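(* Let $M$ be a smooth manifold, $k\in\mathbb{N}$, $r\in\mathbb{N}\cup\{\infty\}$. Let $\{X_d\}_{d\in\mathbb{N}}$ be a sequence of $\mathcal{C}^r$ Gaussian random fields $M\to\mathbb{R}^k$ such that the sequence $\{K_d\}_{d\in\mathbb{N}}$ of the associated covariance functions converges to $K$ in $\mathcal{C}^{r+2,r+2}(M\times M,\mathbb{R}^{k\times k})$. Then there exists a $\mathcal{C}^r$ Gaussian random field $X$ on $M$ with values in $\mathbb{R}^k$ and covariance function $K_X=K$ such that for every Borel set $A\subset \mathcal{C}^r(M,\mathbb{R}^k)$ $$\mathbb{P}(X\in\mathrm{int}(A))\le\liminf_{d\to\infty}\mathbb{P}(X_d\in A)\le\limsup_{d\to\infty}\mathbb{P}(X_d\in A)\le\mathbb{P}(X\in\overline{A}).$$ In particular, if $\mathbb{P}(X\in\partial A)=0$, then $\lim_{d\to\infty}\mathbb{P}(X_d\in A)$ exists and equals $\mathbb{P}(X\in A)$.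
   Context: Manifolds are Hausdorff and second countable, possibly with boundary. $\mathcal{C}^r(M,\mathbb{R}^k)$ has the weak Whitney topology. A $\mathcal{C}^r$ Gaussian random field $X:M\to\mathbb{R}^k$ is a random element of $\mathcal{C}^r(M,\mathbb{R}^k)$ (up to almost sure equality) such that for all finite sets $p_1,\dots,p_j\in M$ the vector $(X(p_1),\dots,X(p_j))\in\mathbb{R}^{jk}$ is a centered (possibly degenerate) Gaussian vector. Its covariance function is $K_X(p,q)=\mathbb{E}\{X(p)X(q)^T\}$. $\mathcal{C}^{s,s}(M\times M,\mathbb{R}^{k\times k})$ is the space of functions $K(x,y)$ having continuous mixed partial derivatives $\partial_x^\alpha\partial_y^\beta K$ for all $|\alpha|,|\beta|\le s$ (in coordinates), with the topology of uniform convergence of all these derivatives on compact sets in product charts; $\infty+2=\infty$. *)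

theory Defs
  imports "HOL-Probability.Probability" "HOL-Library.Extended_Nat"
begin

text \<open>
  As in \<^const>\<open>Euclidean_space\<close>, a point of \<open>\<real>\<^sup>n\<close> is a sequence vanishing from index \<open>n\<close> on, so that
  \<open>n\<close> is an ordinary variable, \<open>n = 0\<close> included. The set \<open>W\<close> below is always relatively open in
  \<open>\<real>\<^sup>n\<close> or in the closed half-space; partial derivatives are taken within \<open>W\<close>, hence are one-sided
  in the normal direction at boundary points.
\<close>

definition partial_deriv ::
    "(nat \<Rightarrow> real) set \<Rightarrow> nat \<Rightarrow> ((nat \<Rightarrow> real) \<Rightarrow> 'b::real_normed_vector) \<Rightarrow> (nat \<Rightarrow> real) \<Rightarrow> 'b" where
  "partial_deriv W i f x =
     vector_derivative (\<lambda>t. f (x(i := t))) (at (x i) within {t. x(i := t) \<in> W})"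

definition partial_differentiable ::
    "(nat \<Rightarrow> real) set \<Rightarrow> nat \<Rightarrow> ((nat \<Rightarrow> real) \<Rightarrow> 'b::real_normed_vector) \<Rightarrow> bool" where
  "partial_differentiable W i f \<longleftrightarrow>
     (\<forall>x\<in>W. (\<lambda>t. f (x(i := t))) differentiable (at (x i) within {t. x(i := t) \<in> W}))"

primrec iter_partial ::
    "(nat \<Rightarrow> real) set \<Rightarrow> nat list \<Rightarrow> ((nat \<Rightarrow> real) \<Rightarrow> 'b::real_normed_vector) \<Rightarrow> (nat \<Rightarrow> real) \<Rightarrow> 'b" where
  "iter_partial W [] f = f"
| "iter_partial W (i # is) f = partial_deriv W i (iter_partial W is f)"

text \<open>Derivatives of order at most \<open>r\<close> are indexed by lists of directions, in arbitrary order and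
  with repetition, rather than by multi-indices.\<close>

definition directions :: "nat \<Rightarrow> enat \<Rightarrow> nat list set" where
  "directions n r = {is. set is \<subseteq> {..<n} \<and> enat (length is) \<le> r}"

definition Cr_on ::
    "nat \<Rightarrow> enat \<Rightarrow> (nat \<Rightarrow> real) set \<Rightarrow> ((nat \<Rightarrow> real) \<Rightarrow> 'b::real_normed_vector) \<Rightarrow> bool" where
  "Cr_on n r W f \<longleftrightarrow>
     (\<forall>is\<in>directions n r. continuous_on W (iter_partial W is f)) \<and>
     (\<forall>i is. i # is \<in> directions n r \<longrightarrow> partial_differentiable W i (iter_partial W is f))"

text \<open>\<open>mixed_partial W W' is js K\<close> is \<open>\<partial>\<^sub>x\<^bsup>is\<^esup> \<partial>\<^sub>y\<^bsup>js\<^esup> K(x, y)\<close>, for \<open>x \<in> W\<close> and \<open>y \<in> W'\<close>.\<close>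

definition mixed_partial ::
    "(nat \<Rightarrow> real) set \<Rightarrow> (nat \<Rightarrow> real) set \<Rightarrow> nat list \<Rightarrow> nat list \<Rightarrow>
     ((nat \<Rightarrow> real) \<times> (nat \<Rightarrow> real) \<Rightarrow> 'b::real_normed_vector) \<Rightarrow> (nat \<Rightarrow> real) \<times> (nat \<Rightarrow> real) \<Rightarrow> 'b" where
  "mixed_partial W W' is js K =
     (\<lambda>(x, y). iter_partial W is (\<lambda>x'. iter_partial W' js (\<lambda>y'. K (x', y')) y) x)"

definition Css_on ::
    "nat \<Rightarrow> enat \<Rightarrow> (nat \<Rightarrow> real) set \<Rightarrow> (nat \<Rightarrow> real) set \<Rightarrow>
     ((nat \<Rightarrow> real) \<times> (nat \<Rightarrow> real) \<Rightarrow> 'b::real_normed_vector) \<Rightarrow> bool" where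
  "Css_on n s W W' K \<longleftrightarrow>
     (\<forall>is\<in>directions n s. \<forall>js\<in>directions n s.
        continuous_on (W \<times> W') (mixed_partial W W' is js K)) \<and>
     (\<forall>j js. j # js \<in> directions n s \<longrightarrow>
        (\<forall>x\<in>W. partial_differentiable W' j (iter_partial W' js (\<lambda>y. K (x, y))))) \<and>
     (\<forall>i is. i # is \<in> directions n s \<longrightarrow> (\<forall>js\<in>directions n s.
        \<forall>y\<in>W'. partial_differentiable W i (\<lambda>x. mixed_partial W W' is js K (x, y))))"

definition half_space :: "nat \<Rightarrow> (nat \<Rightarrow> real) topology" where
  "half_space n = subtopology (Euclidean_space n) {x. 0 \<le> x 0}"

type_synonym 'm chart = "'m set \<times> ('m \<Rightarrow> nat \<Rightarrow> real)"

definition is_chart :: "'m topology \<Rightarrow> nat \<Rightarrow> 'm chart \<Rightarrow> bool" where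
  "is_chart M n = (\<lambda>(U, \<phi>).
     openin M U \<and>
     (openin (Euclidean_space n) (\<phi> ` U) \<or> openin (half_space n) (\<phi> ` U)) \<and>
     homeomorphic_map (subtopology M U) (subtopology (Euclidean_space n) (\<phi> ` U)) \<phi>)"

text \<open>The atlas need not be maximal: the \<open>C\<^sup>r\<close> functions and the topologies defined from an
  atlas below depend only on the smooth structure that it generates.\<close>

definition smooth_atlas :: "'m topology \<Rightarrow> nat \<Rightarrow> 'm chart set \<Rightarrow> bool" where
  "smooth_atlas M n \<A> \<longleftrightarrow>
     (\<forall>c\<in>\<A>. is_chart M n c) \<and>
     (\<Union>(U, \<phi>)\<in>\<A>. U) = topspace M \<and>
     (\<forall>(U, \<phi>)\<in>\<A>. \<forall>(V, \<psi>)\<in>\<A>. \<forall>i<n.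
        Cr_on n \<infinity> (\<phi> ` (U \<inter> V)) (\<lambda>x. \<psi> (inv_into U \<phi> x) i))"

definition smooth_manifold :: "'m topology \<Rightarrow> nat \<Rightarrow> 'm chart set \<Rightarrow> bool" where
  "smooth_manifold M n \<A> \<longleftrightarrow>
     Hausdorff_space M \<and> second_countable M \<and> smooth_atlas M n \<A>"

definition in_chart :: "'m chart \<Rightarrow> ('m \<Rightarrow> 'b) \<Rightarrow> (nat \<Rightarrow> real) \<Rightarrow> 'b" where
  "in_chart = (\<lambda>(U, \<phi>) f x. f (inv_into U \<phi> x))"

definition in_charts ::
    "'m chart \<Rightarrow> 'm chart \<Rightarrow> ('m \<times> 'm \<Rightarrow> 'b) \<Rightarrow> (nat \<Rightarrow> real) \<times> (nat \<Rightarrow> real) \<Rightarrow> 'b" where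
  "in_charts = (\<lambda>(U, \<phi>) (V, \<psi>) K (x, y). K (inv_into U \<phi> x, inv_into V \<psi> y))"

definition chart_image :: "'m chart \<Rightarrow> (nat \<Rightarrow> real) set" where
  "chart_image = (\<lambda>(U, \<phi>). \<phi> ` U)"

text \<open>The topology on a set \<open>S\<close> of functions generated by the sets
  \<open>{g \<in> S. |D g - D f| < e on C}\<close>, where \<open>f \<in> S\<close>, \<open>e > 0\<close> and \<open>(D, C)\<close> ranges over the given
  pairs of an operator and a set.\<close>

definition uniform_on_topology ::
    "'f set \<Rightarrow> (('f \<Rightarrow> 'x \<Rightarrow> 'b::real_normed_vector) \<times> 'x set) set \<Rightarrow> 'f topology" where
  "uniform_on_topology S \<D> = topology_generated_by
     (insert S {{g\<in>S. \<forall>x\<in>C. norm (D g x - D f x) < e} | f D C e. f \<in> S \<and> (D, C) \<in> \<D> \<and> 0 < e})"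

definition Cr_space ::
    "'m topology \<Rightarrow> nat \<Rightarrow> 'm chart set \<Rightarrow> enat \<Rightarrow> ('m \<Rightarrow> 'b::real_normed_vector) set" where
  "Cr_space M n \<A> r =
     {f \<in> extensional (topspace M). \<forall>c\<in>\<A>. Cr_on n r (chart_image c) (in_chart c f)}"

definition weak_Whitney ::
    "'m topology \<Rightarrow> nat \<Rightarrow> 'm chart set \<Rightarrow> enat \<Rightarrow> ('m \<Rightarrow> 'b::real_normed_vector) topology" where
  "weak_Whitney M n \<A> r = uniform_on_topology (Cr_space M n \<A> r)
     {(\<lambda>f. iter_partial (chart_image c) is (in_chart c f), C) | c is C.
        c \<in> \<A> \<and> is \<in> directions n r \<and> compact C \<and> C \<subseteq> chart_image c}"

definition Css_space ::
    "'m topology \<Rightarrow> nat \<Rightarrow> 'm chart set \<Rightarrow> enat \<Rightarrow> ('m \<times> 'm \<Rightarrow> 'b::real_normed_vector) set" where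
  "Css_space M n \<A> s =
     {K \<in> extensional (topspace M \<times> topspace M).
        \<forall>c\<in>\<A>. \<forall>c'\<in>\<A>. Css_on n s (chart_image c) (chart_image c') (in_charts c c' K)}"

definition Css_topology ::
    "'m topology \<Rightarrow> nat \<Rightarrow> 'm chart set \<Rightarrow> enat \<Rightarrow> ('m \<times> 'm \<Rightarrow> 'b::real_normed_vector) topology" where
  "Css_topology M n \<A> s = uniform_on_topology (Css_space M n \<A> s)
     {(\<lambda>K. mixed_partial (chart_image c) (chart_image c') is js (in_charts c c' K), C) | c c' is js C.
        c \<in> \<A> \<and> c' \<in> \<A> \<and> is \<in> directions n s \<and> js \<in> directions n s \<and>
        compact C \<and> C \<subseteq> chart_image c \<times> chart_image c'}"

lemma topspace_uniform_on_topology [simp]: "topspace (uniform_on_topology S \<D>) = S"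
  unfolding uniform_on_topology_def topology_generated_by_topspace by auto

lemma topspace_weak_Whitney [simp]: "topspace (weak_Whitney M n \<A> r) = Cr_space M n \<A> r"
  by (simp add: weak_Whitney_def)

lemma topspace_Css_topology [simp]: "topspace (Css_topology M n \<A> s) = Css_space M n \<A> s"
  by (simp add: Css_topology_def)

definition borel_of :: "'a topology \<Rightarrow> 'a measure" where
  "borel_of T = sigma (topspace T) {U. openin T U}"

text \<open>Normal with mean \<open>0\<close> and variance \<open>\<ge> 0\<close>; the first disjunct is variance \<open>0\<close>.\<close>

definition centered_gaussian_rv :: "'w measure \<Rightarrow> ('w \<Rightarrow> real) \<Rightarrow> bool" where
  "centered_gaussian_rv P Y \<longleftrightarrow>
     Y \<in> borel_measurable P \<and>
     ((AE \<omega> in P. Y \<omega> = 0) \<or> (\<exists>\<sigma>>0. distributed P lborel Y (normal_density 0 \<sigma>)))"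

text \<open>The family \<open>(Y p)\<close>, \<open>p \<in> F\<close>, regarded as one random vector with \<open>card F * CARD('k)\<close> real entries,
  is Gaussian if every linear functional of it is.\<close>

definition centered_gaussian_vector ::
    "'w measure \<Rightarrow> 'i set \<Rightarrow> ('i \<Rightarrow> 'w \<Rightarrow> real ^ 'k) \<Rightarrow> bool" where
  "centered_gaussian_vector P F Y \<longleftrightarrow>
     (\<forall>a :: 'i \<Rightarrow> real ^ 'k. centered_gaussian_rv P (\<lambda>\<omega>. \<Sum>p\<in>F. a p \<bullet> Y p \<omega>))"

definition gaussian_random_field ::
    "'m topology \<Rightarrow> nat \<Rightarrow> 'm chart set \<Rightarrow> enat \<Rightarrow> 'w measure \<Rightarrow> ('w \<Rightarrow> 'm \<Rightarrow> real ^ 'k) \<Rightarrow> bool" where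
  "gaussian_random_field M n \<A> r P X \<longleftrightarrow>
     prob_space P \<and>
     X \<in> measurable P (borel_of (weak_Whitney M n \<A> r)) \<and>
     (\<forall>F. finite F \<and> F \<subseteq> topspace M \<longrightarrow> centered_gaussian_vector P F (\<lambda>p \<omega>. X \<omega> p))"

definition covariance_function ::
    "'m topology \<Rightarrow> 'w measure \<Rightarrow> ('w \<Rightarrow> 'm \<Rightarrow> real ^ 'k) \<Rightarrow> 'm \<times> 'm \<Rightarrow> real ^ 'k ^ 'k" where
  "covariance_function M P X = restrict
     (\<lambda>(p, q). \<chi> i j. integral\<^sup>L P (\<lambda>\<omega>. X \<omega> p $ i * X \<omega> q $ j))
     (topspace M \<times> topspace M)"

definition law_prob :: "'w measure \<Rightarrow> ('w \<Rightarrow> 'f) \<Rightarrow> 'f set \<Rightarrow> real" where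
  "law_prob P X A = measure P {\<omega> \<in> space P. X \<omega> \<in> A}"

end

theory Submission
  imports Defs
begin

text \<open>
  A \<open>C\<^sup>r\<close> field is described by countably many real coordinates: the values of its derivatives of order
  at most \<open>r\<close> at the dyadic points of countably many cubes that cover \<open>M\<close> in charts. The coordinates of
  \<open>X\<^sub>d\<close> are jointly Gaussian, and their covariances are mixed partial derivatives of \<open>K\<^sub>d\<close>, so they converge.
  If \<open>L\<^sub>d\<close> are lower triangular factors of these covariances and \<open>\<zeta>\<close> is a sequence of independent standard
  normal variables, then \<open>L\<^sub>d \<zeta>\<close> has the law of the coordinates of \<open>X\<^sub>d\<close> and, along subsequences, \<open>L\<^sub>d\<close>
  and hence \<open>L\<^sub>d \<zeta>\<close> converge pointwise. Since a Gaussian law is determined by its covariance, this gives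
  the limit law of the coordinates, and the upper bound of the portmanteau theorem for closed sets of
  sequences.

  It remains to return to \<open>C\<^sup>r\<close>. The covariances of the derivatives of order at most \<open>r\<close> are Lipschitz,
  uniformly in \<open>d\<close>, so Gaussian moments and chaining bound the increments of these derivatives along the
  dyadic grids with probability close to \<open>1\<close>. For fields with such bounds, pointwise convergence of the
  coordinates is uniform convergence of all derivatives on the cubes, and by the chain rule
  convergence in the weak Whitney topology. Hence closed sets of fields correspond to closed sets of
  sequences, and the limit law is carried by \<open>C\<^sup>r\<close> fields.
\<close>

section \<open>Gaussian random variables and their limits\<close>

text \<open>Each row of a triangular factor is bounded by the diagonal of the covariance, so factors
  have convergent subsequences; different subsequences may give different factors, but only one law.
  Triangularity makes every coordinate a finite sum, so the coupled variables converge for every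
  value of the noise. Tightness enters only in the passage to C^r functions, and in a weak form:
  closed sets of sequences take the place of compact ones. A Lipschitz covariance gives variances of
  order 2^-m for increments over the mesh 2^-m. Moments of order 2p bound these increments by
  (7/8)^m off an event of probability O(2^-m), once p is so large that the roughly 2^(nm) grid steps
  of level m do no harm. Derivatives of a field are pointwise limits of difference quotients. For
  Gaussian variables such limits carry covariances along, which exchanges derivative and expectation
  without a dominating function. Charts may end in a half-space, where derivatives are one-sided and
  taken along coordinate lines. Closed cubes are therefore the basic domains: their lines are
  intervals, and coordinatewise paths stay inside.\<close>

abbreviation "N01 \<equiv> std_normal_distribution"

lemma prob_space_std_normal: "prob_space N01"
  using prob_space_normal_density by simp

text \<open>Allowing \<sigma> = 0 merges the degenerate case with the others, so that moments and
  characteristic functions need no case distinction later.\<close>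

lemma centered_gaussian_rv_iff_scaled:
  assumes P: "prob_space P"
  shows "centered_gaussian_rv P Y \<longleftrightarrow>
    Y \<in> borel_measurable P \<and> (\<exists>\<sigma>\<ge>0. distr P borel Y = distr N01 borel (\<lambda>x. \<sigma> * x))"
proof -
  interpret prob_space P by (rule P)
  interpret N: prob_space N01 by (rule prob_space_std_normal)
  have zero: "(AE \<omega> in P. Y \<omega> = 0) \<longleftrightarrow> distr P borel Y = distr N01 borel (\<lambda>x. 0 * x)"
    if Y: "Y \<in> borel_measurable P"
  proof
    assume "AE \<omega> in P. Y \<omega> = 0"
    then have "distr P borel Y = distr P borel (\<lambda>_. 0)"
      by (intro distr_cong_AE) (use Y in auto)
    then show "distr P borel Y = distr N01 borel (\<lambda>x. 0 * x)"
      by (simp add: distr_const N.distr_const)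
  next
    assume eq: "distr P borel Y = distr N01 borel (\<lambda>x. 0 * x)"
    have "AE x in distr N01 borel (\<lambda>x. 0 * x). x = (0::real)"
      by (subst AE_distr_iff) auto
    then have "AE x in distr P borel Y. x = (0::real)"
      unfolding eq .
    then show "AE \<omega> in P. Y \<omega> = 0"
      using Y by (rule AE_distrD[rotated])
  qed
  have pos: "distributed P lborel Y (normal_density 0 \<sigma>) \<longleftrightarrow>
      distr P borel Y = distr N01 borel (\<lambda>x. \<sigma> * x)"
    if Y: "Y \<in> borel_measurable P" and s: "\<sigma> > 0" for \<sigma>
  proof -
    have lb: "distr P lborel Z = distr P borel Z" for Z by (intro distr_cong) auto
    have "distributed P lborel Y (normal_density 0 \<sigma>) \<longleftrightarrow>
        distributed P lborel (\<lambda>x. Y x / \<sigma>) std_normal_density"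
      using normal_standard_normal_convert[OF s, of Y 0] by simp
    also have "\<dots> \<longleftrightarrow> distr P borel (\<lambda>x. Y x / \<sigma>) = N01"
      using Y by (simp add: distributed_def lb)
    also have "\<dots> \<longleftrightarrow> distr P borel Y = distr N01 borel (\<lambda>x. \<sigma> * x)"
    proof
      assume "distr P borel (\<lambda>x. Y x / \<sigma>) = N01"
      then have "distr (distr P borel (\<lambda>x. Y x / \<sigma>)) borel (\<lambda>x. \<sigma> * x) = distr N01 borel (\<lambda>x. \<sigma> * x)"
        by simp
      then show "distr P borel Y = distr N01 borel (\<lambda>x. \<sigma> * x)"
        using Y s by (simp add: distr_distr comp_def)
    next
      assume "distr P borel Y = distr N01 borel (\<lambda>x. \<sigma> * x)"
      then have "distr (distr P borel Y) borel (\<lambda>x. x / \<sigma>)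
          = distr (distr N01 borel (\<lambda>x. \<sigma> * x)) borel (\<lambda>x. x / \<sigma>)"
        by simp
      then have "distr P borel (\<lambda>x. Y x / \<sigma>) = distr N01 borel (\<lambda>x. x)"
        using Y s by (simp add: distr_distr comp_def)
      also have "\<dots> = N01" by (rule distr_id2) simp
      finally show "distr P borel (\<lambda>x. Y x / \<sigma>) = N01" .
    qed
    finally show ?thesis .
  qed
  show ?thesis
    unfolding centered_gaussian_rv_def using zero pos by (metis less_eq_real_def)
qed

text \<open>All four follow by writing the law of \<open>Y\<close> as that of a multiple of a
  standard normal variable. The factor in the even moments is the double factorial (2k -
  1)!!.\<close>

lemma
  assumes P: "prob_space P" and Y: "centered_gaussian_rv P Y"
  shows gaussian_measurable: "Y \<in> borel_measurable P"
    and gaussian_integrable_power: "integrable P (\<lambda>\<omega>. Y \<omega> ^ k)"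
    and gaussian_even_moment: "(\<integral>\<omega>. Y \<omega> ^ (2 * k) \<partial>P) = fact (2 * k) / (2 ^ k * fact k) * (\<integral>\<omega>. (Y \<omega>)\<^sup>2 \<partial>P) ^ k"
    and gaussian_char: "(CLINT \<omega>|P. iexp (t * Y \<omega>)) = exp (- (t\<^sup>2 * (\<integral>\<omega>. (Y \<omega>)\<^sup>2 \<partial>P)) / 2)"
proof -
  from Y obtain s where [measurable]: "Y \<in> borel_measurable P" and s: "s \<ge> 0"
    and eq: "distr P borel Y = distr N01 borel (\<lambda>x. s * x)"
    unfolding centered_gaussian_rv_iff_scaled[OF P] by auto
  show "Y \<in> borel_measurable P" by fact
  have "integrable (distr P borel Y) (\<lambda>x. x ^ k)"
    unfolding eq by (subst integrable_distr_eq)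
      (auto simp: power_mult_distrib integrable_std_normal_distribution_moment)
  then show "integrable P (\<lambda>\<omega>. Y \<omega> ^ k)" by (subst (asm) integrable_distr_eq) auto
  have mom: "(\<integral>\<omega>. Y \<omega> ^ (2 * j) \<partial>P) = s ^ (2 * j) * (fact (2 * j) / (2 ^ j * fact j))" for j
  proof -
    have "(\<integral>\<omega>. Y \<omega> ^ (2 * j) \<partial>P) = (\<integral>x. x ^ (2 * j) \<partial>distr P borel Y)"
      by (subst integral_distr) auto
    also have "\<dots> = (\<integral>x. (s * x) ^ (2 * j) \<partial>N01)"
      unfolding eq by (subst integral_distr) auto
    finally show ?thesis
      by (simp add: power_mult_distrib std_normal_distribution_even_moments(1) del: integral_density)
  qed
  have v: "(\<integral>\<omega>. (Y \<omega>)\<^sup>2 \<partial>P) = s\<^sup>2"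
    using mom[of 1] by simp
  show "(\<integral>\<omega>. Y \<omega> ^ (2 * k) \<partial>P) = fact (2 * k) / (2 ^ k * fact k) * (\<integral>\<omega>. (Y \<omega>)\<^sup>2 \<partial>P) ^ k"
    unfolding mom v by (simp add: power_mult)
  have "(CLINT \<omega>|P. iexp (t * Y \<omega>)) = (CLINT x|distr P borel Y. iexp (t * x))"
    by (subst integral_distr) auto
  also have "\<dots> = (CLINT x|N01. iexp (t * (s * x)))"
    unfolding eq by (subst integral_distr) auto
  also have "\<dots> = char N01 (t * s)"
    unfolding char_def by (simp add: mult_ac del: integral_density)
  finally show "(CLINT \<omega>|P. iexp (t * Y \<omega>)) = exp (- (t\<^sup>2 * (\<integral>\<omega>. (Y \<omega>)\<^sup>2 \<partial>P)) / 2)"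
    unfolding char_std_normal_distribution v by (simp add: power_mult_distrib exp_of_real)
qed

lemma gaussianI_char:
  assumes P: "prob_space P" and Y[measurable]: "Y \<in> borel_measurable P" and v: "v \<ge> 0"
    and ch: "\<And>t. (CLINT \<omega>|P. iexp (t * Y \<omega>)) = exp (- (t\<^sup>2 * v) / 2)"
  shows "centered_gaussian_rv P Y"
proof -
  interpret prob_space P by (rule P)
  interpret N: prob_space N01 by (rule prob_space_std_normal)
  have "char (distr P borel Y) = char (distr N01 borel (\<lambda>x. sqrt v * x))"
  proof
    fix t
    have "char (distr P borel Y) t = exp (- (t\<^sup>2 * v) / 2)"
      unfolding char_def using ch by (subst integral_distr) auto
    moreover have "char (distr N01 borel (\<lambda>x. sqrt v * x)) t = char N01 (t * sqrt v)"
      unfolding char_def by (subst integral_distr) (auto simp: mult_ac)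
    ultimately show "char (distr P borel Y) t = char (distr N01 borel (\<lambda>x. sqrt v * x)) t"
      unfolding char_std_normal_distribution using v by (simp add: power_mult_distrib exp_of_real)
  qed
  then have "distr P borel Y = distr N01 borel (\<lambda>x. sqrt v * x)"
    by (intro Levy_uniqueness real_distribution_distr N.real_distribution_distr) auto
  then show ?thesis
    unfolding centered_gaussian_rv_iff_scaled[OF P] using v by (auto intro!: exI[of _ "sqrt v"])
qed

text \<open>Characteristic functions converge by dominated convergence. Their exponents are
  proportional to the variances, so the variances converge too, and the limit has a Gaussian
  characteristic function.\<close>

lemma gaussian_lim:
  assumes P: "prob_space P" and Y: "\<And>n. centered_gaussian_rv P (Y n)"
    and lim: "\<And>\<omega>. \<omega> \<in> space P \<Longrightarrow> (\<lambda>n. Y n \<omega>) \<longlonglongrightarrow> Z \<omega>"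
  shows "centered_gaussian_rv P Z"
    and "(\<lambda>n. \<integral>\<omega>. (Y n \<omega>)\<^sup>2 \<partial>P) \<longlonglongrightarrow> (\<integral>\<omega>. (Z \<omega>)\<^sup>2 \<partial>P)"
proof -
  interpret prob_space P by (rule P)
  have [measurable]: "Y n \<in> borel_measurable P" for n by (rule gaussian_measurable[OF P Y])
  have [measurable]: "Z \<in> borel_measurable P"
    by (rule borel_measurable_LIMSEQ_real[OF lim]) auto
  define v where "v n = (\<integral>\<omega>. (Y n \<omega>)\<^sup>2 \<partial>P)" for n
  have v0: "v n \<ge> 0" for n by (simp add: v_def)
  let ?c = "\<lambda>t. CLINT \<omega>|P. iexp (t * Z \<omega>)"
  have conv: "(\<lambda>n. complex_of_real (exp (- (t\<^sup>2 * v n) / 2))) \<longlonglongrightarrow> ?c t" for t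
  proof -
    have "(\<lambda>n. CLINT \<omega>|P. iexp (t * Y n \<omega>)) \<longlonglongrightarrow> ?c t"
      by (rule integral_dominated_convergence[where w="\<lambda>_. 1"])
         (auto intro!: tendsto_intros lim AE_I2)
    then show ?thesis unfolding gaussian_char[OF P Y] v_def .
  qed
  define q where "q t = Re (?c t)" for t
  have convr: "(\<lambda>n. exp (- (t\<^sup>2 * v n) / 2)) \<longlonglongrightarrow> q t" for t
    using tendsto_Re[OF conv[of t]] by (simp add: q_def)
  have ceq: "?c t = of_real (q t)" for t
    using LIMSEQ_unique[OF conv tendsto_of_real[OF convr]] by blast
  \<comment> \<open>This excludes variances that tend to infinity: if \<open>q 1 = 0\<close>, the
    limiting characteristic function vanishes off 0, against its continuity at 0 and its value 1
    there.\<close>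
  have "q 1 > 0"
  proof (rule ccontr)
    assume "\<not> q 1 > 0"
    moreover have "q 1 \<ge> 0" by (rule LIMSEQ_le_const[OF convr]) auto
    ultimately have q1: "q 1 = 0" by simp
    have q0: "q t = 0" if "t \<noteq> 0" for t
    proof -
      \<comment> \<open>A centred Gaussian characteristic function at \<open>t\<close> is its value
        at 1 raised to the power t squared.\<close>
      have "(\<lambda>n. exp (- (1\<^sup>2 * v n) / 2) powr (t\<^sup>2)) \<longlonglongrightarrow> q 1 powr t\<^sup>2"
        using convr[of 1] that q1 by (intro tendsto_powr2) auto
      then have "(\<lambda>n. exp (- (t\<^sup>2 * v n) / 2)) \<longlonglongrightarrow> 0"
        using q1 that by (simp add: powr_def mult_ac)
      then show ?thesis using convr[of t] LIMSEQ_unique by blast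
    qed
    interpret Z: real_distribution "distr P borel Z" by (rule real_distribution_distr) simp
    have "isCont (char (distr P borel Z)) 0" by (rule Z.isCont_char)
    moreover have ch: "char (distr P borel Z) t = of_real (q t)" for t
      unfolding char_def using ceq by (subst integral_distr) auto
    moreover have "char (distr P borel Z) = (\<lambda>t. of_real (q t))" using ch by blast
    ultimately have "isCont (\<lambda>t. complex_of_real (q t)) 0" by simp
    then have "((\<lambda>t. complex_of_real (q t)) \<longlongrightarrow> of_real (q 0)) (at 0)" by (simp add: isCont_def)
    then have "((\<lambda>t::real. 0::complex) \<longlongrightarrow> of_real (q 0)) (at 0)"
      by (rule Lim_transform_eventually) (auto simp: eventually_at_filter q0)
    then have "complex_of_real (q 0) = 0"
      by (simp add: tendsto_const_iff)
    moreover have "complex_of_real (q 0) = 1" using ch[of 0] Z.char_zero by simp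
    ultimately show False by simp
  qed
  \<comment> \<open>The limit variance, read off from the limiting characteristic function at
    1.\<close>
  define w where "w = - 2 * ln (q 1)"
  have vw: "v \<longlonglongrightarrow> w"
  proof -
    have "(\<lambda>n. - 2 * ln (exp (- (1\<^sup>2 * v n) / 2))) \<longlonglongrightarrow> w"
      unfolding w_def using \<open>q 1 > 0\<close> by (intro tendsto_intros convr) auto
    then show ?thesis by simp
  qed
  have w0: "w \<ge> 0" by (rule LIMSEQ_le_const[OF vw]) (auto simp: v0)
  have "(\<lambda>n. exp (- (t\<^sup>2 * v n) / 2)) \<longlonglongrightarrow> exp (- (t\<^sup>2 * w) / 2)" for t
    by (intro tendsto_intros vw) auto
  then have cw: "?c t = exp (- (t\<^sup>2 * w) / 2)" for t
    using LIMSEQ_unique[OF convr] ceq by metis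
  show Z: "centered_gaussian_rv P Z"
    by (rule gaussianI_char[OF P _ w0]) (use cw in auto)
  have "of_real (exp (- (1\<^sup>2 * w) / 2)) = complex_of_real (exp (- (1\<^sup>2 * (\<integral>\<omega>. (Z \<omega>)\<^sup>2 \<partial>P)) / 2))"
    using cw[of 1] gaussian_char[OF P Z, of 1] by simp
  then have "w = (\<integral>\<omega>. (Z \<omega>)\<^sup>2 \<partial>P)"
    by (simp only: of_real_eq_iff exp_inj_iff) simp
  then show "(\<lambda>n. \<integral>\<omega>. (Y n \<omega>)\<^sup>2 \<partial>P) \<longlonglongrightarrow> (\<integral>\<omega>. (Z \<omega>)\<^sup>2 \<partial>P)"
    using vw by (simp add: v_def[abs_def])
qed

section \<open>Linear spaces of jointly Gaussian variables and their pointwise limits\<close>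

definition gaussian_space :: "'w measure \<Rightarrow> ('w \<Rightarrow> real) set \<Rightarrow> bool" where
  "gaussian_space P V \<longleftrightarrow> (\<forall>Y\<in>V. centered_gaussian_rv P Y) \<and>
     (\<forall>Y\<in>V. \<forall>Z\<in>V. (\<lambda>\<omega>. Y \<omega> + Z \<omega>) \<in> V) \<and> (\<forall>c. \<forall>Y\<in>V. (\<lambda>\<omega>. c * Y \<omega>) \<in> V)"

lemma gaussian_space_rv: "gaussian_space P V \<Longrightarrow> Y \<in> V \<Longrightarrow> centered_gaussian_rv P Y"
  unfolding gaussian_space_def by blast

lemma gaussian_space_add:
  "gaussian_space P V \<Longrightarrow> Y \<in> V \<Longrightarrow> Z \<in> V \<Longrightarrow> (\<lambda>\<omega>. Y \<omega> + Z \<omega>) \<in> V"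
  unfolding gaussian_space_def by blast

lemma gaussian_space_scale: "gaussian_space P V \<Longrightarrow> Y \<in> V \<Longrightarrow> (\<lambda>\<omega>. c * Y \<omega>) \<in> V"
  unfolding gaussian_space_def by blast

text \<open>Convergence is demanded at every sample point, not almost surely or in mean square: this
  is how difference quotients of differentiable sample functions converge. Iterating the operation
  reaches derivatives of higher order.\<close>

definition pointwise_limits :: "'w measure \<Rightarrow> ('w \<Rightarrow> real) set \<Rightarrow> ('w \<Rightarrow> real) set" where
  "pointwise_limits P V = {Z. \<exists>Y. (\<forall>n. Y n \<in> V) \<and> (\<forall>\<omega>\<in>space P. (\<lambda>n::nat. Y n \<omega>) \<longlonglongrightarrow> Z \<omega>)}"

lemma pointwise_limits_subset: "V \<subseteq> pointwise_limits P V"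
proof
  fix Y assume "Y \<in> V"
  then show "Y \<in> pointwise_limits P V"
    unfolding pointwise_limits_def by (intro CollectI exI[of _ "\<lambda>_. Y"]) auto
qed

lemma gaussian_space_limits:
  assumes P: "prob_space P" and V: "gaussian_space P V"
  shows "gaussian_space P (pointwise_limits P V)"
  unfolding gaussian_space_def
proof (intro conjI ballI allI)
  fix Z assume "Z \<in> pointwise_limits P V"
  then obtain Y where "\<And>n. Y n \<in> V" and "\<And>\<omega>. \<omega> \<in> space P \<Longrightarrow> (\<lambda>n::nat. Y n \<omega>) \<longlonglongrightarrow> Z \<omega>"
    unfolding pointwise_limits_def mem_Collect_eq by blast
  then show "centered_gaussian_rv P Z"
    using gaussian_space_rv[OF V] gaussian_lim(1)[OF P, of Y Z] by blast
next
  fix Z Z' assume "Z \<in> pointwise_limits P V" "Z' \<in> pointwise_limits P V"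
  then obtain Y Y' where "\<And>n. Y n \<in> V" "\<And>\<omega>. \<omega> \<in> space P \<Longrightarrow> (\<lambda>n::nat. Y n \<omega>) \<longlonglongrightarrow> Z \<omega>"
    "\<And>n. Y' n \<in> V" "\<And>\<omega>. \<omega> \<in> space P \<Longrightarrow> (\<lambda>n::nat. Y' n \<omega>) \<longlonglongrightarrow> Z' \<omega>"
    unfolding pointwise_limits_def mem_Collect_eq by blast
  then show "(\<lambda>\<omega>. Z \<omega> + Z' \<omega>) \<in> pointwise_limits P V"
    unfolding pointwise_limits_def
    by (intro CollectI exI[of _ "\<lambda>n \<omega>. Y n \<omega> + Y' n \<omega>"] conjI allI ballI
          tendsto_add gaussian_space_add[OF V])
next
  fix Z and c :: real assume "Z \<in> pointwise_limits P V"
  then obtain Y where "\<And>n. Y n \<in> V" and "\<And>\<omega>. \<omega> \<in> space P \<Longrightarrow> (\<lambda>n::nat. Y n \<omega>) \<longlonglongrightarrow> Z \<omega>"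
    unfolding pointwise_limits_def mem_Collect_eq by blast
  then show "(\<lambda>\<omega>. c * Z \<omega>) \<in> pointwise_limits P V"
    unfolding pointwise_limits_def
    by (intro CollectI exI[of _ "\<lambda>n \<omega>. c * Y n \<omega>"] conjI allI ballI
          tendsto_mult_left gaussian_space_scale[OF V])
qed

text \<open>Two members of the union lie in a common \<open>V m\<close>, because the spaces
  increase.\<close>

lemma gaussian_space_UN:
  assumes "\<And>m::nat. gaussian_space P (V m)" "\<And>m. V m \<subseteq> V (Suc m)"
  shows "gaussian_space P (\<Union>m. V m)"
proof -
  have mono: "V m \<subseteq> V n" if "m \<le> n" for m n
    using that assms(2) by (metis lift_Suc_mono_le)
  have "(\<lambda>\<omega>. Y \<omega> + Z \<omega>) \<in> (\<Union>m. V m)" if "Y \<in> V m" "Z \<in> V n" for Y Z m n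
  proof -
    have "Y \<in> V (max m n)" "Z \<in> V (max m n)"
      using that mono[of m "max m n"] mono[of n "max m n"] by auto
    then show ?thesis using gaussian_space_add[OF assms(1)] by blast
  qed
  then show ?thesis
    using assms(1) unfolding gaussian_space_def by blast
qed

lemma gaussian_space_diff:
  assumes "gaussian_space P V" "Y \<in> V" "Z \<in> V"
  shows "(\<lambda>\<omega>. Y \<omega> - Z \<omega>) \<in> V"
proof -
  have "(\<lambda>\<omega>. Y \<omega> + (-1) * Z \<omega>) \<in> V"
    by (rule gaussian_space_add[OF assms(1,2) gaussian_space_scale[OF assms(1,3)]])
  then show ?thesis by simp
qed

text \<open>\<open>F\<close> is nonempty because a \<open>gaussian_space\<close> may be empty and
  then lacks the empty sum 0.\<close>

lemma gaussian_space_sum: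
  assumes "gaussian_space P V" "finite F" "F \<noteq> {}" "\<And>i. i \<in> F \<Longrightarrow> Y i \<in> V"
  shows "(\<lambda>\<omega>. \<Sum>i\<in>F. Y i \<omega>) \<in> V"
  using assms(2-4)
proof (induction rule: finite_ne_induct)
  case (insert x F)
  then show ?case using gaussian_space_add[OF assms(1), of "Y x" "\<lambda>\<omega>. \<Sum>i\<in>F. Y i \<omega>"] by simp
qed simp

lemma gaussian_space_comb:
  assumes "gaussian_space P V" "finite F" "F \<noteq> {}" "\<And>i. i \<in> F \<Longrightarrow> Y i \<in> V"
  shows "(\<lambda>\<omega>. \<Sum>i\<in>F. a i * Y i \<omega>) \<in> V"
  by (rule gaussian_space_sum[OF assms(1-3)]) (use assms in \<open>blast intro: gaussian_space_scale\<close>)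


lemma integrable_square_mult:
  fixes f g :: "'a \<Rightarrow> real"
  assumes [measurable]: "f \<in> borel_measurable M" "g \<in> borel_measurable M"
    and "integrable M (\<lambda>x. (f x)\<^sup>2)" "integrable M (\<lambda>x. (g x)\<^sup>2)"
  shows "integrable M (\<lambda>x. f x * g x)"
proof (rule Bochner_Integration.integrable_bound)
  show "integrable M (\<lambda>x. (f x)\<^sup>2 + (g x)\<^sup>2)" using assms by simp
  show "AE x in M. norm (f x * g x) \<le> norm ((f x)\<^sup>2 + (g x)\<^sup>2)"
  proof (rule AE_I2)
    fix x
    have "0 \<le> (\<bar>f x\<bar> - \<bar>g x\<bar>)\<^sup>2" by simp
    then have "2 * (\<bar>f x\<bar> * \<bar>g x\<bar>) \<le> (f x)\<^sup>2 + (g x)\<^sup>2" by (simp add: power2_diff)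
    moreover have "0 \<le> \<bar>f x\<bar> * \<bar>g x\<bar>" by (intro mult_nonneg_nonneg) auto
    ultimately have "\<bar>f x\<bar> * \<bar>g x\<bar> \<le> (f x)\<^sup>2 + (g x)\<^sup>2" by linarith
    then show "norm (f x * g x) \<le> norm ((f x)\<^sup>2 + (g x)\<^sup>2)" by (simp add: abs_mult)
  qed
qed simp

lemma gaussian_integrable_mult:
  assumes "prob_space P" "centered_gaussian_rv P Y" "centered_gaussian_rv P Z"
  shows "integrable P (\<lambda>\<omega>. Y \<omega> * Z \<omega>)"
  using assms by (intro integrable_square_mult gaussian_integrable_power gaussian_measurable)

text \<open>\<open>gaussian_lim\<close> controls second moments only. Polarization turns this into
  convergence of covariances, since \<open>Y n + W\<close> lies in the Gaussian space as
  well.\<close>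

lemma gaussian_cov_lim:
  assumes P: "prob_space P" and V: "gaussian_space P V"
    and Y: "\<And>n. Y n \<in> V" and Z: "Z \<in> V" and W: "W \<in> V"
    and lim: "\<And>\<omega>. \<omega> \<in> space P \<Longrightarrow> (\<lambda>n. Y n \<omega>) \<longlonglongrightarrow> Z \<omega>"
  shows "(\<lambda>n. \<integral>\<omega>. Y n \<omega> * W \<omega> \<partial>P) \<longlonglongrightarrow> (\<integral>\<omega>. Z \<omega> * W \<omega> \<partial>P)"
proof -
  note g = gaussian_space_rv[OF V]
  have pol: "(\<integral>\<omega>. U \<omega> * W \<omega> \<partial>P) =
      ((\<integral>\<omega>. (U \<omega> + W \<omega>)\<^sup>2 \<partial>P) - (\<integral>\<omega>. (U \<omega>)\<^sup>2 \<partial>P) - (\<integral>\<omega>. (W \<omega>)\<^sup>2 \<partial>P)) / 2"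
    if U: "U \<in> V" for U
  proof -
    have "(\<integral>\<omega>. (U \<omega> + W \<omega>)\<^sup>2 \<partial>P) = (\<integral>\<omega>. (U \<omega>)\<^sup>2 + (W \<omega>)\<^sup>2 + 2 * (U \<omega> * W \<omega>) \<partial>P)"
      by (simp add: power2_sum mult_ac)
    also have "\<dots> = (\<integral>\<omega>. (U \<omega>)\<^sup>2 \<partial>P) + (\<integral>\<omega>. (W \<omega>)\<^sup>2 \<partial>P) + 2 * (\<integral>\<omega>. U \<omega> * W \<omega> \<partial>P)"
      using gaussian_integrable_power[OF P g[OF U], of 2] gaussian_integrable_power[OF P g[OF W], of 2]
        gaussian_integrable_mult[OF P g[OF U] g[OF W]] by simp
    finally show ?thesis by simp
  qed
  have "(\<lambda>n. \<integral>\<omega>. (Y n \<omega> + W \<omega>)\<^sup>2 \<partial>P) \<longlonglongrightarrow> (\<integral>\<omega>. (Z \<omega> + W \<omega>)\<^sup>2 \<partial>P)"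
    by (intro gaussian_lim(2)[OF P] tendsto_intros lim gaussian_space_rv[OF V] gaussian_space_add[OF V] Y W)
  moreover have "(\<lambda>n. \<integral>\<omega>. (Y n \<omega>)\<^sup>2 \<partial>P) \<longlonglongrightarrow> (\<integral>\<omega>. (Z \<omega>)\<^sup>2 \<partial>P)"
    using Y by (intro gaussian_lim(2)[OF P] lim g)
  ultimately show ?thesis
    unfolding pol[OF Y] pol[OF Z] by (intro tendsto_intros) auto
qed

section \<open>Gaussian laws of sequences\<close>

lemma tendsto_fun_iff:
  fixes f :: "'a \<Rightarrow> 'i \<Rightarrow> 'b::topological_space"
  shows "(f \<longlongrightarrow> l) F \<longleftrightarrow> (\<forall>i. ((\<lambda>x. f x i) \<longlongrightarrow> l i) F)"
  using limitin_componentwise[of "\<lambda>_. euclidean" UNIV f l F]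
  by (simp add: euclidean_product_topology)

section \<open>Laws of sequences are determined by their characteristic functionals\<close>

lemma integrable_bounded_mult_iexp:
  assumes "prob_space M" and [measurable]: "W \<in> borel_measurable M" "f \<in> borel_measurable M"
    and "\<And>x. \<bar>W x\<bar> \<le> (C::real)"
  shows "integrable M (\<lambda>x. of_real (W x) * iexp (f x))"
proof -
  interpret prob_space M by fact
  show ?thesis
    by (rule integrable_const_bound[of _ C]) (auto simp: norm_mult assms(4) intro!: AE_I2)
qed

text \<open>Divided by its total mass, the nonnegative weight \<open>W\<close> is a probability
  density, and the image under \<open>f\<close> of the resulting measure is determined by its
  characteristic function. The total masses under \<open>M\<close> and \<open>M'\<close> agree by
  the case t = 0; mass 0 is treated apart.\<close>

lemma weighted_char_unique:
  fixes f W :: "'a \<Rightarrow> real"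
  assumes M: "prob_space M" and M': "prob_space M'" and sets: "sets M' = sets M"
    and [measurable]: "f \<in> borel_measurable M" "W \<in> borel_measurable M"
    and W: "\<And>x. 0 \<le> W x" "\<And>x. W x \<le> C"
    and eq: "\<And>t. (CLINT x|M. of_real (W x) * iexp (t * f x)) = (CLINT x|M'. of_real (W x) * iexp (t * f x))"
    and B[measurable]: "B \<in> sets borel"
  shows "(\<integral>x. W x * indicator B (f x) \<partial>M) = (\<integral>x. W x * indicator B (f x) \<partial>M')"
proof -
  interpret M: prob_space M by fact
  interpret M': prob_space M' by fact
  have [measurable]: "f \<in> borel_measurable M'" "W \<in> borel_measurable M'"
    using assms(4,5) by (simp_all add: measurable_cong_sets[OF sets refl])
  have int: "integrable M W" "integrable M' W"
    using W by (auto intro!: M.integrable_const_bound[of _ C] M'.integrable_const_bound[of _ C])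
  define c where "c = (\<integral>x. W x \<partial>M)"
  have "complex_of_real (\<integral>x. W x \<partial>M) = of_real (\<integral>x. W x \<partial>M')"
    using eq[of 0] by simp
  then have c': "c = (\<integral>x. W x \<partial>M')" unfolding c_def of_real_eq_iff .
  have "c \<ge> 0" unfolding c_def using W by simp
  show ?thesis
  proof (cases "c = 0")
    case True
    have "AE x in M. W x = 0"
      using True integral_nonneg_eq_0_iff_AE[OF int(1)] W by (simp add: c_def)
    moreover have "AE x in M'. W x = 0"
      using True c' integral_nonneg_eq_0_iff_AE[OF int(2)] W by simp
    ultimately have "(\<integral>x. W x * indicator B (f x) \<partial>M) = (\<integral>x. 0 \<partial>M)"
      "(\<integral>x. W x * indicator B (f x) \<partial>M') = (\<integral>x. 0 \<partial>M')"
      by (intro integral_cong_AE; simp; elim AE_mp, simp)+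
    then show ?thesis by simp
  next
    case False
    with \<open>c \<ge> 0\<close> have c: "c > 0" by simp
    define \<rho> where "\<rho> N = distr (density N (\<lambda>x. ennreal (W x / c))) borel f" for N :: "'a measure"
    have main: "real_distribution (\<rho> N) \<and>
        char (\<rho> N) t = (CLINT x|N. of_real (W x) * iexp (t * f x)) / of_real c \<and>
        measure (\<rho> N) B = (\<integral>x. W x * indicator B (f x) \<partial>N) / c"
      if N: "prob_space N" and s: "sets N = sets M" and cN: "c = (\<integral>x. W x \<partial>N)" for N t
    proof -
      interpret N: prob_space N by fact
      have [measurable]: "f \<in> borel_measurable N" "W \<in> borel_measurable N"
        using assms(4,5) by (simp_all add: measurable_cong_sets[OF s refl])
      have intN: "integrable N W"
        using W by (auto intro!: N.integrable_const_bound[of _ C])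
      have "(\<integral>\<^sup>+x. ennreal (W x / c) \<partial>N) = ennreal (\<integral>x. W x / c \<partial>N)"
        using W c intN by (intro nn_integral_eq_integral) auto
      also have "\<dots> = 1" using c cN by simp
      finally have "emeasure (density N (\<lambda>x. ennreal (W x / c))) (space N) = 1"
        by (subst emeasure_density) (auto cong: nn_integral_cong)
      then interpret D: prob_space "density N (\<lambda>x. ennreal (W x / c))"
        by (intro prob_spaceI) simp
      have 1: "real_distribution (\<rho> N)"
        unfolding \<rho>_def by (intro D.real_distribution_distr) simp
      have "char (\<rho> N) t = (CLINT x|density N (\<lambda>x. ennreal (W x / c)). iexp (t * f x))"
        unfolding \<rho>_def char_def by (subst integral_distr) auto
      also have "\<dots> = (CLINT x|N. (W x / c) *\<^sub>R iexp (t * f x))"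
        using W c by (subst integral_density) auto
      also have "\<dots> = (CLINT x|N. (of_real (W x) * iexp (t * f x)) / of_real c)"
        by (simp add: scaleR_conv_of_real)
      also have "\<dots> = (CLINT x|N. of_real (W x) * iexp (t * f x)) / of_real c"
        by (rule integral_divide_zero)
      finally have 2: "char (\<rho> N) t = (CLINT x|N. of_real (W x) * iexp (t * f x)) / of_real c" .
      interpret R: real_distribution "\<rho> N" by (rule 1)
      have "measure (\<rho> N) B = (\<integral>x. indicator B x \<partial>\<rho> N)"
        by (simp add: \<rho>_def)
      also have "\<dots> = (\<integral>x. indicator B (f x) \<partial>density N (\<lambda>x. ennreal (W x / c)))"
        unfolding \<rho>_def by (subst integral_distr) auto
      also have "\<dots> = (\<integral>x. W x / c * indicator B (f x) \<partial>N)"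
        using W c by (subst integral_density) auto
      also have "\<dots> = (\<integral>x. W x * indicator B (f x) \<partial>N) / c"
        by (simp add: divide_inverse mult_ac)
      finally show ?thesis using 1 2 by simp
    qed
    have "char (\<rho> M) = char (\<rho> M')"
      using main[OF M refl c_def] main[OF M' sets c'] eq by (intro ext) simp
    then have "\<rho> M = \<rho> M'"
      using main[OF M refl c_def] main[OF M' sets c'] by (intro Levy_uniqueness) blast+
    then show ?thesis
      using main[OF M refl c_def] main[OF M' sets c'] c by simp
  qed
qed

lemma complex_cos_sin_iexp:
  "complex_of_real (cos s) = (iexp s + iexp (- s)) / 2"
  "complex_of_real (sin s) = (iexp s - iexp (- s)) / (2 * \<i>)"
  by (simp_all add: cos_exp_eq sin_exp_eq cos_of_real sin_of_real flip: cos_of_real sin_of_real)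

text \<open>The characters of the coordinates are replaced by indicators one coordinate at a time; the
  weights \<open>1 + cos S\<close> and \<open>1 + sin S\<close> keep the measures positive.\<close>

lemma cramer_wold:
  fixes M M' :: "(nat \<Rightarrow> real) measure"
  assumes M: "prob_space M" and M': "prob_space M'"
    and sets: "sets M = sets borel" "sets M' = sets borel"
    and eq: "\<And>N a. (CLINT x|M. iexp (\<Sum>l<N. a l * x l)) = (CLINT x|M'. iexp (\<Sum>l<N. a l * x l))"
  shows "M = M'"
proof -
  interpret M: prob_space M by fact
  interpret M': prob_space M' by fact
  have [measurable]: "(\<lambda>x. x l) \<in> borel_measurable M" "(\<lambda>x. x l) \<in> borel_measurable M'" for l
    by (simp_all add: measurable_cong_sets[OF sets(1) refl] measurable_cong_sets[OF sets(2) refl])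
  let ?I = "\<lambda>m B x. (\<Prod>l<m. indicator (B l) (x l) :: real)"
  have I01: "0 \<le> ?I m B x" "?I m B x \<le> 1" for m B and x :: "nat \<Rightarrow> real"
    by (auto intro!: prod_nonneg prod_le_1 simp: indicator_def)
  \<comment> \<open>Coordinates below \<open>m\<close> are tested by indicators, those from
    \<open>m\<close> on by a character; the induction moves \<open>m\<close> past one coordinate at
    a time.\<close>
  have H: "(CLINT x|M. of_real (?I m B x) * iexp (\<Sum>l\<in>{m..<N}. a l * x l))
      = (CLINT x|M'. of_real (?I m B x) * iexp (\<Sum>l\<in>{m..<N}. a l * x l))"
    if "\<And>l. B l \<in> sets borel" for m B N a
  proof (induction m arbitrary: N a)
    case 0
    then show ?case using eq by (simp add: lessThan_atLeast0)
  next
    case (Suc m)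
    note [measurable] = that
    define S where "S x = (\<Sum>l\<in>{Suc m..<N}. a l * x l)" for x :: "nat \<Rightarrow> real"
    have [measurable]: "S \<in> borel_measurable M" "S \<in> borel_measurable M'"
      unfolding S_def[abs_def] by measurable
    let ?E = "\<lambda>\<mu> t s x. of_real (?I m B x) * iexp (t * x m + s * S x)"
    have G: "(CLINT x|M. ?E M t s x) = (CLINT x|M'. ?E M' t s x)" for t s
    proof -
      \<comment> \<open>The maximum puts \<open>m\<close> into the summation range even if
        \<open>N \<le> m\<close>, where \<open>S\<close> is an empty sum.\<close>
      define N' where "N' = max N (Suc m)"
      define b where "b l = (if l = m then t else if l < N then s * a l else 0)" for l
      have "(\<Sum>l\<in>{m..<N'}. b l * x l) = t * x m + s * S x" for x
      proof -
        have "(\<Sum>l\<in>{m..<N'}. b l * x l) = b m * x m + (\<Sum>l\<in>{Suc m..<N'}. b l * x l)"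
          by (rule sum.atLeast_Suc_lessThan) (simp add: N'_def)
        also have "(\<Sum>l\<in>{Suc m..<N'}. b l * x l) = (\<Sum>l\<in>{Suc m..<N}. b l * x l)"
          by (rule sum.mono_neutral_right) (auto simp: N'_def b_def)
        also have "\<dots> = s * S x"
          unfolding S_def sum_distrib_left by (rule sum.cong) (auto simp: b_def)
        finally show ?thesis by (simp add: b_def)
      qed
      then show ?thesis using Suc.IH[of b N'] by simp
    qed
    have intE: "integrable M (?E M t s)" "integrable M' (?E M' t s)" for t s
      using I01 by (intro integrable_bounded_mult_iexp[where C=1] M M'; simp)+
    have cs: "(CLINT x|\<mu>. of_real (?I m B x * (1 + cos (S x))) * iexp (t * x m)) =
        (CLINT x|\<mu>. ?E \<mu> t 0 x) + ((CLINT x|\<mu>. ?E \<mu> t 1 x) + (CLINT x|\<mu>. ?E \<mu> t (-1) x)) / 2"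
      "(CLINT x|\<mu>. of_real (?I m B x * (1 + sin (S x))) * iexp (t * x m)) =
        (CLINT x|\<mu>. ?E \<mu> t 0 x) + ((CLINT x|\<mu>. ?E \<mu> t 1 x) - (CLINT x|\<mu>. ?E \<mu> t (-1) x)) / (2 * \<i>)"
      if int: "\<And>t s. integrable \<mu> (?E \<mu> t s)" for \<mu> t
    proof -
      have ex: "iexp (t * x m + s * S x) = iexp (t * x m) * iexp (s * S x)" for x s
        by (simp add: ring_distribs exp_add)
      have "(CLINT x|\<mu>. of_real (?I m B x * (1 + cos (S x))) * iexp (t * x m)) =
        (CLINT x|\<mu>. ?E \<mu> t 0 x + (?E \<mu> t 1 x + ?E \<mu> t (-1) x) / 2)"
        unfolding ex unfolding of_real_mult of_real_add complex_cos_sin_iexp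
        by (intro Bochner_Integration.integral_cong refl) (simp add: field_simps)
      also have "\<dots> = (CLINT x|\<mu>. ?E \<mu> t 0 x) + ((CLINT x|\<mu>. ?E \<mu> t 1 x) + (CLINT x|\<mu>. ?E \<mu> t (-1) x)) / 2"
        by (simp only: Bochner_Integration.integral_add Bochner_Integration.integrable_add integral_divide_zero
            Bochner_Integration.integrable_divide int)
      finally show "(CLINT x|\<mu>. of_real (?I m B x * (1 + cos (S x))) * iexp (t * x m)) =
        (CLINT x|\<mu>. ?E \<mu> t 0 x) + ((CLINT x|\<mu>. ?E \<mu> t 1 x) + (CLINT x|\<mu>. ?E \<mu> t (-1) x)) / 2" .
      have "(CLINT x|\<mu>. of_real (?I m B x * (1 + sin (S x))) * iexp (t * x m)) =
        (CLINT x|\<mu>. ?E \<mu> t 0 x + (?E \<mu> t 1 x - ?E \<mu> t (-1) x) / (2 * \<i>))"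
        unfolding ex unfolding of_real_mult of_real_add complex_cos_sin_iexp
        by (intro Bochner_Integration.integral_cong refl) (simp add: field_simps)
      also have "\<dots> = (CLINT x|\<mu>. ?E \<mu> t 0 x) + ((CLINT x|\<mu>. ?E \<mu> t 1 x) - (CLINT x|\<mu>. ?E \<mu> t (-1) x)) / (2 * \<i>)"
        by (simp only: Bochner_Integration.integral_add Bochner_Integration.integral_diff
            Bochner_Integration.integrable_diff integral_divide_zero
            Bochner_Integration.integrable_divide int)
      finally show "(CLINT x|\<mu>. of_real (?I m B x * (1 + sin (S x))) * iexp (t * x m)) =
        (CLINT x|\<mu>. ?E \<mu> t 0 x) + ((CLINT x|\<mu>. ?E \<mu> t 1 x) - (CLINT x|\<mu>. ?E \<mu> t (-1) x)) / (2 * \<i>)" .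
    qed
    let ?J = "\<lambda>x. ?I m B x * indicator (B m) (x m)"
    have "(\<integral>x. ?I m B x * indicator (B m) (x m) \<partial>M) = (\<integral>x. ?I m B x * indicator (B m) (x m) \<partial>M')"
      using I01 G[of _ 0] sets by (intro weighted_char_unique[OF M M', where C=1]) auto
    then have e0: "(\<integral>x. ?J x \<partial>M) = (\<integral>x. ?J x \<partial>M')" .
    have le2: "?I m B x * (1 + u) \<le> 2" if "u \<le> 1" "-1 \<le> u" for x u
      using mult_mono[of "?I m B x" 1 "1 + u" 2] I01 that by auto
    have one_plus: "0 \<le> 1 + cos u" "0 \<le> 1 + sin u" for u :: real
      using cos_ge_minus_one[of u] sin_ge_minus_one[of u] by linarith+
    have e1: "(\<integral>x. ?I m B x * (1 + cos (S x)) * indicator (B m) (x m) \<partial>M)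
        = (\<integral>x. ?I m B x * (1 + cos (S x)) * indicator (B m) (x m) \<partial>M')"
    proof (rule weighted_char_unique[OF M M', where C=2])
      show "(CLINT x|M. of_real (?I m B x * (1 + cos (S x))) * iexp (t * x m)) =
        (CLINT x|M'. of_real (?I m B x * (1 + cos (S x))) * iexp (t * x m))" for t
        unfolding cs[OF intE(1)] cs[OF intE(2)] G ..
    qed (use I01 sets in \<open>auto intro!: le2 mult_nonneg_nonneg one_plus\<close>)
    have e2: "(\<integral>x. ?I m B x * (1 + sin (S x)) * indicator (B m) (x m) \<partial>M)
        = (\<integral>x. ?I m B x * (1 + sin (S x)) * indicator (B m) (x m) \<partial>M')"
    proof (rule weighted_char_unique[OF M M', where C=2])
      show "(CLINT x|M. of_real (?I m B x * (1 + sin (S x))) * iexp (t * x m)) =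
        (CLINT x|M'. of_real (?I m B x * (1 + sin (S x))) * iexp (t * x m))" for t
        unfolding cs[OF intE(1)] cs[OF intE(2)] G ..
    qed (use I01 sets in \<open>auto intro!: le2 mult_nonneg_nonneg one_plus\<close>)
    have J01: "0 \<le> ?J x" "?J x \<le> 1" for x
      by (cases "x m \<in> B m"; simp add: I01)+
    \<comment> \<open>Subtracting the integral of \<open>?J\<close> removes the summand 1 that had
      been added to cos and sin for the sake of positivity.\<close>
    have split: "(CLINT x|\<mu>. of_real (?I (Suc m) B x) * iexp (S x)) =
        of_real ((\<integral>x. ?I m B x * (1 + cos (S x)) * indicator (B m) (x m) \<partial>\<mu>) - (\<integral>x. ?J x \<partial>\<mu>)) +
        \<i> * of_real ((\<integral>x. ?I m B x * (1 + sin (S x)) * indicator (B m) (x m) \<partial>\<mu>) - (\<integral>x. ?J x \<partial>\<mu>))"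
      if \<mu>: "prob_space \<mu>" and sm: "sets \<mu> = sets borel" for \<mu>
    proof -
      interpret \<mu>: prob_space \<mu> by fact
      have [measurable]: "(\<lambda>x. x l) \<in> borel_measurable \<mu>" for l
        by (simp add: measurable_cong_sets[OF sm refl])
      have [measurable]: "S \<in> borel_measurable \<mu>"
        unfolding S_def[abs_def] by measurable
      have bd: "\<bar>?J x * u\<bar> \<le> 1" if "\<bar>u\<bar> \<le> 1" for x u
        unfolding abs_mult[of "?J x" u] abs_of_nonneg[OF J01(1)]
        using mult_mono[of "?J x" 1 "\<bar>u\<bar>" 1] J01[of x] that by simp
      have i: "integrable \<mu> ?J" "integrable \<mu> (\<lambda>x. ?J x * cos (S x))" "integrable \<mu> (\<lambda>x. ?J x * sin (S x))"
      proof -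
        show "integrable \<mu> ?J"
          by (rule \<mu>.integrable_const_bound[where B=1, OF AE_I2])
             (use bd[of 1] in \<open>simp only: real_norm_def mult_1_right abs_one order_refl\<close>, measurable)
        show "integrable \<mu> (\<lambda>x. ?J x * cos (S x))"
          by (rule \<mu>.integrable_const_bound[where B=1, OF AE_I2])
             (simp only: real_norm_def bd abs_cos_le_one, measurable)
        show "integrable \<mu> (\<lambda>x. ?J x * sin (S x))"
          by (rule \<mu>.integrable_const_bound[where B=1, OF AE_I2])
             (simp only: real_norm_def bd abs_sin_le_one, measurable)
      qed
      have "(\<integral>x. ?I m B x * (1 + cos (S x)) * indicator (B m) (x m) \<partial>\<mu>) = (\<integral>x. ?J x + ?J x * cos (S x) \<partial>\<mu>)"
        "(\<integral>x. ?I m B x * (1 + sin (S x)) * indicator (B m) (x m) \<partial>\<mu>) = (\<integral>x. ?J x + ?J x * sin (S x) \<partial>\<mu>)"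
        by (intro Bochner_Integration.integral_cong refl; simp add: algebra_simps)+
      moreover have "(CLINT x|\<mu>. of_real (?I (Suc m) B x) * iexp (S x)) =
          (CLINT x|\<mu>. of_real (?J x * cos (S x)) + \<i> * of_real (?J x * sin (S x)))"
        by (intro Bochner_Integration.integral_cong refl)
           (simp add: exp_Euler cos_of_real sin_of_real algebra_simps)
      ultimately show ?thesis
        using i by (simp add: integral_add del: of_real_mult)
    qed
    show ?case
      unfolding S_def[symmetric] split[OF M sets(1)] split[OF M' sets(2)] e0 e1 e2 ..
  qed
  have Hm: "measure M (prod_emb UNIV (\<lambda>_. borel) J (Pi\<^sub>E J B)) = measure M' (prod_emb UNIV (\<lambda>_. borel) J (Pi\<^sub>E J B))"
    if J: "finite J" and B: "\<And>i. i \<in> J \<Longrightarrow> B i \<in> sets borel" for J B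
  proof -
    define C where "C l = (if l \<in> J then B l else UNIV)" for l
    obtain m where m: "J \<subseteq> {..<m}" using J finite_nat_iff_bounded by blast
    have ind: "indicator (prod_emb UNIV (\<lambda>_. borel) J (Pi\<^sub>E J B)) x = ?I m C x" for x
    proof (cases "\<forall>l\<in>J. x l \<in> B l")
      case True
      then have "?I m C x = 1" by (intro prod.neutral) (auto simp: C_def)
      then show ?thesis using True by (auto simp: prod_emb_def PiE_def space_PiM)
    next
      case False
      then obtain l where "l \<in> J" "x l \<notin> B l" by auto
      then have "?I m C x = 0" using m by (intro prod_zero bexI[of _ l]) (auto simp: C_def)
      moreover have "x \<notin> prod_emb UNIV (\<lambda>_. borel) J (Pi\<^sub>E J B)"
        using \<open>l \<in> J\<close> \<open>x l \<notin> B l\<close> by (auto simp: prod_emb_def PiE_def Pi_def)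
      ultimately show ?thesis by (simp only: indicator_simps not_False_eq_True)
    qed
    have C: "C l \<in> sets borel" for l using B by (auto simp: C_def)
    have [measurable]: "prod_emb UNIV (\<lambda>_. borel) J (Pi\<^sub>E J B) \<in> sets borel"
      using J B unfolding sets_PiM_equal_borel[symmetric] by (intro sets_PiM_I) auto
    \<comment> \<open>The upper limit 0 makes the exponent an empty sum, so that only the indicators
      remain.\<close>
    have "(CLINT x|M. of_real (?I m C x) * iexp (\<Sum>l\<in>{m..<0}. a l * x l))
      = (CLINT x|M'. of_real (?I m C x) * iexp (\<Sum>l\<in>{m..<0}. a l * x l))" for a
      by (rule H[OF C])
    then have "complex_of_real (\<integral>x. ?I m C x \<partial>M) = of_real (\<integral>x. ?I m C x \<partial>M')"
      by (simp del: of_real_prod)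
    then show ?thesis
      unfolding of_real_eq_iff ind[symmetric] by (simp add: sets)
  qed
  show ?thesis
  proof (rule measure_eqI_PiM_infinite)
    show "sets M = sets (Pi\<^sub>M UNIV (\<lambda>_. borel))" "sets M' = sets (Pi\<^sub>M UNIV (\<lambda>_. borel))"
      using sets by (simp_all add: sets_PiM_equal_borel)
    show "finite_measure M" by unfold_locales
    show "emeasure M (prod_emb UNIV (\<lambda>_. borel) J (Pi\<^sub>E J A)) = emeasure M' (prod_emb UNIV (\<lambda>_. borel) J (Pi\<^sub>E J A))"
      if "finite J" "\<And>i. i \<in> J \<Longrightarrow> A i \<in> sets borel" for A J
      using Hm[OF that] by (simp add: M.emeasure_eq_measure M'.emeasure_eq_measure)
  qed
qed

text \<open>An infinite Cholesky factorization. Row \<open>l\<close> vanishes beyond index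
  \<open>l\<close>, so the inner product of two rows is the same finite sum for every
  \<open>N\<close> above both row indices.\<close>

definition lower_factor :: "(nat \<Rightarrow> nat \<Rightarrow> real) \<Rightarrow> (nat \<Rightarrow> nat \<Rightarrow> real) \<Rightarrow> bool" where
  "lower_factor L \<Gamma> \<longleftrightarrow> (\<forall>l j. l < j \<longrightarrow> L l j = 0) \<and>
     (\<forall>N l l'. l < N \<longrightarrow> l' < N \<longrightarrow> (\<Sum>j<N. L l j * L l' j) = \<Gamma> l l')"

text \<open>Gram--Schmidt is applied to the random variables themselves; since \<open>x / 0 = 0\<close>, the degenerate
  steps need no separate treatment.\<close>

lemma cholesky_factor_exists:
  fixes \<xi> :: "nat \<Rightarrow> 'w \<Rightarrow> real"
  assumes meas: "\<And>l. \<xi> l \<in> borel_measurable P" and sq: "\<And>l. integrable P (\<lambda>\<omega>. (\<xi> l \<omega>)\<^sup>2)"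
  shows "\<exists>L. lower_factor L (\<lambda>l l'. \<integral>\<omega>. \<xi> l \<omega> * \<xi> l' \<omega> \<partial>P)"
proof -
  \<comment> \<open>\<open>R j l\<close> is what remains of \<open>\<xi> l\<close> after the
    residuals \<open>R i i\<close> with \<open>i < j\<close> have been projected off;
    \<open>G j\<close> is the Gram matrix of the remainders.\<close>
  define R where "R = rec_nat \<xi> (\<lambda>j R l \<omega>. R l \<omega> -
    (\<integral>\<omega>. R l \<omega> * R j \<omega> \<partial>P) / (\<integral>\<omega>. R j \<omega> * R j \<omega> \<partial>P) * R j \<omega>)"
  define G where "G j l l' = (\<integral>\<omega>. R j l \<omega> * R j l' \<omega> \<partial>P)" for j l l'
  have R0: "R 0 = \<xi>" by (simp add: R_def)
  have RS: "R (Suc j) = (\<lambda>l \<omega>. R j l \<omega> - G j l j / G j j j * R j j \<omega>)" for j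
    by (simp add: R_def G_def)
  have RL: "R j l \<in> borel_measurable P \<and> integrable P (\<lambda>\<omega>. (R j l \<omega>)\<^sup>2)" for j l
  proof (induction j arbitrary: l)
    case 0
    then show ?case using meas sq by (simp add: R0)
  next
    case (Suc j)
    have [measurable]: "R j l \<in> borel_measurable P" for l using Suc by blast
    have int: "integrable P (\<lambda>\<omega>. R j l \<omega> * R j l' \<omega>)" for l l'
      using Suc by (intro integrable_square_mult) auto
    let ?c = "G j l j / G j j j"
    have "integrable P (\<lambda>\<omega>. R j l \<omega> * R j l \<omega> - 2 * ?c * (R j l \<omega> * R j j \<omega>) + ?c * ?c * (R j j \<omega> * R j j \<omega>))"
      by (intro Bochner_Integration.integrable_add Bochner_Integration.integrable_diff integrable_mult_right int)
    then have "integrable P (\<lambda>\<omega>. (R j l \<omega> - ?c * R j j \<omega>)\<^sup>2)"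
      by (simp add: power2_eq_square algebra_simps)
    then show ?case unfolding RS by simp
  qed
  have [measurable]: "R j l \<in> borel_measurable P" for j l using RL by blast
  have int: "integrable P (\<lambda>\<omega>. R j l \<omega> * R j l' \<omega>)" for j l l'
    using RL by (intro integrable_square_mult) auto
  have sym: "G j l l' = G j l' l" for j l l' unfolding G_def by (simp add: mult.commute)
  have Gpos: "G j l l \<ge> 0" for j l unfolding G_def by simp
  have Gdeg: "G j l j = 0" if "G j j j = 0" for j l
  proof -
    have "AE \<omega> in P. R j j \<omega> * R j j \<omega> = 0"
      using that integral_nonneg_eq_0_iff_AE[OF int] by (simp add: G_def)
    then have "G j l j = (\<integral>\<omega>. 0 \<partial>P)"
      unfolding G_def by (intro integral_cong_AE) auto
    then show ?thesis by simp
  qed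
  have GS: "G (Suc j) l l' = G j l l' - G j l j * G j l' j / G j j j" for j l l'
  proof -
    let ?c = "G j l j / G j j j" and ?c' = "G j l' j / G j j j"
    have "G (Suc j) l l' = (\<integral>\<omega>. R j l \<omega> * R j l' \<omega> - ?c' * (R j l \<omega> * R j j \<omega>) -
        ?c * (R j l' \<omega> * R j j \<omega>) + ?c * ?c' * (R j j \<omega> * R j j \<omega>) \<partial>P)"
      unfolding G_def[of "Suc j"] RS
      by (intro Bochner_Integration.integral_cong refl) (simp add: algebra_simps)
    also have "\<dots> = G j l l' - ?c' * G j l j - ?c * G j l' j + ?c * ?c' * G j j j"
      unfolding G_def by (simp only: Bochner_Integration.integral_add Bochner_Integration.integral_diff
          integral_mult_right_zero Bochner_Integration.integrable_add Bochner_Integration.integrable_diff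
          integrable_mult_right int)
    also have "\<dots> = G j l l' - G j l j * G j l' j / G j j j"
      using Gdeg by (cases "G j j j = 0") (auto simp: field_simps)
    finally show ?thesis .
  qed
  have Gz: "G j l l' = 0" if "l < j" for j l l'
    using that
  proof (induction j arbitrary: l l')
    case (Suc j)
    show ?case
    proof (cases "l = j")
      case True
      then show ?thesis using Gdeg[of j l'] sym[of j j l'] by (cases "G j j j = 0") (auto simp: GS)
    next
      case False
      then show ?thesis using Suc by (simp add: GS)
    qed
  qed simp
  define L where "L l j = G j l j / sqrt (G j j j)" for l j
  \<comment> \<open>Column \<open>j\<close> of \<open>L\<close> accounts exactly for the change of
    the Gram matrix in step \<open>j\<close>. The sum over columns telescopes, and after
    \<open>N\<close> steps all entries with an index below \<open>N\<close> are 0.\<close>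
  have LL: "L l j * L l' j = G j l l' - G (Suc j) l l'" for l l' j
    using Gpos[of j j] by (simp add: L_def GS real_sqrt_mult_self)
  have "lower_factor L (\<lambda>l l'. G 0 l l')"
    unfolding lower_factor_def
  proof (intro conjI allI impI)
    show "L l j = 0" if "l < j" for l j using Gz[OF that] by (simp add: L_def)
    show "(\<Sum>j<N. L l j * L l' j) = G 0 l l'" if "l < N" "l' < N" for N l l'
      unfolding LL by (subst sum_lessThan_telescope') (simp add: Gz[OF that(1)])
  qed
  then show ?thesis by (auto simp: G_def R0)
qed

section \<open>Gaussian laws on sequences, their coupling and their limits\<close>

definition gaussian_law :: "(nat \<Rightarrow> real) measure \<Rightarrow> (nat \<Rightarrow> nat \<Rightarrow> real) \<Rightarrow> bool" where
  "gaussian_law \<mu> \<Gamma> \<longleftrightarrow> prob_space \<mu> \<and> sets \<mu> = sets borel \<and>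
     (\<forall>N a. (CLINT x|\<mu>. iexp (\<Sum>l<N. a l * x l)) =
        of_real (exp (- (\<Sum>l<N. \<Sum>l'<N. a l * a l' * \<Gamma> l l') / 2)))"

lemma gaussian_law_unique: "gaussian_law \<mu> \<Gamma> \<Longrightarrow> gaussian_law \<nu> \<Gamma> \<Longrightarrow> \<mu> = \<nu>"
  unfolding gaussian_law_def by (intro cramer_wold) auto

definition noise :: "(nat \<Rightarrow> real) measure" where "noise = PiM UNIV (\<lambda>_. N01)"

lemma prob_space_noise: "prob_space noise"
  unfolding noise_def by (intro prob_space_PiM prob_space_std_normal)

lemma noise_coord_measurable [measurable]: "(\<lambda>\<omega>. \<omega> j) \<in> borel_measurable noise"
proof -
  have "(\<lambda>\<omega>. \<omega> j) \<in> measurable noise N01" unfolding noise_def by simp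
  then show ?thesis by simp
qed

lemma noise_char:
  "(CLINT \<omega>|noise. iexp (\<Sum>j<N. b j * \<omega> j)) = of_real (exp (- (\<Sum>j<N. (b j)\<^sup>2) / 2))"
proof -
  interpret N: prob_space noise by (rule prob_space_noise)
  interpret PP: product_prob_space "\<lambda>_::nat. N01" UNIV
    by (simp add: product_prob_space_def product_prob_space_axioms_def product_sigma_finite_def
        prob_space_std_normal prob_space_imp_sigma_finite)
  have co: "distr noise borel (\<lambda>\<omega>. \<omega> j) = N01" for j
  proof -
    have "distr noise borel (\<lambda>\<omega>. \<omega> j) = distr noise N01 (\<lambda>\<omega>. \<omega> j)" by (intro distr_cong) auto
    also have "\<dots> = N01" unfolding noise_def by (rule PP.PiM_component) simp
    finally show ?thesis .
  qed
  have "N.indep_vars (\<lambda>_. borel) (\<lambda>j \<omega>. \<omega> j) UNIV"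
  proof (subst N.indep_vars_iff_distr_eq_PiM)
    have s: "sets (PiM UNIV (\<lambda>_::nat. borel::real measure)) = sets noise"
      unfolding noise_def by (intro sets_PiM_cong) auto
    have "distr noise (PiM UNIV (\<lambda>_. borel)) (\<lambda>x. \<lambda>i\<in>UNIV. x i) = distr noise noise (\<lambda>x. x)"
      by (intro distr_cong s) auto
    also have "\<dots> = noise" by (rule distr_id)
    finally show "distr noise (PiM UNIV (\<lambda>_. borel)) (\<lambda>x. \<lambda>i\<in>UNIV. x i) = PiM UNIV (\<lambda>i. distr noise borel (\<lambda>\<omega>. \<omega> i))"
      unfolding co noise_def[symmetric] .
  qed auto
  then have "N.indep_vars (\<lambda>_. borel) (\<lambda>j \<omega>. \<omega> j) {..<N}"
    by (rule N.indep_vars_subset) auto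
  then have iv: "N.indep_vars (\<lambda>_. borel) (\<lambda>j \<omega>. b j * \<omega> j) {..<N}"
    by (rule N.indep_vars_compose2) auto
  have "(CLINT \<omega>|noise. iexp (\<Sum>j<N. b j * \<omega> j)) = char (distr noise borel (\<lambda>\<omega>. \<Sum>j<N. b j * \<omega> j)) 1"
    unfolding char_def by (subst integral_distr) auto
  also have "\<dots> = (\<Prod>j<N. char (distr noise borel (\<lambda>\<omega>. b j * \<omega> j)) 1)"
    by (rule N.char_distr_sum[OF iv])
  also have "\<dots> = (\<Prod>j<N. char (distr noise borel (\<lambda>\<omega>. \<omega> j)) (b j))"
    unfolding char_def by (intro prod.cong refl, subst (1 2) integral_distr) auto
  also have "\<dots> = (\<Prod>j<N. of_real (exp (- (b j)\<^sup>2 / 2)))"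
    unfolding co char_std_normal_distribution ..
  also have "\<dots> = of_real (exp (\<Sum>j<N. - (b j)\<^sup>2 / 2))"
    unfolding exp_sum[OF finite_lessThan] of_real_prod ..
  finally show ?thesis
    by (simp add: sum_divide_distrib sum_negf)
qed

text \<open>The product of \<open>L\<close> with the noise. Stopping the sum at \<open>l\<close> is
  legitimate for triangular \<open>L\<close>, and it makes entrywise convergence of \<open>L\<close>
  sufficient for convergence of the product at every \<omega>.\<close>

definition mix :: "(nat \<Rightarrow> nat \<Rightarrow> real) \<Rightarrow> (nat \<Rightarrow> real) \<Rightarrow> nat \<Rightarrow> real" where
  "mix L \<omega> l = (\<Sum>j\<le>l. L l j * \<omega> j)"

lemma mix_measurable [measurable]: "mix L \<in> borel_measurable noise"
  unfolding mix_def[abs_def] by (intro measurable_coordinatewise_then_product) measurable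

text \<open>A combination of coordinates with weights \<open>a\<close> has as its variance the
  squared norm of the transpose of \<open>L\<close> applied to \<open>a\<close>, which is the
  quadratic form of \<Gamma>.\<close>

lemma gaussian_law_mix:
  assumes "lower_factor L \<Gamma>"
  shows "gaussian_law (distr noise borel (mix L)) \<Gamma>"
proof -
  interpret N: prob_space noise by (rule prob_space_noise)
  have "(CLINT x|distr noise borel (mix L). iexp (\<Sum>l<N. a l * x l)) =
      of_real (exp (- (\<Sum>l<N. \<Sum>l'<N. a l * a l' * \<Gamma> l l') / 2))" for N a
  proof -
    define b where "b j = (\<Sum>l<N. a l * L l j)" for j
    have mixN: "mix L \<omega> l = (\<Sum>j<N. L l j * \<omega> j)" if "l < N" for l \<omega>
      unfolding mix_def using that assms
      by (intro sum.mono_neutral_left) (auto simp: lower_factor_def)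
    have 1: "(\<Sum>l<N. a l * mix L \<omega> l) = (\<Sum>j<N. b j * \<omega> j)" for \<omega>
    proof -
      have "(\<Sum>l<N. a l * mix L \<omega> l) = (\<Sum>l<N. \<Sum>j<N. a l * L l j * \<omega> j)"
        by (intro sum.cong refl) (simp add: mixN sum_distrib_left mult.assoc)
      also have "\<dots> = (\<Sum>j<N. b j * \<omega> j)"
        unfolding b_def sum_distrib_right by (rule sum.swap)
      finally show ?thesis .
    qed
    have 2: "(\<Sum>j<N. (b j)\<^sup>2) = (\<Sum>l<N. \<Sum>l'<N. a l * a l' * \<Gamma> l l')"
    proof -
      have "(\<Sum>j<N. (b j)\<^sup>2) = (\<Sum>j<N. \<Sum>l<N. \<Sum>l'<N. a l * a l' * (L l j * L l' j))"
        unfolding b_def power2_eq_square sum_product by (simp add: mult_ac)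
      also have "\<dots> = (\<Sum>l<N. \<Sum>j<N. \<Sum>l'<N. a l * a l' * (L l j * L l' j))"
        by (rule sum.swap)
      also have "\<dots> = (\<Sum>l<N. \<Sum>l'<N. \<Sum>j<N. a l * a l' * (L l j * L l' j))"
        by (intro sum.cong refl sum.swap)
      also have "\<dots> = (\<Sum>l<N. \<Sum>l'<N. a l * a l' * \<Gamma> l l')"
        using assms by (intro sum.cong refl) (simp add: lower_factor_def flip: sum_distrib_left)
      finally show ?thesis .
    qed
    have [measurable]: "(\<lambda>x::nat \<Rightarrow> real. x l) \<in> borel_measurable borel" for l
      by (rule borel_measurable_continuous_onI) simp
    have "(CLINT x|distr noise borel (mix L). iexp (\<Sum>l<N. a l * x l)) =
        (CLINT \<omega>|noise. iexp (\<Sum>l<N. a l * mix L \<omega> l))"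
      by (subst integral_distr) auto
    then show ?thesis unfolding 1 noise_char 2 .
  qed
  then show ?thesis
    unfolding gaussian_law_def by (auto intro!: N.prob_space_distr)
qed

lemma gaussian_law_eq_mix:
  "gaussian_law \<mu> \<Gamma> \<Longrightarrow> lower_factor L \<Gamma> \<Longrightarrow> \<mu> = distr noise borel (mix L)"
  using gaussian_law_unique gaussian_law_mix by blast

text \<open>Tychonoff's theorem for a product of intervals; with a countable index type, compactness
  of the product yields convergent subsequences.\<close>

lemma pointwise_bounded_subsequence:
  fixes L :: "nat \<Rightarrow> 'i::countable \<Rightarrow> real"
  assumes "\<And>d i. \<bar>L d i\<bar> \<le> B i"
  shows "\<exists>s L'. strict_mono s \<and> (\<forall>i. (\<lambda>d. L (s d) i) \<longlonglongrightarrow> L' i)"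
proof -
  have "compactin (product_topology (\<lambda>_. euclidean) UNIV) (\<Pi>\<^sub>E i\<in>UNIV. {- B i..B i})"
    unfolding compactin_PiE by simp
  then have "compact (\<Pi>\<^sub>E i\<in>UNIV. {- B i..B i})"
    by (simp add: euclidean_product_topology)
  then have "seq_compact (\<Pi>\<^sub>E i\<in>UNIV. {- B i..B i})"
    by (rule compact_imp_seq_compact)
  moreover have "\<forall>d. L d \<in> (\<Pi>\<^sub>E i\<in>UNIV. {- B i..B i})"
    using assms by (auto simp: abs_le_iff minus_le_iff)
  ultimately obtain L' s where "strict_mono s" "(L \<circ> s) \<longlonglongrightarrow> L'"
    by (rule seq_compactE)
  then show ?thesis unfolding tendsto_fun_iff by (auto simp: comp_def)
qed

text \<open>Reverse Fatou inequality for sets: the tail unions decrease to the limit superior of the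
  sets \<open>A d\<close>, which is contained in \<open>C\<close>.\<close>

lemma (in finite_measure) measure_tail_limit:
  assumes A: "\<And>d. A d \<in> sets M" and C: "C \<in> sets M"
    and sub: "\<And>\<omega>. \<omega> \<in> space M \<Longrightarrow> \<exists>\<^sub>F d in sequentially. \<omega> \<in> A d \<Longrightarrow> \<omega> \<in> C"
    and e: "e > 0"
  shows "\<forall>\<^sub>F d in sequentially. measure M (A d) < measure M C + e"
proof -
  define U where "U n = (\<Union>d\<in>{n..}. A d)" for n :: nat
  have U: "U n \<in> sets M" for n unfolding U_def using A by auto
  have "(\<lambda>n. measure M (U n)) \<longlonglongrightarrow> measure M (\<Inter>n. U n)"
  proof (rule finite_Lim_measure_decseq)
    show "decseq U" unfolding decseq_def U_def by (intro allI impI UN_mono) auto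
  qed (use U in auto)
  moreover have "measure M (\<Inter>n. U n) \<le> measure M C"
  proof (rule finite_measure_mono[OF _ C], rule subsetI)
    fix \<omega> assume \<omega>: "\<omega> \<in> (\<Inter>n. U n)"
    then have "\<omega> \<in> space M" using sets.sets_into_space[OF U] by blast
    then show "\<omega> \<in> C"
      using \<omega> by (intro sub) (auto simp: frequently_sequentially U_def)
  qed
  ultimately have "\<forall>\<^sub>F n in sequentially. measure M (U n) < measure M C + e"
    using e by (intro order_tendstoD(2)) auto
  then show ?thesis
  proof eventually_elim
    case (elim n)
    have "measure M (A n) \<le> measure M (U n)"
      using U by (intro finite_measure_mono) (auto simp: U_def)
    with elim show ?case by simp
  qed
qed

text \<open>Along a subsequence that violates the bound, a further subsequence of the factors
  converges. The coupled variables then converge for every value of the noise, and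
  \<open>measure_tail_limit\<close> gives a contradiction. The limit factor may depend on the
  subsequence, its law does not.\<close>

theorem gaussian_law_limit:
  assumes law: "\<And>d. gaussian_law (\<mu> d) (\<Gamma> d)" and fac: "\<And>d. \<exists>L. lower_factor L (\<Gamma> d)"
    and lim: "\<And>l l'. (\<lambda>d. \<Gamma> d l l') \<longlonglongrightarrow> \<Gamma>' l l'"
  shows "\<exists>\<nu>. gaussian_law \<nu> \<Gamma>' \<and>
    (\<forall>G e. closed G \<longrightarrow> e > 0 \<longrightarrow> (\<forall>\<^sub>F d in sequentially. measure (\<mu> d) G < measure \<nu> G + e))"
proof -
  interpret N: prob_space noise by (rule prob_space_noise)
  obtain L where L: "\<And>d. lower_factor (L d) (\<Gamma> d)" using fac by metis
  have "\<exists>B. \<forall>d. \<bar>\<Gamma> d l l\<bar> \<le> B" for l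
    using convergent_imp_Bseq[OF convergentI[OF lim[of l l]]] unfolding Bseq_def by auto
  then obtain B where B: "\<And>d l. \<bar>\<Gamma> d l l\<bar> \<le> B l" by metis
  have B1: "B l \<ge> 0" for l using B[of 0 l] by simp
  \<comment> \<open>Row \<open>l\<close> of a factor has squared norm \<open>\<Gamma> d l l\<close>,
    which is at most \<open>B l\<close>; the bound \<open>B l + 1\<close> avoids a square
    root.\<close>
  have bd: "\<bar>L d l j\<bar> \<le> B l + 1" for d l j
  proof (cases "l < j")
    case True
    then show ?thesis using L[of d] B1[of l] by (simp add: lower_factor_def)
  next
    case False
    have "(L d l j)\<^sup>2 \<le> (\<Sum>j<Suc l. (L d l j)\<^sup>2)"
      using False by (intro member_le_sum) auto
    also have "\<dots> = \<Gamma> d l l" using L[of d] by (simp add: lower_factor_def power2_eq_square del: sum.lessThan_Suc)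
    also have "\<dots> \<le> B l" using B[of d l] by simp
    also have "\<dots> \<le> (B l + 1)\<^sup>2" using B1[of l] by (simp add: power2_eq_square algebra_simps)
    finally show ?thesis using B1[of l] by (simp add: abs_le_square_iff[symmetric])
  qed
  \<comment> \<open>Bounded entries converge along a further subsequence, and triangularity and the
    finite row products pass to the limit.\<close>
  have sub: "\<exists>s L'. strict_mono s \<and> lower_factor L' \<Gamma>' \<and> (\<forall>l j. (\<lambda>d. L (t (s d)) l j) \<longlonglongrightarrow> L' l j)"
    if t: "strict_mono t" for t :: "nat \<Rightarrow> nat"
  proof -
    obtain s L' where s: "strict_mono s"
      and L': "\<And>i. (\<lambda>d. L (t (s d)) (fst i) (snd i)) \<longlonglongrightarrow> L' i"
      using pointwise_bounded_subsequence[of "\<lambda>d i. L (t d) (fst i) (snd i)" "\<lambda>i. B (fst i) + 1", OF bd]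
      by blast
    have lj: "(\<lambda>d. L (t (s d)) l j) \<longlonglongrightarrow> L' (l, j)" for l j using L'[of "(l, j)"] by simp
    have "lower_factor (\<lambda>l j. L' (l, j)) \<Gamma>'"
      unfolding lower_factor_def
    proof (intro conjI allI impI)
      show "L' (l, j) = 0" if "l < j" for l j
        using lj[of l j] L that by (simp add: lower_factor_def LIMSEQ_const_iff)
      show "(\<Sum>j<N. L' (l, j) * L' (l', j)) = \<Gamma>' l l'" if "l < N" "l' < N" for N l l'
      proof (rule LIMSEQ_unique)
        show "(\<lambda>d. \<Sum>j<N. L (t (s d)) l j * L (t (s d)) l' j) \<longlonglongrightarrow> (\<Sum>j<N. L' (l, j) * L' (l', j))"
          by (intro tendsto_intros lj)
        have "(\<lambda>d. \<Gamma> (t (s d)) l l') \<longlonglongrightarrow> \<Gamma>' l l'"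
          using LIMSEQ_subseq_LIMSEQ[OF lim strict_mono_o[OF t s], of l l'] by (simp add: comp_def)
        then show "(\<lambda>d. \<Sum>j<N. L (t (s d)) l j * L (t (s d)) l' j) \<longlonglongrightarrow> \<Gamma>' l l'"
          using L that by (simp add: lower_factor_def)
      qed
    qed
    then show ?thesis using s lj by (intro exI[of _ s] exI[of _ "\<lambda>l j. L' (l, j)"]) auto
  qed
  \<comment> \<open>This is also how the limit matrix is seen to have a factor at all.\<close>
  obtain L0 where L0: "lower_factor L0 \<Gamma>'"
    using sub[OF strict_mono_id] by auto
  define \<nu> where "\<nu> = distr noise borel (mix L0)"
  have \<nu>: "gaussian_law \<nu> \<Gamma>'" unfolding \<nu>_def by (rule gaussian_law_mix[OF L0])
  have "\<forall>\<^sub>F d in sequentially. measure (\<mu> d) G < measure \<nu> G + e" if G: "closed G" and e: "e > 0" for G e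
  proof (rule ccontr)
    have [measurable]: "G \<in> sets borel" using G by (rule borel_closed)
    assume "\<not> ?thesis"
    then have "\<exists>\<^sub>F d in sequentially. measure (\<mu> d) G \<ge> measure \<nu> G + e"
      by (simp add: frequently_def not_le)
    then have "infinite {d. measure (\<mu> d) G \<ge> measure \<nu> G + e}"
      by (simp add: frequently_cofinite[symmetric] cofinite_eq_sequentially)
    then obtain t :: "nat \<Rightarrow> nat" where t: "strict_mono t" "\<And>d. measure (\<mu> (t d)) G \<ge> measure \<nu> G + e"
      using infinite_enumerate by blast
    obtain s L' where s: "strict_mono s" and L': "lower_factor L' \<Gamma>'"
      and conv: "\<And>l j. (\<lambda>d. L (t (s d)) l j) \<longlonglongrightarrow> L' l j"
      using sub[OF t(1)] by blast
    have mconv: "(\<lambda>d. mix (L (t (s d))) \<omega>) \<longlonglongrightarrow> mix L' \<omega>" for \<omega>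
      unfolding tendsto_fun_iff mix_def by (intro allI tendsto_intros conv)
    have "\<forall>\<^sub>F d in sequentially. measure noise (mix (L (t (s d))) -` G \<inter> space noise) <
        measure noise (mix L' -` G \<inter> space noise) + e"
    proof (rule N.measure_tail_limit)
      fix \<omega> assume \<omega>: "\<omega> \<in> space noise"
        and fr: "\<exists>\<^sub>F d in sequentially. \<omega> \<in> mix (L (t (s d))) -` G \<inter> space noise"
      have "mix L' \<omega> \<in> G"
      proof (rule ccontr)
        assume "mix L' \<omega> \<notin> G"
        then have "\<forall>\<^sub>F d in sequentially. mix (L (t (s d))) \<omega> \<in> - G"
          using G by (intro topological_tendstoD[OF mconv]) auto
        with fr show False by (auto simp: frequently_def elim: eventually_mono)
      qed
      with \<omega> show "\<omega> \<in> mix L' -` G \<inter> space noise" by simp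
    qed (auto simp: e)
    moreover have "measure \<nu> G = measure noise (mix L' -` G \<inter> space noise)"
      unfolding gaussian_law_eq_mix[OF \<nu> L'] by (subst measure_distr) auto
    moreover have "measure (\<mu> d) G = measure noise (mix (L d) -` G \<inter> space noise)" for d
      unfolding gaussian_law_eq_mix[OF law L] by (subst measure_distr) auto
    ultimately have "\<forall>\<^sub>F d in sequentially. measure (\<mu> (t (s d))) G < measure \<nu> G + e"
      by simp
    then obtain d where "measure (\<mu> (t (s d))) G < measure \<nu> G + e"
      by (auto dest: eventually_happens)
    with t(2)[of "s d"] show False by simp
  qed
  with \<nu> show ?thesis by blast
qed

section \<open>Weak limits through countably many functionals\<close>

lemma variance_comb:
  fixes Y :: "'i \<Rightarrow> 'w \<Rightarrow> real"
  assumes P: "prob_space P" and F: "finite F" and Y: "\<And>l. l \<in> F \<Longrightarrow> centered_gaussian_rv P (Y l)"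
  shows "(\<integral>\<omega>. (\<Sum>l\<in>F. a l * Y l \<omega>)\<^sup>2 \<partial>P) = (\<Sum>l\<in>F. \<Sum>l'\<in>F. a l * a l' * (\<integral>\<omega>. Y l \<omega> * Y l' \<omega> \<partial>P))"
proof -
  have int: "integrable P (\<lambda>\<omega>. Y l \<omega> * Y l' \<omega>)" if "l \<in> F" "l' \<in> F" for l l'
    by (intro gaussian_integrable_mult[OF P] Y that)
  have "(\<integral>\<omega>. (\<Sum>l\<in>F. a l * Y l \<omega>)\<^sup>2 \<partial>P) = (\<integral>\<omega>. (\<Sum>l\<in>F. \<Sum>l'\<in>F. a l * a l' * (Y l \<omega> * Y l' \<omega>)) \<partial>P)"
    unfolding power2_eq_square sum_product by (simp add: mult_ac)
  also have "\<dots> = (\<Sum>l\<in>F. \<Sum>l'\<in>F. a l * a l' * (\<integral>\<omega>. Y l \<omega> * Y l' \<omega> \<partial>P))"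
    using int by (subst Bochner_Integration.integral_sum)
      (auto intro!: Bochner_Integration.integrable_sum sum.cong simp: Bochner_Integration.integral_sum)
  finally show ?thesis .
qed

section \<open>Borel sets of an abstract topology, and the return from sequences to it\<close>

lemma space_borel_of [simp]: "space (borel_of T) = topspace T"
  unfolding borel_of_def by (rule space_measure_of) (auto dest: openin_subset)

lemma sets_borel_of: "sets (borel_of T) = sigma_sets (topspace T) {U. openin T U}"
  unfolding borel_of_def by (rule sets_measure_of) (auto dest: openin_subset)

lemma openin_borel_of: "openin T U \<Longrightarrow> U \<in> sets (borel_of T)"
  unfolding sets_borel_of by (rule sigma_sets.Basic) simp

lemma closedin_borel_of: "closedin T F \<Longrightarrow> F \<in> sets (borel_of T)"
  using sets.compl_sets[OF openin_borel_of[of T "topspace T - F"]]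
  by (simp add: closedin_def double_diff)

lemma measurable_borel_ofI:
  assumes "\<And>x. x \<in> space N \<Longrightarrow> h x \<in> topspace T"
    and "\<And>F. closedin T F \<Longrightarrow> {x \<in> space N. h x \<in> F} \<in> sets N"
  shows "h \<in> measurable N (borel_of T)"
  unfolding borel_of_def
proof (rule measurable_measure_of)
  fix U assume "U \<in> {U. openin T U}"
  then have U: "openin T U" by simp
  have "h -` U \<inter> space N = space N - {x \<in> space N. h x \<in> topspace T - U}"
    using assms(1) by auto
  also have "\<dots> \<in> sets N"
    using assms(2)[of "topspace T - U"] U by (intro sets.compl_sets) auto
  finally show "h -` U \<inter> space N \<in> sets N" .
qed (use assms(1) in \<open>auto dest: openin_subset\<close>)

text \<open>The coordinate map need not be a homeomorphism onto its image. On closed sets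
  \<open>\<kappa>\<close> of sequences that carry nearly all the mass, the part of the image of a
  closed set inside \<open>\<kappa>\<close> is closed. Bounds for closed sets of sequences thus
  become bounds for closed sets of \<open>T\<close>, and the limit law can be pulled back.\<close>

theorem gaussian_weak_limit:
  fixes T :: "'f topology" and D :: "nat \<Rightarrow> 'f \<Rightarrow> real" and X :: "nat \<Rightarrow> 'w \<Rightarrow> 'f"
  assumes P: "\<And>d. prob_space (P d)"
    and X: "\<And>d. X d \<in> measurable (P d) (borel_of T)"
    and D: "\<And>l. D l \<in> borel_measurable (borel_of T)"
    and V: "\<And>d. gaussian_space (P d) (V d)"
    and DX: "\<And>d l. (\<lambda>\<omega>. D l (X d \<omega>)) \<in> V d"
    and cov: "\<And>l l'. (\<lambda>d. \<integral>\<omega>. D l (X d \<omega>) * D l' (X d \<omega>) \<partial>P d) \<longlonglongrightarrow> \<Gamma> l l'"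
    and inj: "\<And>f g. f \<in> topspace T \<Longrightarrow> g \<in> topspace T \<Longrightarrow> (\<And>l. D l f = D l g) \<Longrightarrow> f = g"
    and tight: "\<And>e. e > 0 \<Longrightarrow> \<exists>\<kappa>. closed \<kappa> \<and>
      (\<forall>\<^sub>F d in sequentially. measure (P d) {\<omega> \<in> space (P d). (\<lambda>l. D l (X d \<omega>)) \<notin> \<kappa>} \<le> e) \<and>
      (\<forall>F. closedin T F \<longrightarrow> closed ((\<lambda>f l. D l f) ` F \<inter> \<kappa>))"
  shows "\<exists>Q. prob_space Q \<and> sets Q = sets (borel_of T) \<and>
    (\<forall>N a. (CLINT f|Q. iexp (\<Sum>l<N. a l * D l f)) =
       of_real (exp (- (\<Sum>l<N. \<Sum>l'<N. a l * a l' * \<Gamma> l l') / 2))) \<and>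
    (\<forall>F e. closedin T F \<longrightarrow> e > 0 \<longrightarrow>
       (\<forall>\<^sub>F d in sequentially. measure (P d) {\<omega> \<in> space (P d). X d \<omega> \<in> F} < measure Q F + e))"
proof -
  interpret P: prob_space "P d" for d by (rule P)
  define pi where "pi f l = D l f" for f l
  define \<mu> where "\<mu> d = distr (P d) borel (\<lambda>\<omega>. pi (X d \<omega>))" for d
  have XT: "X d \<omega> \<in> topspace T" if "\<omega> \<in> space (P d)" for d \<omega>
    using measurable_space[OF X that] by simp
  have [measurable]: "(\<lambda>\<omega>. D l (X d \<omega>)) \<in> borel_measurable (P d)" for l d
    using measurable_comp[OF X[of d] D[of l]] by (simp add: comp_def)
  have pim[measurable]: "(\<lambda>\<omega>. pi (X d \<omega>)) \<in> borel_measurable (P d)" for d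
    unfolding pi_def[abs_def] by (rule measurable_coordinatewise_then_product) measurable
  have piT[measurable]: "pi \<in> borel_measurable (borel_of T)"
    unfolding pi_def[abs_def] by (rule measurable_coordinatewise_then_product) (rule D)
  have coord[measurable]: "(\<lambda>x::nat \<Rightarrow> real. x l) \<in> borel_measurable borel" for l
    by (rule borel_measurable_continuous_onI) simp
  have law: "gaussian_law (\<mu> d) (\<lambda>l l'. \<integral>\<omega>. D l (X d \<omega>) * D l' (X d \<omega>) \<partial>P d)" for d
    unfolding gaussian_law_def
  proof (intro conjI allI)
    show "prob_space (\<mu> d)" unfolding \<mu>_def by (rule P.prob_space_distr) (rule pim)
    show "sets (\<mu> d) = sets borel" by (simp add: \<mu>_def)
    fix N and a :: "nat \<Rightarrow> real"
    let ?Y = "\<lambda>\<omega>. \<Sum>l<N. a l * D l (X d \<omega>)"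
    have "(CLINT x|\<mu> d. iexp (\<Sum>l<N. a l * x l)) = (CLINT \<omega>|P d. iexp (1 * ?Y \<omega>))"
      unfolding \<mu>_def by (subst integral_distr) (auto simp: pi_def)
    also have "\<dots> = of_real (exp (- (1\<^sup>2 * (\<integral>\<omega>. (?Y \<omega>)\<^sup>2 \<partial>P d)) / 2))"
    proof (cases "N = 0")
      case False
      then show ?thesis
        using DX by (intro gaussian_char[OF P] gaussian_space_rv[OF V] gaussian_space_comb[OF V]) auto
    qed (simp add: P.prob_space)
    also have "(\<integral>\<omega>. (?Y \<omega>)\<^sup>2 \<partial>P d) =
        (\<Sum>l<N. \<Sum>l'<N. a l * a l' * (\<integral>\<omega>. D l (X d \<omega>) * D l' (X d \<omega>) \<partial>P d))"
      by (rule variance_comb[OF P]) (auto intro: gaussian_space_rv[OF V] DX)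
    finally show "(CLINT x|\<mu> d. iexp (\<Sum>l<N. a l * x l)) =
        of_real (exp (- (\<Sum>l<N. \<Sum>l'<N. a l * a l' * (\<integral>\<omega>. D l (X d \<omega>) * D l' (X d \<omega>) \<partial>P d)) / 2))"
      by simp
  qed
  have fac: "\<exists>L. lower_factor L (\<lambda>l l'. \<integral>\<omega>. D l (X d \<omega>) * D l' (X d \<omega>) \<partial>P d)" for d
    by (rule cholesky_factor_exists) (auto intro!: gaussian_integrable_power[OF P] gaussian_space_rv[OF V] DX)
  obtain \<nu> where \<nu>: "gaussian_law \<nu> \<Gamma>"
    and lim: "\<And>G e. closed G \<Longrightarrow> e > 0 \<Longrightarrow> \<forall>\<^sub>F d in sequentially. measure (\<mu> d) G < measure \<nu> G + e"
    using gaussian_law_limit[of \<mu> _ \<Gamma>, OF law fac cov] by blast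
  interpret \<nu>: prob_space \<nu> using \<nu> by (simp add: gaussian_law_def)
  have s\<nu>: "sets \<nu> = sets borel" using \<nu> by (simp add: gaussian_law_def)
  have sp\<nu>: "space \<nu> = UNIV" using sets_eq_imp_space_eq[OF s\<nu>] by simp
  have \<mu>m: "measure (\<mu> d) G = measure (P d) {\<omega> \<in> space (P d). pi (X d \<omega>) \<in> G}"
    if "closed G" for d G
    unfolding \<mu>_def using that by (subst measure_distr) (auto simp: borel_closed vimage_def Int_def conj_commute)
  have "\<forall>m::nat. \<exists>\<kappa>. closed \<kappa> \<and>
      (\<forall>\<^sub>F d in sequentially. measure (P d) {\<omega> \<in> space (P d). pi (X d \<omega>) \<notin> \<kappa>} \<le> inverse (Suc m)) \<and>
      (\<forall>F. closedin T F \<longrightarrow> closed (pi ` F \<inter> \<kappa>))"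
    using tight[of "inverse (Suc m)" for m] unfolding pi_def[abs_def] by simp
  from choice[OF this] obtain \<kappa> where \<kappa>: "\<And>m. closed (\<kappa> m)"
    and tight': "\<And>m. \<forall>\<^sub>F d in sequentially. measure (P d) {\<omega> \<in> space (P d). pi (X d \<omega>) \<notin> \<kappa> m} \<le> inverse (Suc m)"
    and cl: "\<And>m F. closedin T F \<Longrightarrow> closed (pi ` F \<inter> \<kappa> m)"
    by blast
  have [measurable]: "\<kappa> m \<in> sets borel" for m using \<kappa> by (rule borel_closed)
  have [measurable]: "pi ` F \<inter> \<kappa> m \<in> sets borel" if "closedin T F" for m F
    using cl[OF that] by (rule borel_closed)
  \<comment> \<open>Either the coordinate sequence lies in \<open>\<kappa> m\<close>, and then
    \<open>X d \<omega> \<in> F\<close> puts it into a closed set, or it does not, which for large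
    \<open>d\<close> has probability at most 1 / (m + 1).\<close>
  have bound: "\<forall>\<^sub>F d in sequentially. measure (P d) {\<omega> \<in> space (P d). X d \<omega> \<in> F} <
      measure \<nu> (pi ` F \<inter> \<kappa> m) + e + inverse (Suc m)" if F: "closedin T F" and e: "e > 0" for F e m
    using lim[OF cl[OF F] e, of m] tight'[of m]
  proof eventually_elim
    case (elim d)
    have [measurable]: "{\<omega> \<in> space (P d). X d \<omega> \<in> F} \<in> sets (P d)"
      using measurable_sets[OF X closedin_borel_of[OF F], of d] by (simp add: vimage_def Int_def conj_commute)
    have m1: "{\<omega> \<in> space (P d). pi (X d \<omega>) \<in> pi ` F \<inter> \<kappa> m} \<in> sets (P d)"
      using measurable_sets[OF pim borel_closed[OF cl[OF F]], of d m]
      by (simp add: vimage_def Int_def conj_commute)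
    have m2: "{\<omega> \<in> space (P d). pi (X d \<omega>) \<notin> \<kappa> m} \<in> sets (P d)"
      by measurable
    have "measure (P d) {\<omega> \<in> space (P d). X d \<omega> \<in> F} \<le>
        measure (P d) ({\<omega> \<in> space (P d). pi (X d \<omega>) \<in> pi ` F \<inter> \<kappa> m} \<union> {\<omega> \<in> space (P d). pi (X d \<omega>) \<notin> \<kappa> m})"
      using F by (intro P.finite_measure_mono sets.Un m1 m2) auto
    also have "\<dots> \<le> measure (P d) {\<omega> \<in> space (P d). pi (X d \<omega>) \<in> pi ` F \<inter> \<kappa> m} +
        measure (P d) {\<omega> \<in> space (P d). pi (X d \<omega>) \<notin> \<kappa> m}"
      by (rule measure_Un_le[OF m1 m2])
    also have "\<dots> < measure \<nu> (pi ` F \<inter> \<kappa> m) + e + inverse (Suc m)"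
      using elim unfolding \<mu>m[OF cl[OF F]] by simp
    finally show ?case .
  qed
  define S where "S = (\<Union>m. pi ` topspace T \<inter> \<kappa> m)"
  have Sm[measurable]: "S \<in> sets borel" unfolding S_def by (intro sets.countable_UN) auto
  \<comment> \<open>The whole space is closed and has probability 1 under every \<open>X d\<close>,
    so \<open>bound\<close> leaves no mass of the limit law outside the image.\<close>
  have "measure \<nu> S \<ge> 1"
  proof (rule field_le_epsilon)
    fix e :: real assume e: "e > 0"
    obtain m where m: "inverse (Suc m) < e / 2" using reals_Archimedean[of "e / 2"] e by auto
    have full: "{\<omega> \<in> space (P d). X d \<omega> \<in> topspace T} = space (P d)" for d using XT by auto
    have "\<forall>\<^sub>F d in sequentially. 1 < measure \<nu> (pi ` topspace T \<inter> \<kappa> m) + e / 2 + inverse (Suc m)"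
      using bound[OF closedin_topspace half_gt_zero[OF e], of m] unfolding full P.prob_space .
    then have "1 < measure \<nu> (pi ` topspace T \<inter> \<kappa> m) + e / 2 + inverse (Suc m)"
      by (auto dest: eventually_happens)
    moreover have "measure \<nu> (pi ` topspace T \<inter> \<kappa> m) \<le> measure \<nu> S"
    proof (rule \<nu>.finite_measure_mono)
      show "S \<in> sets \<nu>" using Sm by (simp add: s\<nu>)
    qed (auto simp: S_def)
    ultimately show "1 \<le> measure \<nu> S + e" using m by simp
  qed
  then have AES: "AE v in \<nu>. v \<in> S"
    using \<nu>.prob_eq_1[of S] \<nu>.measure_le_1[of S] by (simp add: s\<nu> antisym)
  obtain f0 where f0: "f0 \<in> topspace T"
    using XT[of _ 0] P.not_empty[of 0] by blast
  \<comment> \<open>Inverse of the coordinate map on \<open>S\<close>; the default \<open>f0\<close>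
    is met only on a null set.\<close>
  define h where "h v = (if v \<in> S then inv_into (topspace T) pi v else f0)" for v
  have hT: "h v \<in> topspace T" for v
    unfolding h_def S_def using f0 by (auto intro: inv_into_into)
  have pih: "pi (h v) = v" if "v \<in> S" for v
    using that unfolding h_def S_def by (auto intro: f_inv_into_f)
  have hF: "h v \<in> F \<longleftrightarrow> v \<in> pi ` F" if "v \<in> S" "closedin T F" for v F
  proof
    show "h v \<in> F \<Longrightarrow> v \<in> pi ` F" using pih[OF that(1)] by force
    assume "v \<in> pi ` F"
    then obtain f where f: "f \<in> F" "v = pi f" by auto
    have "f = h v"
    proof (rule inj)
      show "f \<in> topspace T" using f closedin_subset[OF that(2)] by auto
      show "D l f = D l (h v)" for l using f pih[OF that(1)] by (metis pi_def)
    qed (rule hT)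
    then show "h v \<in> F" using f(1) by (rule subst)
  qed
  have h[measurable]: "h \<in> measurable \<nu> (borel_of T)"
  proof (rule measurable_borel_ofI)
    fix F assume F: "closedin T F"
    \<comment> \<open>A countable union of closed sets, together with the complement of
      \<open>S\<close> in case the default \<open>f0\<close> lies in \<open>F\<close>.\<close>
    have "{x \<in> space \<nu>. h x \<in> F} = (\<Union>m. pi ` F \<inter> \<kappa> m) \<union> (if f0 \<in> F then - S else {})"
    proof (intro set_eqI)
      fix x
      show "x \<in> {x \<in> space \<nu>. h x \<in> F} \<longleftrightarrow> x \<in> (\<Union>m. pi ` F \<inter> \<kappa> m) \<union> (if f0 \<in> F then - S else {})"
      proof (cases "x \<in> S")
        case True
        then show ?thesis using hF[OF True F] by (auto simp: sp\<nu> S_def)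
      next
        case False
        then have "x \<notin> (\<Union>m. pi ` F \<inter> \<kappa> m)" using closedin_subset[OF F] by (auto simp: S_def)
        then show ?thesis using False by (auto simp: sp\<nu> h_def)
      qed
    qed
    also have "\<dots> \<in> sets borel"
      using cl[OF F] borel_comp[OF Sm] by (intro sets.Un sets.countable_UN) (auto intro: borel_closed)
    finally show "{x \<in> space \<nu>. h x \<in> F} \<in> sets \<nu>" by (simp add: s\<nu>)
  qed (rule hT)
  define Q where "Q = distr \<nu> (borel_of T) h"
  show ?thesis
  proof (intro exI[of _ Q] conjI allI impI)
    show "prob_space Q" unfolding Q_def by (rule \<nu>.prob_space_distr) (rule h)
    show "sets Q = sets (borel_of T)" by (simp add: Q_def)
    fix N and a :: "nat \<Rightarrow> real"
    have [measurable]: "(\<lambda>x. x l) \<in> borel_measurable \<nu>" for l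
      by (simp add: measurable_cong_sets[OF s\<nu> refl])
    have hm: "(\<lambda>v. D l (h v)) \<in> borel_measurable \<nu>" for l
      using measurable_comp[OF h D[of l]] by (simp add: comp_def)
    have "(CLINT f|Q. iexp (\<Sum>l<N. a l * D l f)) = (CLINT v|\<nu>. iexp (\<Sum>l<N. a l * D l (h v)))"
      unfolding Q_def using D by (subst integral_distr[OF h]) auto
    also have "\<dots> = (CLINT v|\<nu>. iexp (\<Sum>l<N. a l * v l))"
    proof (rule integral_cong_AE)
      show "AE v in \<nu>. iexp (\<Sum>l<N. a l * D l (h v)) = iexp (\<Sum>l<N. a l * v l)"
        using AES by eventually_elim (metis (no_types) pih pi_def)
    qed (use hm in measurable)
    also have "\<dots> = of_real (exp (- (\<Sum>l<N. \<Sum>l'<N. a l * a l' * \<Gamma> l l') / 2))"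
      using \<nu> by (simp add: gaussian_law_def)
    finally show "(CLINT f|Q. iexp (\<Sum>l<N. a l * D l f)) =
       of_real (exp (- (\<Sum>l<N. \<Sum>l'<N. a l * a l' * \<Gamma> l l') / 2))" .
  next
    fix F and e :: real assume F: "closedin T F" and e: "e > 0"
    obtain m where m: "inverse (Suc m) < e / 2" using reals_Archimedean[of "e / 2"] e by auto
    have "measure \<nu> (pi ` F \<inter> \<kappa> m) \<le> measure \<nu> (h -` F \<inter> space \<nu>)"
    proof (rule \<nu>.finite_measure_mono)
      show "pi ` F \<inter> \<kappa> m \<subseteq> h -` F \<inter> space \<nu>"
        using hF[OF _ F] closedin_subset[OF F] by (auto simp: sp\<nu> S_def)
      show "h -` F \<inter> space \<nu> \<in> sets \<nu>" by (rule measurable_sets[OF h closedin_borel_of[OF F]])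
    qed
    also have "\<dots> = measure Q F"
      unfolding Q_def by (rule measure_distr[symmetric, OF h closedin_borel_of[OF F]])
    finally have le: "measure \<nu> (pi ` F \<inter> \<kappa> m) \<le> measure Q F" .
    show "\<forall>\<^sub>F d in sequentially. measure (P d) {\<omega> \<in> space (P d). X d \<omega> \<in> F} < measure Q F + e"
      using bound[OF F, of "e / 2" m] e le m by (auto elim!: eventually_mono)
  qed
qed

section \<open>Iterated partial derivatives\<close>

text \<open>On a thick set the derivative along a coordinate line within the set is unique, since no
  point is isolated on its line. Cubes with positive sides and relatively open subsets of the
  half-space are of this kind.\<close>

definition thick :: "nat \<Rightarrow> (nat \<Rightarrow> real) set \<Rightarrow> bool" where
  "thick n V \<longleftrightarrow> (\<forall>x\<in>V. \<forall>i<n. x i islimpt {t. x(i := t) \<in> V})"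

text \<open>Unlike \<^const>\<open>Cr_on\<close>, this notion passes to arbitrary subsets of \<open>V\<close>.\<close>

definition Cr_with ::
    "nat \<Rightarrow> enat \<Rightarrow> (nat \<Rightarrow> real) set \<Rightarrow> ((nat \<Rightarrow> real) \<Rightarrow> 'b::real_normed_vector) \<Rightarrow>
     (nat list \<Rightarrow> (nat \<Rightarrow> real) \<Rightarrow> 'b) \<Rightarrow> bool" where
  "Cr_with n r V f g \<longleftrightarrow> (\<forall>x\<in>V. g [] x = f x) \<and>
     (\<forall>is\<in>directions n r. continuous_on V (g is)) \<and>
     (\<forall>i is. i # is \<in> directions n r \<longrightarrow> (\<forall>x\<in>V.
        ((\<lambda>t. g is (x(i := t))) has_vector_derivative g (i # is) x) (at (x i) within {t. x(i := t) \<in> V})))"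

lemma directions_Nil [simp]: "[] \<in> directions n r"
  by (simp add: directions_def enat_0)

lemma directions_ConsD: "i # is \<in> directions n r \<Longrightarrow> i < n \<and> is \<in> directions n r"
proof -
  assume "i # is \<in> directions n r"
  then have a: "i < n" "set is \<subseteq> {..<n}" "enat (Suc (length is)) \<le> r"
    by (simp_all add: directions_def)
  have "enat (length is) \<le> r" by (rule order_trans[OF _ a(3)]) simp
  with a show ?thesis by (simp add: directions_def)
qed

lemma directions_mono: "r \<le> s \<Longrightarrow> directions n r \<subseteq> directions n s"
proof (rule subsetI)
  fix "is" assume "r \<le> s" "is \<in> directions n r"
  then show "is \<in> directions n s"
    using order.trans[of "enat (length is)" r s] by (simp add: directions_def)
qed

lemma finite_directions: "finite (directions n (enat m))"
  unfolding directions_def using finite_lists_length_le[of "{..<n}" m] by simp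

lemma partial_deriv_eqI:
  assumes "thick n V" "x \<in> V" "i < n"
    and "((\<lambda>t. f (x(i := t))) has_vector_derivative D) (at (x i) within {t. x(i := t) \<in> V})"
  shows "partial_deriv V i f x = D"
  unfolding partial_deriv_def
  by (rule vector_derivative_within[OF _ assms(4)])
     (use assms(1-3) in \<open>auto simp: thick_def trivial_limit_within\<close>)

lemma Cr_onD:
  assumes "Cr_on n r V f"
  shows "Cr_with n r V f (\<lambda>is. iter_partial V is f)"
  unfolding Cr_with_def
proof (intro conjI allI ballI impI)
  show "continuous_on V (iter_partial V is f)" if "is \<in> directions n r" for "is"
    using assms that by (simp add: Cr_on_def)
  show "((\<lambda>t. iter_partial V is f (x(i := t))) has_vector_derivative iter_partial V (i # is) f x)
      (at (x i) within {t. x(i := t) \<in> V})" if "i # is \<in> directions n r" "x \<in> V" for i "is" x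
    unfolding iter_partial.simps partial_deriv_def
    using assms that unfolding Cr_on_def partial_differentiable_def
    by (intro vector_derivative_works[THEN iffD1]) blast
qed simp

lemma Cr_with_deriv:
  "Cr_with n r V f g \<Longrightarrow> i # is \<in> directions n r \<Longrightarrow> x \<in> V \<Longrightarrow>
    ((\<lambda>t. g is (x(i := t))) has_vector_derivative g (i # is) x) (at (x i) within {t. x(i := t) \<in> V})"
  unfolding Cr_with_def by (elim conjE) simp

lemma Cr_with_continuous: "Cr_with n r V f g \<Longrightarrow> is \<in> directions n r \<Longrightarrow> continuous_on V (g is)"
  unfolding Cr_with_def by (elim conjE) simp

lemma Cr_with_Nil: "Cr_with n r V f g \<Longrightarrow> x \<in> V \<Longrightarrow> g [] x = f x"
  unfolding Cr_with_def by (elim conjE) simp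

text \<open>Induction on the word of directions, by uniqueness of line derivatives. Continuity of
  \<open>g\<close> is kept out of this statement because for covariances the line derivatives are
  known first.\<close>

lemma iter_partial_lines:
  assumes V: "thick n V" and base: "\<And>x. x \<in> V \<Longrightarrow> g [] x = f x"
    and lines: "\<And>i is x. i # is \<in> directions n r \<Longrightarrow> x \<in> V \<Longrightarrow>
      ((\<lambda>t. g is (x(i := t))) has_vector_derivative g (i # is) x) (at (x i) within {t. x(i := t) \<in> V})"
    and "is": "is \<in> directions n r" and x: "x \<in> V"
  shows "iter_partial V is f x = g is x"
  using "is" x
proof (induction "is" arbitrary: x)
  case Nil
  then show ?case using base by simp
next
  case (Cons i "is")
  have i: "i < n" "is \<in> directions n r" using directions_ConsD[OF Cons.prems(1)] by auto
  have "((\<lambda>t. iter_partial V is f (x(i := t))) has_vector_derivative g (i # is) x)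
      (at (x i) within {t. x(i := t) \<in> V})"
    by (rule has_vector_derivative_transform[OF _ _ lines[OF Cons.prems]])
       (use Cons.prems Cons.IH[OF i(2)] in auto)
  then show ?case by (simp add: partial_deriv_eqI[OF V Cons.prems(2) i(1)])
qed

text \<open>Converse of \<open>Cr_onD\<close> on thick sets: a family with the right line
  derivatives has to be the family of iterated partial derivatives.\<close>

lemma Cr_onI:
  assumes V: "thick n V" and g: "Cr_with n r V f g"
  shows "Cr_on n r V f"
    and iter_partial_eqI: "is \<in> directions n r \<Longrightarrow> x \<in> V \<Longrightarrow> iter_partial V is f x = g is x"
proof -
  have eq: "iter_partial V is f x = g is x" if "is \<in> directions n r" "x \<in> V" for "is" x
    by (rule iter_partial_lines[OF V Cr_with_Nil[OF g] Cr_with_deriv[OF g] that])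
  then show "is \<in> directions n r \<Longrightarrow> x \<in> V \<Longrightarrow> iter_partial V is f x = g is x" .
  show "Cr_on n r V f"
    unfolding Cr_on_def partial_differentiable_def
  proof (intro conjI ballI allI impI)
    show "continuous_on V (iter_partial V is f)" if "is \<in> directions n r" for "is"
      using Cr_with_continuous[OF g that] eq[OF that] by (simp cong: continuous_on_cong)
    show "(\<lambda>t. iter_partial V is f (x(i := t))) differentiable at (x i) within {t. x(i := t) \<in> V}"
      if i: "i # is \<in> directions n r" "x \<in> V" for i "is" x
    proof (rule differentiableI_vector, rule has_vector_derivative_transform)
      show "((\<lambda>t. g is (x(i := t))) has_vector_derivative g (i # is) x) (at (x i) within {t. x(i := t) \<in> V})"
        by (rule Cr_with_deriv[OF g i])
    qed (use i eq directions_ConsD[OF i(1)] in auto)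
  qed
qed

lemma Cr_with_subset:
  assumes g: "Cr_with n r W f g" and VW: "V \<subseteq> W"
  shows "Cr_with n r V f g"
  unfolding Cr_with_def
proof (intro conjI allI ballI impI)
  show "g [] x = f x" if "x \<in> V" for x
    by (rule Cr_with_Nil[OF g subsetD[OF VW that]])
  show "continuous_on V (g is)" if "is \<in> directions n r" for "is"
    by (rule continuous_on_subset[OF Cr_with_continuous[OF g that] VW])
  show "((\<lambda>t. g is (x(i := t))) has_vector_derivative g (i # is) x) (at (x i) within {t. x(i := t) \<in> V})"
    if "i # is \<in> directions n r" "x \<in> V" for i "is" x
    by (rule has_vector_derivative_within_subset[OF Cr_with_deriv[OF g that(1) subsetD[OF VW that(2)]]])
       (use VW in auto)
qed

lemma Cr_with_cong:
  "Cr_with n r V f g \<Longrightarrow> (\<And>x. x \<in> V \<Longrightarrow> f x = f' x) \<Longrightarrow> Cr_with n r V f' g"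
  unfolding Cr_with_def by simp

lemma open_line: "open A \<Longrightarrow> open {t::real. x(i := t) \<in> (A :: (nat \<Rightarrow> real) set)}"
proof -
  assume "open A"
  have "continuous_on UNIV (\<lambda>t. x(i := t))"
  proof (rule continuous_on_coordinatewise_then_product)
    show "continuous_on UNIV (\<lambda>t. (x(i := t)) j)" for j by (cases "j = i") auto
  qed
  then have "open ((\<lambda>t. x(i := t)) -` A)" using \<open>open A\<close> by (rule open_vimage[rotated])
  then show ?thesis by (simp add: vimage_def)
qed

text \<open>Continuity and line derivatives at a point depend only on an open neighbourhood
  \<open>A\<close> of it, because a coordinate line meets \<open>A\<close> in an open set of
  parameters.\<close>

lemma Cr_with_local:
  assumes loc: "\<And>x. x \<in> W \<Longrightarrow> \<exists>A. open A \<and> x \<in> A \<and> Cr_with n r (W \<inter> A) f g"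
  shows "Cr_with n r W f g"
  unfolding Cr_with_def
proof (intro conjI ballI allI impI)
  show "g [] x = f x" if "x \<in> W" for x using loc[OF that] that by (auto simp: Cr_with_def)
  show "continuous_on W (g is)" if "is \<in> directions n r" for "is"
    unfolding continuous_on_eq_continuous_within
  proof
    fix x assume "x \<in> W"
    then obtain A where A: "open A" "x \<in> A" "Cr_with n r (W \<inter> A) f g"
      using loc by blast
    then have "continuous_on (W \<inter> A) (g is)" using that by (simp add: Cr_with_def)
    then have "continuous (at x within W \<inter> A) (g is)"
      using \<open>x \<in> W\<close> A(2) by (simp add: continuous_on_eq_continuous_within)
    also have "at x within W \<inter> A = at x within W"
      by (rule at_within_nhd[OF A(2,1)]) auto
    finally show "continuous (at x within W) (g is)" .
  qed
  fix i "is" x assume i: "i # is \<in> directions n r" and x: "x \<in> W"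
  obtain A where A: "open A" "x \<in> A" "Cr_with n r (W \<inter> A) f g" using loc[OF x] by auto
  have "at (x i) within {t. x(i := t) \<in> W \<inter> A} = at (x i) within {t. x(i := t) \<in> W}"
    by (rule at_within_nhd[OF _ open_line[OF A(1), of x i]]) (use A in auto)
  moreover have "((\<lambda>t. g is (x(i := t))) has_vector_derivative g (i # is) x)
      (at (x i) within {t. x(i := t) \<in> W \<inter> A})"
    using A(3) i x A(2) unfolding Cr_with_def by blast
  ultimately show "((\<lambda>t. g is (x(i := t))) has_vector_derivative g (i # is) x) (at (x i) within {t. x(i := t) \<in> W})"
    by (simp only:)
qed

lemma has_vector_derivative_iff_quotient:
  "(f has_vector_derivative D) (at x within S) \<longleftrightarrow>
    ((\<lambda>t. (f t - f x) /\<^sub>R (t - x)) \<longlongrightarrow> D) (at x within S)"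
proof -
  have "(f has_vector_derivative D) (at x within S) \<longleftrightarrow>
      ((\<lambda>t. norm ((f t - f x) - (t - x) *\<^sub>R D) / norm (t - x)) \<longlongrightarrow> 0) (at x within S)"
    unfolding has_vector_derivative_def has_derivative_iff_norm
    by (simp add: bounded_linear_scaleR_left)
  also have "\<dots> \<longleftrightarrow> ((\<lambda>t. norm ((f t - f x) /\<^sub>R (t - x) - D)) \<longlongrightarrow> 0) (at x within S)"
  proof (rule tendsto_cong)
    have "norm ((f t - f x) - (t - x) *\<^sub>R D) / norm (t - x) = norm ((f t - f x) /\<^sub>R (t - x) - D)"
      if "t \<noteq> x" for t
    proof -
      have "(f t - f x) /\<^sub>R (t - x) - D = ((f t - f x) - (t - x) *\<^sub>R D) /\<^sub>R (t - x)"
        using that by (simp add: scaleR_diff_right)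
      then show ?thesis by (simp add: divide_inverse mult.commute)
    qed
    then show "\<forall>\<^sub>F t in at x within S. norm ((f t - f x) - (t - x) *\<^sub>R D) / norm (t - x)
        = norm ((f t - f x) /\<^sub>R (t - x) - D)"
      by (auto simp: eventually_at_filter)
  qed
  also have "\<dots> \<longleftrightarrow> ((\<lambda>t. (f t - f x) /\<^sub>R (t - x)) \<longlongrightarrow> D) (at x within S)"
    unfolding tendsto_norm_zero_iff by (rule LIM_zero_iff)
  finally show ?thesis .
qed

section \<open>Cubes: chain rule, uniform limits, and cubes as neighbourhoods\<close>

definition cube :: "nat \<Rightarrow> (nat \<Rightarrow> real) \<Rightarrow> (nat \<Rightarrow> real) \<Rightarrow> (nat \<Rightarrow> real) set" where
  "cube n a b = {y. (\<forall>l<n. a l \<le> y l \<and> y l \<le> b l) \<and> (\<forall>l\<ge>n. y l = 0)}"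

lemma cube_line: "x \<in> cube n a b \<Longrightarrow> i < n \<Longrightarrow> {t. x(i := t) \<in> cube n a b} = {a i..b i}"
proof (rule set_eqI)
  fix t assume "x \<in> cube n a b" "i < n"
  then show "t \<in> {t. x(i := t) \<in> cube n a b} \<longleftrightarrow> t \<in> {a i..b i}"
    unfolding cube_def mem_Collect_eq atLeastAtMost_iff fun_upd_apply by (metis leD)
qed

lemma thick_cube:
  assumes "\<And>i. i < n \<Longrightarrow> a i < b i"
  shows "thick n (cube n a b)"
  unfolding thick_def
proof (intro ballI allI impI)
  fix x i assume x: "x \<in> cube n a b" and i: "i < n"
  then have "x i \<in> {a i..b i}" by (simp add: cube_def)
  then show "x i islimpt {t. x(i := t) \<in> cube n a b}"
    unfolding cube_line[OF x i] using assms[OF i]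
    by (auto intro!: islimpt_closure_open[where s="{a i<..<b i}"])
qed

lemma open_product_nbhd:
  fixes A :: "(nat \<Rightarrow> real) set"
  assumes "open A" "x \<in> A"
  shows "\<exists>e>0. \<forall>y. (\<forall>l<n. \<bar>y l - x l\<bar> < e) \<longrightarrow> (\<forall>l\<ge>n. y l = x l) \<longrightarrow> y \<in> A"
proof -
  have "openin (product_topology (\<lambda>_. euclidean) UNIV) A"
    using assms by (simp add: euclidean_product_topology)
  then obtain U where U: "x \<in> (\<Pi>\<^sub>E i\<in>UNIV. U i)" "\<And>i. open (U i)" "(\<Pi>\<^sub>E i\<in>UNIV. U i) \<subseteq> A"
    using product_topology_open_contains_basis[OF _ assms(2)] by (metis open_openin)
  have "\<exists>e>0. \<forall>t. \<bar>t - x l\<bar> < e \<longrightarrow> t \<in> U l" for l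
    using U(1) U(2)[of l] unfolding open_dist by (auto simp: dist_real_def PiE_def Pi_def)
  then obtain e where e: "\<And>l. e l > 0" "\<And>l t. \<bar>t - x l\<bar> < e l \<Longrightarrow> t \<in> U l" by metis
  define d where "d = Min (insert 1 (e ` {..<n}))"
  have "d > 0" using e(1) by (auto simp: d_def)
  moreover have "y \<in> A" if y: "\<forall>l<n. \<bar>y l - x l\<bar> < d" "\<forall>l\<ge>n. y l = x l" for y
  proof -
    have "y l \<in> U l" for l
    proof (cases "l < n")
      case True
      then have "d \<le> e l" by (auto simp: d_def)
      then show ?thesis using y(1) True e(2) by force
    next
      case False
      then show ?thesis using y(2) U(1) by auto
    qed
    then show ?thesis using U(3) by auto
  qed
  ultimately show ?thesis by blast
qed

text \<open>The telescoping path changes one coordinate at a time, so it stays in the cube.\<close>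

lemma cube_chain_rule:
  fixes F :: "(nat \<Rightarrow> real) \<Rightarrow> 'b::real_normed_vector" and \<gamma> :: "real \<Rightarrow> nat \<Rightarrow> real"
  assumes cont: "\<And>l. l < n \<Longrightarrow> continuous_on (cube n a b) (F' l)"
    and der: "\<And>l x. l < n \<Longrightarrow> x \<in> cube n a b \<Longrightarrow>
      ((\<lambda>t. F (x(l := t))) has_vector_derivative F' l x) (at (x l) within {t. x(l := t) \<in> cube n a b})"
    and \<gamma>: "\<And>t. t \<in> S \<Longrightarrow> \<gamma> t \<in> cube n a b" "t0 \<in> S"
    and \<gamma>': "\<And>l. l < n \<Longrightarrow> ((\<lambda>t. \<gamma> t l) has_vector_derivative \<gamma>' l) (at t0 within S)"
  shows "((\<lambda>t. F (\<gamma> t)) has_vector_derivative (\<Sum>l<n. \<gamma>' l *\<^sub>R F' l (\<gamma> t0))) (at t0 within S)"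
proof -
  let ?Q = "cube n a b"
  define y where "y = \<gamma> t0"
  have yQ: "y \<in> ?Q" unfolding y_def by (rule \<gamma>(1)[OF \<gamma>(2)])
  define p where "p z k l = (if l < k then z l else y l)" for z :: "nat \<Rightarrow> real" and k l :: nat
  have pQ: "p z k \<in> ?Q" if "z \<in> ?Q" for z k
    using that yQ by (auto simp: cube_def p_def)
  have pS: "p z (Suc l) = (p z l)(l := z l)" for z l by (auto simp: p_def fun_eq_iff)
  have p0: "p z 0 = y" for z by (auto simp: p_def fun_eq_iff)
  have pn: "p z n = z" if "z \<in> ?Q" for z
    using that yQ by (auto simp: p_def fun_eq_iff cube_def)
  \<comment> \<open>Slope of \<open>F\<close> along the \<open>l\<close>-th leg of the path from
    \<open>y\<close> to \<open>z\<close>, completed by the derivative where the leg is trivial. The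
    increment of \<open>F\<close> is then an exact combination of coordinate increments, with
    coefficients that tend to \<open>F' l y\<close>.\<close>
  define A where "A l z = (if z l = y l then F' l y else (F (p z (Suc l)) - F (p z l)) /\<^sub>R (z l - y l))" for l z
  have tel: "F z - F y = (\<Sum>l<n. (z l - y l) *\<^sub>R A l z)" if "z \<in> ?Q" for z
  proof -
    have "(z l - y l) *\<^sub>R A l z = F (p z (Suc l)) - F (p z l)" for l
    proof (cases "z l = y l")
      case True
      then have "p z (Suc l) = p z l" unfolding pS by (simp add: fun_eq_iff p_def)
      with True show ?thesis by simp
    qed (simp add: A_def)
    then have "(\<Sum>l<n. (z l - y l) *\<^sub>R A l z) = F (p z n) - F (p z 0)"
      using sum_lessThan_telescope[of "\<lambda>k. F (p z k)" n] by simp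
    then show ?thesis using pn[OF that] p0 by simp
  qed
  have coordc: "((\<lambda>t. \<gamma> t l) \<longlongrightarrow> y l) (at t0 within S)" if "l < n" for l
    using has_vector_derivative_continuous[OF \<gamma>'[OF that]] by (simp add: continuous_within y_def)
  have Alim: "((\<lambda>t. A l (\<gamma> t)) \<longlongrightarrow> F' l y) (at t0 within S)" if l: "l < n" for l
  proof (rule tendstoI)
    fix e :: real assume e: "e > 0"
    obtain O' where O': "open O'" "y \<in> O'" "\<And>q. q \<in> O' \<Longrightarrow> q \<in> ?Q \<Longrightarrow> dist (F' l q) (F' l y) < e / 2"
    proof -
      have "open (ball (F' l y) (e / 2))" by simp
      then obtain O' where O': "open O'" and eq: "O' \<inter> ?Q = F' l -` ball (F' l y) (e / 2) \<inter> ?Q"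
        using cont[OF l] unfolding continuous_on_open_invariant by metis
      show ?thesis
      proof (rule that[OF O'])
        have "y \<in> O' \<inter> ?Q" unfolding eq using yQ e by simp
        then show "y \<in> O'" by simp
        fix q assume "q \<in> O'" "q \<in> ?Q"
        then have "q \<in> F' l -` ball (F' l y) (e / 2) \<inter> ?Q" unfolding eq[symmetric] by simp
        then show "dist (F' l q) (F' l y) < e / 2" by (simp add: dist_commute)
      qed
    qed
    obtain d where d: "d > 0" "\<And>q. (\<forall>l<n. \<bar>q l - y l\<bar> < d) \<Longrightarrow> (\<forall>l\<ge>n. q l = y l) \<Longrightarrow> q \<in> O'"
      using open_product_nbhd[OF O'(1,2), of n] by auto
    have small: "dist (A l z) (F' l y) < e" if z: "z \<in> ?Q" "\<forall>l<n. \<bar>z l - y l\<bar> < d" for z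
    proof (cases "z l = y l")
      case True
      then show ?thesis using e by (simp add: A_def)
    next
      case False
      let ?J = "closed_segment (y l) (z l)"
      let ?q = "\<lambda>t. (p z l)(l := t)"
      have J: "?J \<subseteq> {a l..b l}" using yQ z(1) l by (auto simp: cube_def closed_segment_eq_real_ivl)
      \<comment> \<open>Subtracting the linear part \<open>t *\<^sub>R F' l y\<close> leaves a
        derivative of norm at most \<open>e / 2\<close> close to \<open>y\<close>, and the mean
        value inequality then bounds the error of the slope.\<close>
      have dq: "((\<lambda>t. F (?q t) - t *\<^sub>R F' l y) has_derivative (\<lambda>h. h *\<^sub>R (F' l (?q t) - F' l y))) (at t within ?J)"
        if t: "t \<in> ?J" for t
      proof -
        have qQ: "?q t \<in> ?Q" using pQ[OF z(1), of l] t J l by (auto simp: cube_def)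
        have "((\<lambda>s. F ((?q t)(l := s))) has_vector_derivative F' l (?q t)) (at ((?q t) l) within {s. (?q t)(l := s) \<in> ?Q})"
          by (rule der[OF l qQ])
        then have "((\<lambda>s. F (?q s)) has_vector_derivative F' l (?q t)) (at t within {a l..b l})"
          unfolding cube_line[OF qQ l] by simp
        then have "((\<lambda>s. F (?q s)) has_vector_derivative F' l (?q t)) (at t within ?J)"
          using J by (rule has_vector_derivative_within_subset)
        then show ?thesis
          unfolding has_vector_derivative_def
          by (auto intro!: derivative_eq_intros simp: scaleR_diff_right)
      qed
      have "norm ((F (?q (z l)) - z l *\<^sub>R F' l y) - (F (?q (y l)) - y l *\<^sub>R F' l y)) \<le> e / 2 * norm (z l - y l)"
      proof (rule differentiable_bound[OF _ dq])
        show "onorm (\<lambda>h. h *\<^sub>R (F' l (?q t) - F' l y)) \<le> e / 2" if t: "t \<in> ?J" for t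
        proof (rule onorm_le)
          fix h :: real
          have qQ: "?q t \<in> ?Q" using pQ[OF z(1), of l] t J l by (auto simp: cube_def)
          have "\<bar>t - y l\<bar> \<le> \<bar>z l - y l\<bar>" using t by (auto simp: closed_segment_eq_real_ivl split: if_splits)
          then have "?q t \<in> O'"
            using z(2) l d(1) z(1) yQ by (intro d(2)) (auto simp: p_def cube_def)
          then have "norm (F' l (?q t) - F' l y) \<le> e / 2" using O'(3) qQ by (force simp: dist_norm)
          then have "norm (F' l (?q t) - F' l y) * \<bar>h\<bar> \<le> e / 2 * \<bar>h\<bar>"
            by (rule mult_right_mono) simp
          then show "norm (h *\<^sub>R (F' l (?q t) - F' l y)) \<le> e / 2 * norm h"
            by (simp add: mult.commute)
        qed
      qed (auto simp: convex_closed_segment)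
      moreover have "?q (y l) = p z l" by (auto simp: p_def fun_eq_iff)
      then have "(F (?q (z l)) - z l *\<^sub>R F' l y) - (F (?q (y l)) - y l *\<^sub>R F' l y) =
          (F (p z (Suc l)) - F (p z l)) - (z l - y l) *\<^sub>R F' l y"
        unfolding pS by (simp add: scaleR_diff_left)
      ultimately have "norm ((F (p z (Suc l)) - F (p z l)) - (z l - y l) *\<^sub>R F' l y) \<le> e / 2 * \<bar>z l - y l\<bar>"
        by (simp only: real_norm_def)
      moreover have "(F (p z (Suc l)) - F (p z l)) - (z l - y l) *\<^sub>R F' l y = (z l - y l) *\<^sub>R (A l z - F' l y)"
        using False by (simp add: A_def scaleR_diff_right)
      ultimately have "\<bar>z l - y l\<bar> * norm (A l z - F' l y) \<le> \<bar>z l - y l\<bar> * (e / 2)"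
        by (simp only: norm_scaleR real_norm_def mult.commute)
      then have "norm (A l z - F' l y) \<le> e / 2" using False by (simp add: mult_le_cancel_left)
      then show ?thesis using e by (simp add: dist_norm)
    qed
    have "\<forall>\<^sub>F t in at t0 within S. \<forall>l\<in>{..<n}. \<bar>\<gamma> t l - y l\<bar> < d"
      using coordc d(1) by (intro eventually_ball_finite) (auto simp: tendsto_iff dist_real_def)
    moreover have "\<forall>\<^sub>F t in at t0 within S. t \<in> S" by (simp add: eventually_at_filter)
    ultimately show "\<forall>\<^sub>F t in at t0 within S. dist (A l (\<gamma> t)) (F' l y) < e"
      by eventually_elim (use small \<gamma>(1) in auto)
  qed
  have "((\<lambda>t. \<Sum>l<n. ((\<gamma> t l - \<gamma> t0 l) /\<^sub>R (t - t0)) *\<^sub>R A l (\<gamma> t)) \<longlongrightarrow> (\<Sum>l<n. \<gamma>' l *\<^sub>R F' l y)) (at t0 within S)"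
    using \<gamma>'[unfolded has_vector_derivative_iff_quotient] by (intro tendsto_intros Alim) auto
  moreover have "\<forall>\<^sub>F t in at t0 within S.
      (\<Sum>l<n. ((\<gamma> t l - \<gamma> t0 l) /\<^sub>R (t - t0)) *\<^sub>R A l (\<gamma> t)) = (F (\<gamma> t) - F (\<gamma> t0)) /\<^sub>R (t - t0)"
    using tel \<gamma>(1) by (auto simp: eventually_at_filter y_def scaleR_sum_right)
  ultimately show ?thesis
    unfolding has_vector_derivative_iff_quotient y_def[symmetric] by (rule Lim_transform_eventually)
qed

lemma directions_infinity: "is \<in> directions n \<infinity> \<longleftrightarrow> set is \<subseteq> {..<n}"
  by (simp add: directions_def)

lemma directions_set: "is \<in> directions n r \<Longrightarrow> set is \<subseteq> {..<n}"
  by (simp add: directions_def)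

lemma directions_length: "is \<in> directions n r \<Longrightarrow> enat (length is) \<le> r"
  by (simp add: directions_def)

text \<open>A coordinate line meets the cube in an interval, where uniform convergence of the
  derivatives allows the limit to be differentiated.\<close>

lemma Cr_with_uniform_limit:
  fixes g :: "nat \<Rightarrow> nat list \<Rightarrow> (nat \<Rightarrow> real) \<Rightarrow> 'b::banach"
  assumes Cr: "\<And>j. Cr_with n r (cube n a b) (f j) (g j)"
    and lim: "\<And>is. is \<in> directions n r \<Longrightarrow> uniform_limit (cube n a b) (\<lambda>j. g j is) (h is) sequentially"
  shows "Cr_with n r (cube n a b) (h []) h"
  unfolding Cr_with_def
proof (intro conjI ballI allI impI)
  show "continuous_on (cube n a b) (h is)" if "is \<in> directions n r" for "is"
    using Cr that by (intro uniform_limit_theorem[OF _ lim[OF that]]) (auto intro!: always_eventually Cr_with_continuous)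
  fix i "is" x assume i: "i # is \<in> directions n r" and x: "x \<in> cube n a b"
  have i': "i < n" "is \<in> directions n r" using directions_ConsD[OF i] by auto
  let ?S = "{a i..b i}"
  note line = cube_line[OF x i'(1)]
  have xS: "x i \<in> ?S" using x i' by (simp add: cube_def)
  have xt: "x(i := t) \<in> cube n a b" if "t \<in> ?S" for t using that line by auto
  have "\<exists>G. \<forall>t\<in>?S. (\<lambda>j. g j is (x(i := t))) \<longlonglongrightarrow> G t \<and>
      (G has_derivative (\<lambda>u. u *\<^sub>R h (i # is) (x(i := t)))) (at t within ?S)"
  proof (rule has_derivative_sequence[where f="\<lambda>j t. g j is (x(i := t))"])
    show "convex ?S" by simp
    show "((\<lambda>t. g j is (x(i := t))) has_derivative (\<lambda>u. u *\<^sub>R g j (i # is) (x(i := t)))) (at t within ?S)"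
      if "t \<in> ?S" for j t
      using Cr_with_deriv[OF Cr i xt[OF that], of j] cube_line[OF xt[OF that] i'(1)]
      by (simp add: has_vector_derivative_def)
    show "\<forall>\<^sub>F j in sequentially. \<forall>t\<in>?S. \<forall>u. norm (u *\<^sub>R g j (i # is) (x(i := t)) - u *\<^sub>R h (i # is) (x(i := t))) \<le> e * norm u"
      if "e > 0" for e
      using uniform_limitD[OF lim[OF i] that]
    proof eventually_elim
      case (elim j)
      show ?case
      proof (intro ballI allI)
        fix t u assume "t \<in> ?S"
        then have "norm (g j (i # is) (x(i := t)) - h (i # is) (x(i := t))) \<le> e"
          using elim xt by (auto simp: dist_norm less_imp_le)
        then have "\<bar>u\<bar> * norm (g j (i # is) (x(i := t)) - h (i # is) (x(i := t))) \<le> \<bar>u\<bar> * e"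
          by (intro mult_left_mono) auto
        then show "norm (u *\<^sub>R g j (i # is) (x(i := t)) - u *\<^sub>R h (i # is) (x(i := t))) \<le> e * norm u"
          by (simp add: mult.commute flip: scaleR_diff_right)
      qed
    qed
    show "x i \<in> ?S" by (rule xS)
    show "(\<lambda>j. g j is (x(i := x i))) \<longlonglongrightarrow> h is (x(i := x i))"
      using tendsto_uniform_limitI[OF lim[OF i'(2)] x] by simp
  qed
  then obtain G where G: "\<And>t. t \<in> ?S \<Longrightarrow> (\<lambda>j. g j is (x(i := t))) \<longlonglongrightarrow> G t"
    "\<And>t. t \<in> ?S \<Longrightarrow> (G has_derivative (\<lambda>u. u *\<^sub>R h (i # is) (x(i := t)))) (at t within ?S)"
    by blast
  have "h is (x(i := t)) = G t" if "t \<in> ?S" for t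
    using LIMSEQ_unique[OF tendsto_uniform_limitI[OF lim[OF i'(2)] xt[OF that]] G(1)[OF that]] .
  moreover have "(G has_vector_derivative h (i # is) x) (at (x i) within ?S)"
    using G(2)[OF xS] by (simp add: has_vector_derivative_def)
  ultimately show "((\<lambda>t. h is (x(i := t))) has_vector_derivative h (i # is) x)
      (at (x i) within {t. x(i := t) \<in> cube n a b})"
    unfolding line using xS by - (rule has_vector_derivative_transform[of _ _ _ G], auto)
qed simp

text \<open>The coefficients in the chain rule of higher order are polynomials in the partial derivatives
  of the inner function; this class is closed under partial derivatives.\<close>

inductive coef :: "(nat \<Rightarrow> nat list \<Rightarrow> (nat \<Rightarrow> real) \<Rightarrow> real) \<Rightarrow> nat \<Rightarrow> ((nat \<Rightarrow> real) \<Rightarrow> real) \<Rightarrow> bool"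
  for D n where
  base: "l < n \<Longrightarrow> set is \<subseteq> {..<n} \<Longrightarrow> coef D n (D l is)"
| const: "coef D n (\<lambda>_. c)"
| add: "coef D n u \<Longrightarrow> coef D n v \<Longrightarrow> coef D n (\<lambda>x. u x + v x)"
| mult: "coef D n u \<Longrightarrow> coef D n v \<Longrightarrow> coef D n (\<lambda>x. u x * v x)"

definition line_deriv :: "(nat \<Rightarrow> real) set \<Rightarrow> nat \<Rightarrow> ((nat \<Rightarrow> real) \<Rightarrow> 'b::real_normed_vector) \<Rightarrow>
    ((nat \<Rightarrow> real) \<Rightarrow> 'b) \<Rightarrow> bool" where
  "line_deriv V i f f' \<longleftrightarrow> (\<forall>x\<in>V.
     ((\<lambda>t. f (x(i := t))) has_vector_derivative f' x) (at (x i) within {t. x(i := t) \<in> V}))"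

lemma coef_deriv:
  assumes D: "\<And>l. l < n \<Longrightarrow> Cr_with n \<infinity> V (\<lambda>x. \<tau> x l) (D l)" and "coef D n u"
  shows "continuous_on V u" and "i < n \<Longrightarrow> \<exists>v. coef D n v \<and> line_deriv V i u v"
proof -
  from \<open>coef D n u\<close> have "continuous_on V u \<and> (i < n \<longrightarrow> (\<exists>v. coef D n v \<and> line_deriv V i u v))"
  proof induction
    case (base l "is")
    then show ?case
      using Cr_with_continuous[OF D[OF base(1)], of "is"] Cr_with_deriv[OF D[OF base(1)], of i "is"]
        coef.base[of l n "i # is" D]
      by (auto simp: directions_infinity line_deriv_def)
  next
    case (const c)
    then show ?case
      by (auto simp: line_deriv_def intro!: exI[of _ "\<lambda>_. 0"] coef.const)
  next
    case (add u v)
    have "\<exists>w. coef D n w \<and> line_deriv V i (\<lambda>x. u x + v x) w" if i: "i < n"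
    proof -
      obtain u' v' where "coef D n u'" "line_deriv V i u u'" "coef D n v'" "line_deriv V i v v'"
        using add i by blast
      then show ?thesis
        by (intro exI[of _ "\<lambda>x. u' x + v' x"] conjI coef.add)
           (simp_all add: line_deriv_def has_vector_derivative_add)
    qed
    then show ?case using add by (auto intro!: continuous_intros)
  next
    case (mult u v)
    have "\<exists>w. coef D n w \<and> line_deriv V i (\<lambda>x. u x * v x) w" if i: "i < n"
    proof -
      obtain u' v' where "coef D n u'" "line_deriv V i u u'" "coef D n v'" "line_deriv V i v v'"
        using mult i by blast
      then show ?thesis
        using mult.hyps has_vector_derivative_mult[of "\<lambda>t. u (_(i := t))" _ _ _ "\<lambda>t. v (_(i := t))"]
        by (intro exI[of _ "\<lambda>x. u x * v' x + u' x * v x"] conjI coef.add coef.mult)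
           (fastforce simp: line_deriv_def)+
    qed
    then show ?case using mult by (auto intro!: continuous_intros)
  qed
  then show "continuous_on V u" "i < n \<Longrightarrow> \<exists>v. coef D n v \<and> line_deriv V i u v" by auto
qed

lemma directions_Suc:
  "directions n (enat (Suc m)) = insert [] ((\<lambda>(l, ks). l # ks) ` ({..<n} \<times> directions n (enat m)))"
proof (intro set_eqI)
  fix js
  show "js \<in> directions n (enat (Suc m)) \<longleftrightarrow>
      js \<in> insert [] ((\<lambda>(l, ks). l # ks) ` ({..<n} \<times> directions n (enat m)))"
    by (cases js) (auto simp: directions_def image_iff)
qed

text \<open>Chain rule of any order with coefficients left implicit. They depend on
  \<open>\<tau>\<close> alone and not on \<open>F\<close>, \<open>G\<close> or \<open>r\<close>, so
  the same coefficients serve a sequence of functions and its limit.\<close>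

lemma compose_partials:
  fixes \<tau> :: "(nat \<Rightarrow> real) \<Rightarrow> nat \<Rightarrow> real"
  assumes D: "\<And>l. l < n \<Longrightarrow> Cr_with n \<infinity> V (\<lambda>x. \<tau> x l) (D l)"
    and \<tau>: "\<And>x. x \<in> V \<Longrightarrow> \<tau> x \<in> cube n a b"
  shows "\<exists>C. (\<forall>is js. set is \<subseteq> {..<n} \<longrightarrow> continuous_on V (C is js)) \<and>
    (\<forall>r F G. Cr_with n r (cube n a b) F G \<longrightarrow>
       Cr_with n r V (\<lambda>x. F (\<tau> x) :: 'b::real_normed_vector)
         (\<lambda>is x. \<Sum>js\<in>directions n (enat (length is)). C is js x *\<^sub>R G js (\<tau> x)))"
proof -
  define der where "der i u = (SOME v. coef D n v \<and> line_deriv V i u v)" for i u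
  have der: "coef D n (der i u) \<and> line_deriv V i u (der i u)" if "coef D n u" "i < n" for i u
    unfolding der_def using coef_deriv(2)[OF D that] by (rule someI_ex)
  \<comment> \<open>Leibniz rule for one more direction \<open>i\<close>: \<open>A\<close>
    differentiates the coefficient of an old word, \<open>B\<close> differentiates \<open>G\<close>
    along \<open>\<tau>\<close> and thereby puts a letter in front of the word. Words longer than
    \<open>m\<close> did not occur before, hence the 0 in \<open>A\<close>.\<close>
  define A where "A i m c js = (if length js \<le> m then der i (c js) else (\<lambda>_. 0))" for i m and c :: "nat list \<Rightarrow> (nat \<Rightarrow> real) \<Rightarrow> real" and js :: "nat list"
  define B where "B i m c js = (case js of [] \<Rightarrow> (\<lambda>_. 0) |
      l # ks \<Rightarrow> if l < n then (\<lambda>x. c ks x * D l [i] x) else (\<lambda>_. 0))" for i m :: nat and c :: "nat list \<Rightarrow> (nat \<Rightarrow> real) \<Rightarrow> real" and js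
  define C where "C = rec_list (\<lambda>js x. if js = [] then 1 else 0)
     (\<lambda>i is c js x. A i (length is) c js x + B i (length is) c js x)"
  have C_simps: "C [] = (\<lambda>js x. if js = [] then 1 else 0)"
    "C (i # is) = (\<lambda>js x. A i (length is) (C is) js x + B i (length is) (C is) js x)" for i "is"
    by (simp_all add: C_def)
  have coefC: "coef D n (C is js)" if "set is \<subseteq> {..<n}" for "is" js
    using that
  proof (induction "is" arbitrary: js)
    case Nil
    show ?case unfolding C_simps using coef.const[of D n "if js = [] then 1 else 0"] by simp
  next
    case (Cons i "is")
    then have c: "coef D n (C is js)" "i < n" for js by auto
    have "coef D n (A i (length is) (C is) js)"
      using der c by (simp add: A_def coef.const)
    moreover have "coef D n (B i (length is) (C is) js)"
      using c by (auto simp: B_def split: list.split intro!: coef.intros)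
    ultimately show ?case unfolding C_simps by (rule coef.add)
  qed
  have \<tau>c: "continuous_on V \<tau>"
  proof (rule continuous_on_coordinatewise_then_product)
    fix l
    show "continuous_on V (\<lambda>x. \<tau> x l)"
    proof (cases "l < n")
      case True
      have "continuous_on V (D l [])" by (rule Cr_with_continuous[OF D[OF True]]) simp
      then show ?thesis using Cr_with_Nil[OF D[OF True]] by (simp cong: continuous_on_cong)
    next
      case False
      then have "\<tau> x l = 0" if "x \<in> V" for x using \<tau>[OF that] by (simp add: cube_def)
      then show ?thesis by (simp cong: continuous_on_cong)
    qed
  qed
  have main: "Cr_with n r V (\<lambda>x. F (\<tau> x))
         (\<lambda>is x. \<Sum>js\<in>directions n (enat (length is)). C is js x *\<^sub>R G js (\<tau> x))"
    if G: "Cr_with n r (cube n a b) F G" for r and F :: "(nat \<Rightarrow> real) \<Rightarrow> 'b" and G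
    unfolding Cr_with_def
  proof (intro conjI ballI allI impI)
    fix x assume x: "x \<in> V"
    have "directions n 0 = {[]}" by (auto simp: directions_def zero_enat_def)
    then show "(\<Sum>js\<in>directions n (enat (length [])). C [] js x *\<^sub>R G js (\<tau> x)) = F (\<tau> x)"
      using Cr_with_Nil[OF G \<tau>[OF x]] by (simp add: C_simps enat_0)
  next
    fix "is" assume i: "is \<in> directions n r"
    have "js \<in> directions n r" if "js \<in> directions n (enat (length is))" for js
      using that directions_mono[OF directions_length[OF i], of n] by (rule subsetD[rotated])
    then show "continuous_on V (\<lambda>x. \<Sum>js\<in>directions n (enat (length is)). C is js x *\<^sub>R G js (\<tau> x))"
      using coefC[OF directions_set[OF i]]
      by (intro continuous_intros coef_deriv(1)[OF D] continuous_on_compose2[OF Cr_with_continuous[OF G] \<tau>c])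
         (use \<tau> in auto)
  next
    fix i "is" x assume i: "i # is \<in> directions n r" and x: "x \<in> V"
    have i': "i < n" "is \<in> directions n r" using directions_ConsD[OF i] by auto
    let ?m = "length is" and ?S = "{t. x(i := t) \<in> V}"
    let ?J = "directions n (enat ?m)"
    have mr: "enat (Suc ?m) \<le> r" using directions_length[OF i] by simp
    have l: "l # js \<in> directions n r" if "js \<in> ?J" "l < n" for l js
    proof -
      have "l # js \<in> directions n (enat (Suc ?m))" using that by (auto simp: directions_Suc)
      then show ?thesis using directions_mono[OF mr] by (rule subsetD[rotated])
    qed
    have inner: "((\<lambda>t. G js (\<tau> (x(i := t)))) has_vector_derivative
        (\<Sum>l<n. D l [i] x *\<^sub>R G (l # js) (\<tau> x))) (at (x i) within ?S)" if js: "js \<in> ?J" for js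
    proof -
      have "((\<lambda>t. G js (\<tau> (x(i := t)))) has_vector_derivative
        (\<Sum>l<n. D l [i] x *\<^sub>R G (l # js) (\<tau> (x(i := x i))))) (at (x i) within ?S)"
      proof (rule cube_chain_rule)
        show "continuous_on (cube n a b) (G (l # js))" if "l < n" for l
          by (rule Cr_with_continuous[OF G l[OF js that]])
        show "((\<lambda>t. G js (y(l := t))) has_vector_derivative G (l # js) y)
            (at (y l) within {t. y(l := t) \<in> cube n a b})" if "l < n" "y \<in> cube n a b" for l y
          by (rule Cr_with_deriv[OF G l[OF js that(1)] that(2)])
        show "((\<lambda>t. \<tau> (x(i := t)) l) has_vector_derivative D l [i] x) (at (x i) within ?S)" if "l < n" for l
        proof (rule has_vector_derivative_transform)
          show "((\<lambda>t. D l [] (x(i := t))) has_vector_derivative D l [i] x) (at (x i) within ?S)"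
            using i' by (intro Cr_with_deriv[OF D[OF that] _ x]) (simp add: directions_infinity)
        qed (use x Cr_with_Nil[OF D[OF that]] in auto)
        show "\<tau> (x(i := t)) \<in> cube n a b" if "t \<in> ?S" for t
          using that by (intro \<tau>) simp
        show "x i \<in> ?S" using x by simp
      qed
      then show ?thesis by simp
    qed
    have outer: "((\<lambda>t. C is js (x(i := t)) *\<^sub>R G js (\<tau> (x(i := t)))) has_vector_derivative
        (C is js x *\<^sub>R (\<Sum>l<n. D l [i] x *\<^sub>R G (l # js) (\<tau> x)) + der i (C is js) x *\<^sub>R G js (\<tau> x))) (at (x i) within ?S)"
      if js: "js \<in> ?J" for js
    proof -
      have "((\<lambda>t. C is js (x(i := t))) has_vector_derivative der i (C is js) x) (at (x i) within ?S)"
        using der[OF coefC[OF directions_set[OF i'(2)]] i'(1)] x by (simp add: line_deriv_def)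
      then have "((\<lambda>t. C is js (x(i := t))) has_field_derivative der i (C is js) x) (at (x i) within ?S)"
        by (simp add: has_real_derivative_iff_has_vector_derivative)
      from has_vector_derivative_scaleR[OF this inner[OF js]] show ?thesis by simp
    qed
    have A: "(\<Sum>js\<in>directions n (enat (Suc ?m)). A i ?m (C is) js x *\<^sub>R G js (\<tau> x)) =
        (\<Sum>js\<in>?J. der i (C is js) x *\<^sub>R G js (\<tau> x))"
      by (rule sum.mono_neutral_cong_right)
         (auto simp: finite_directions A_def, auto simp: directions_def)
    have "(\<Sum>js\<in>directions n (enat (Suc ?m)). B i ?m (C is) js x *\<^sub>R G js (\<tau> x)) =
        (\<Sum>js\<in>(\<lambda>(l, ks). l # ks) ` ({..<n} \<times> ?J). B i ?m (C is) js x *\<^sub>R G js (\<tau> x))"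
      unfolding directions_Suc by (subst sum.insert) (auto simp: finite_directions B_def)
    also have "\<dots> = (\<Sum>(l, ks)\<in>{..<n} \<times> ?J. (C is ks x * D l [i] x) *\<^sub>R G (l # ks) (\<tau> x))"
      by (subst sum.reindex) (auto simp: inj_on_def B_def intro!: sum.cong)
    also have "\<dots> = (\<Sum>l<n. \<Sum>ks\<in>?J. (C is ks x * D l [i] x) *\<^sub>R G (l # ks) (\<tau> x))"
      by (rule sum.cartesian_product[symmetric])
    also have "\<dots> = (\<Sum>ks\<in>?J. C is ks x *\<^sub>R (\<Sum>l<n. D l [i] x *\<^sub>R G (l # ks) (\<tau> x)))"
      by (subst sum.swap) (simp add: scaleR_sum_right)
    finally have B: "(\<Sum>js\<in>directions n (enat (Suc ?m)). B i ?m (C is) js x *\<^sub>R G js (\<tau> x)) = \<dots>" .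
    have "((\<lambda>t. \<Sum>js\<in>?J. C is js (x(i := t)) *\<^sub>R G js (\<tau> (x(i := t)))) has_vector_derivative
        (\<Sum>js\<in>?J. C is js x *\<^sub>R (\<Sum>l<n. D l [i] x *\<^sub>R G (l # js) (\<tau> x)) + der i (C is js) x *\<^sub>R G js (\<tau> x)))
        (at (x i) within ?S)"
      by (rule has_vector_derivative_sum) (rule outer)
    also have "(\<Sum>js\<in>?J. C is js x *\<^sub>R (\<Sum>l<n. D l [i] x *\<^sub>R G (l # js) (\<tau> x)) + der i (C is js) x *\<^sub>R G js (\<tau> x)) =
        (\<Sum>js\<in>directions n (enat (length (i # is))). C (i # is) js x *\<^sub>R G js (\<tau> x))"
      unfolding C_simps scaleR_left_distrib sum.distrib length_Cons A B by (rule add.commute)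
    finally show "((\<lambda>t. \<Sum>js\<in>?J. C is js (x(i := t)) *\<^sub>R G js (\<tau> (x(i := t)))) has_vector_derivative
        (\<Sum>js\<in>directions n (enat (length (i # is))). C (i # is) js x *\<^sub>R G js (\<tau> x))) (at (x i) within ?S)" .
  qed
  show ?thesis
    using coef_deriv(1)[OF D coefC] main by (intro exI[of _ C] conjI allI impI) auto
qed

text \<open>\<open>bd\<close> selects the closed half-space.\<close>

definition model_space :: "nat \<Rightarrow> bool \<Rightarrow> (nat \<Rightarrow> real) set" where
  "model_space n bd = {y. (\<forall>l\<ge>n. y l = 0) \<and> (bd \<longrightarrow> 0 \<le> y 0)}"

text \<open>The cube is closed, so an open set \<open>A\<close> is supplied with it;
  \<open>A\<close> certifies that the cube is a neighbourhood of \<open>x\<close> relative to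
  \<open>W\<close>.\<close>

lemma model_space_nbhd:
  assumes W: "openin (top_of_set (model_space n bd)) W" and x: "x \<in> W"
  shows "\<exists>a b A. (\<forall>i<n. a i < b i) \<and> cube n a b \<subseteq> W \<and> open A \<and> x \<in> A \<and> W \<inter> A \<subseteq> cube n a b"
proof -
  obtain O' where O': "open O'" "W = model_space n bd \<inter> O'" using W by (auto simp: openin_open)
  obtain e where e: "e > 0" "\<And>y. (\<forall>l<n. \<bar>y l - x l\<bar> < e) \<Longrightarrow> (\<forall>l\<ge>n. y l = x l) \<Longrightarrow> y \<in> O'"
    using open_product_nbhd[OF O'(1), of x n] x O' by auto
  have xH: "x \<in> model_space n bd" using x O' by auto
  \<comment> \<open>In the boundary direction the lower face is clipped at 0, which keeps the cube
    in the half-space. As \<open>x 0 \<ge> 0\<close>, the side remains positive.\<close>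
  define a where "a l = (if l = 0 \<and> bd then max 0 (x l - e / 2) else x l - e / 2)" for l
  define b where "b l = x l + e / 2" for l
  define A where "A = {y. \<forall>l<n. \<bar>y l - x l\<bar> < e / 2}"
  have "A = (\<Inter>l\<in>{..<n}. (\<lambda>y. y l) -` {x l - e / 2<..<x l + e / 2})"
    by (auto simp only: A_def abs_diff_less_iff mem_Collect_eq INT_iff lessThan_iff vimage_eq
        greaterThanLessThan_iff)
  also have "open \<dots>"
    by (intro open_INT ballI open_vimage) auto
  finally have "open A" .
  moreover have "a i < b i" for i using e xH by (auto simp: a_def b_def model_space_def)
  moreover have "cube n a b \<subseteq> W"
  proof
    fix y assume y: "y \<in> cube n a b"
    have "\<bar>y l - x l\<bar> < e" if "l < n" for l
    proof -
      have "a l \<le> y l" "y l \<le> b l" using y that by (auto simp: cube_def)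
      moreover have "x l - e / 2 \<le> a l" by (simp add: a_def)
      ultimately show ?thesis using e(1) by (simp add: b_def abs_less_iff)
    qed
    then have "y \<in> O'" using y xH by (intro e(2)) (auto simp: cube_def model_space_def)
    \<comment> \<open>For \<open>n = 0\<close>, coordinate 0 is one of those that vanish.\<close>
    moreover have "y \<in> model_space n bd"
      using y by (cases "0 < n") (auto simp: cube_def model_space_def a_def)
    ultimately show "y \<in> W" using O' by simp
  qed
  moreover have "x \<in> A" using e by (simp add: A_def)
  moreover have "W \<inter> A \<subseteq> cube n a b"
  proof
    fix y assume "y \<in> W \<inter> A"
    then have y: "y \<in> model_space n bd" "\<And>l. l < n \<Longrightarrow> \<bar>y l - x l\<bar> < e / 2"
      using O' by (auto simp: A_def)
    have "a l \<le> y l \<and> y l \<le> b l" if "l < n" for l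
    proof -
      have "x l - e / 2 < y l" "y l < x l + e / 2"
        using y(2)[OF that] unfolding abs_diff_less_iff by auto
      then show ?thesis using y(1) by (auto simp: a_def b_def model_space_def)
    qed
    then show "y \<in> cube n a b" using y(1) by (simp add: cube_def model_space_def)
  qed
  ultimately show ?thesis by blast
qed

lemma thick_model_space:
  assumes W: "openin (top_of_set (model_space n bd)) W"
  shows "thick n W"
  unfolding thick_def
proof (intro ballI allI impI)
  fix x i assume x: "x \<in> W" and i: "i < n"
  obtain a b A where ab: "\<forall>i<n. a i < b i" "cube n a b \<subseteq> W" "x \<in> A" "W \<inter> A \<subseteq> cube n a b"
    using model_space_nbhd[OF W x] by blast
  have "x \<in> cube n a b" using x ab by auto
  then have "x i islimpt {t. x(i := t) \<in> cube n a b}"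
    using thick_cube[of n a b] ab(1) i by (simp add: thick_def)
  then show "x i islimpt {t. x(i := t) \<in> W}"
    by (rule islimpt_subset) (use ab(2) in auto)
qed

section \<open>Chaining on dyadic grids\<close>

definition grids :: "nat \<Rightarrow> nat \<Rightarrow> nat list set" where
  "grids n m = {z. set z \<subseteq> {..2 ^ m} \<and> length z = n}"

definition gridpt :: "nat \<Rightarrow> (nat \<Rightarrow> real) \<Rightarrow> (nat \<Rightarrow> real) \<Rightarrow> nat \<Rightarrow> nat list \<Rightarrow> nat \<Rightarrow> real" where
  "gridpt n a b m z l = (if l < n then a l + (b l - a l) * (real (z ! l) / 2 ^ m) else 0)"

definition steps :: "nat \<Rightarrow> nat \<Rightarrow> (nat list \<times> nat) set" where
  "steps n m = {(z, l). z \<in> grids n m \<and> l < n \<and> z ! l < 2 ^ m}"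

abbreviation step_to :: "nat list \<Rightarrow> nat \<Rightarrow> nat list" where
  "step_to z l \<equiv> z[l := Suc (z ! l)]"

lemma finite_grids: "finite (grids n m)"
  unfolding grids_def by (rule finite_lists_length_eq) simp

lemma card_grids: "card (grids n m) = (2 ^ m + 1) ^ n"
  unfolding grids_def by (subst card_lists_length_eq) auto

lemma grids_nth: "z \<in> grids n m \<Longrightarrow> l < n \<Longrightarrow> z ! l \<le> 2 ^ m"
  unfolding grids_def using nth_mem by blast

lemma gridsI: "length z = n \<Longrightarrow> (\<And>l. l < n \<Longrightarrow> z ! l \<le> 2 ^ m) \<Longrightarrow> z \<in> grids n m"
  unfolding grids_def by (auto simp: in_set_conv_nth)

lemma finite_steps: "finite (steps n m)" and card_steps: "card (steps n m) \<le> n * (2 ^ m + 1) ^ n"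
proof -
  have sub: "steps n m \<subseteq> grids n m \<times> {..<n}" by (auto simp: steps_def)
  then show "finite (steps n m)" by (rule finite_subset) (simp add: finite_grids)
  have "card (steps n m) \<le> card (grids n m \<times> {..<n})"
    by (rule card_mono[OF _ sub]) (simp add: finite_grids)
  then show "card (steps n m) \<le> n * (2 ^ m + 1) ^ n"
    by (simp add: card_cartesian_product card_grids mult.commute)
qed

lemma step_to_grids: "(z, l) \<in> steps n m \<Longrightarrow> step_to z l \<in> grids n m"
proof (rule gridsI)
  assume s: "(z, l) \<in> steps n m"
  then have z: "z \<in> grids n m" "z ! l < 2 ^ m" by (auto simp: steps_def)
  then show "length (step_to z l) = n" by (simp add: grids_def)
  show "step_to z l ! k \<le> 2 ^ m" if "k < n" for k
    using grids_nth[OF z(1) that] z(2) that \<open>length (step_to z l) = n\<close>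
    by (cases "k = l") (auto simp: nth_list_update)
qed

lemma gridpt_in_cube:
  assumes ab: "\<And>l. l < n \<Longrightarrow> a l \<le> b l" and z: "z \<in> grids n m"
  shows "gridpt n a b m z \<in> cube n a b"
proof -
  have "a l \<le> gridpt n a b m z l \<and> gridpt n a b m z l \<le> b l" if l: "l < n" for l
  proof -
    let ?u = "real (z ! l) / 2 ^ m"
    have "real (z ! l) \<le> 2 ^ m" using grids_nth[OF z l] by (metis of_nat_le_iff of_nat_numeral of_nat_power)
    then have u: "0 \<le> ?u" "?u \<le> 1" by (auto simp: divide_le_eq)
    have "0 \<le> (b l - a l) * ?u" using u ab[OF l] by (intro mult_nonneg_nonneg) auto
    moreover have "(b l - a l) * ?u \<le> (b l - a l) * 1" using u ab[OF l] by (intro mult_left_mono) auto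
    ultimately show ?thesis using l by (simp add: gridpt_def)
  qed
  then show ?thesis by (simp add: cube_def gridpt_def)
qed

lemma gridpt_step:
  assumes "(z, l) \<in> steps n m"
  shows "gridpt n a b m (step_to z l) = (gridpt n a b m z)(l := gridpt n a b m z l + (b l - a l) / 2 ^ m)"
proof
  fix k
  have "length z = n" "l < n" using assms by (auto simp: steps_def grids_def)
  then show "gridpt n a b m (step_to z l) k = ((gridpt n a b m z)(l := gridpt n a b m z l + (b l - a l) / 2 ^ m)) k"
    by (auto simp: gridpt_def nth_list_update add_divide_distrib algebra_simps)
qed

text \<open>Increments with variance of order 2^-m have size about (1 / sqrt 2)^m, so the threshold
  has to decay with a ratio strictly between 1 / sqrt 2 and 1. For 7/8 the moment bound contains
  (1/2) / (7/8)^2 = 32/49 < 1, and the powers of exponent above m sum to 7 * (7/8)^m.\<close>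

abbreviation decay :: real where "decay \<equiv> 7 / 8"

text \<open>Markov's inequality for a high even moment and a union bound over all steps and levels.
  The level \<open>m0\<close> depends on \<open>V\<close>, \<open>e\<close> and \<open>n\<close> but
  not on \<open>P\<close> or \<open>Y\<close>, which makes the estimate uniform over a sequence of
  fields.\<close>

lemma chaining_probability:
  fixes V e :: real
  assumes V: "V \<ge> 0" and e: "e > 0"
  shows "\<exists>m0. \<forall>(P :: 'w measure) Y. prob_space P \<longrightarrow>
    (\<forall>m z l. (z, l) \<in> steps n m \<longrightarrow>
       centered_gaussian_rv P (\<lambda>\<omega>. Y m (step_to z l) \<omega> - Y m z \<omega>) \<and>
       (\<integral>\<omega>. (Y m (step_to z l) \<omega> - Y m z \<omega>)\<^sup>2 \<partial>P) \<le> V * (1 / 2) ^ m) \<longrightarrow>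
    measure P {\<omega> \<in> space P. \<exists>m\<ge>m0. \<exists>(z, l)\<in>steps n m. decay ^ m < \<bar>Y m (step_to z l) \<omega> - Y m z \<omega>\<bar>} \<le> e"
proof -
  \<comment> \<open>Level \<open>m\<close> has at most n * (2 * 2^m)^n steps, each failing with
    probability of order (32/49)^(p * m). This choice of \<open>p\<close> makes the product at most
    a constant times 2^-m.\<close>
  obtain p where p: "(32 / 49 :: real) ^ p < 1 / 2 / 2 ^ n"
    using real_arch_pow_inv[of "1 / 2 / 2 ^ n" "32 / 49"] by auto
  define c :: real where "c = fact (2 * p) / (2 ^ p * fact p)"
  \<comment> \<open>The factors of the union bound that do not depend on the level:
    \<open>n * 2 ^ n\<close> from counting the steps, \<open>c * V ^ p\<close> from the
    moment.\<close>
  define K where "K = n * 2 ^ n * (c * V ^ p)"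
  have c: "c \<ge> 0" and K: "K \<ge> 0" using V by (auto simp: c_def K_def)
  \<comment> \<open>The failure probabilities of the levels from \<open>m0\<close> on form a
    geometric series with sum \<open>2 * K * (1 / 2) ^ m0\<close>.\<close>
  have "(\<lambda>m. 2 * K * (1 / 2) ^ m) \<longlonglongrightarrow> 2 * K * 0"
    by (intro tendsto_intros LIMSEQ_realpow_zero) auto
  then have "\<forall>\<^sub>F m in sequentially. 2 * K * (1 / 2) ^ m < e"
    using e by (intro order_tendstoD) auto
  then obtain m0 where m0: "2 * K * (1 / 2) ^ m0 < e" by (auto dest: eventually_happens)
  show ?thesis
  proof (rule exI[of _ m0], intro allI impI)
    fix P :: "'w measure" and Y
    assume P: "prob_space P" and Y: "\<forall>m z l. (z, l) \<in> steps n m \<longrightarrow>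
       centered_gaussian_rv P (\<lambda>\<omega>. Y m (step_to z l) \<omega> - Y m z \<omega>) \<and>
       (\<integral>\<omega>. (Y m (step_to z l) \<omega> - Y m z \<omega>)\<^sup>2 \<partial>P) \<le> V * (1 / 2) ^ m"
    interpret prob_space P by fact
    define D where "D m s \<omega> = Y m (step_to (fst s) (snd s)) \<omega> - Y m (fst s) \<omega>" for m s \<omega>
    have g: "centered_gaussian_rv P (D m s)" and v: "(\<integral>\<omega>. (D m s \<omega>)\<^sup>2 \<partial>P) \<le> V * (1 / 2) ^ m"
      if "s \<in> steps n m" for m s
      using Y[rule_format, of "fst s" "snd s" m] that by (simp_all add: D_def[abs_def])
    define B where "B m s = {\<omega> \<in> space P. decay ^ m < \<bar>D m s \<omega>\<bar>}" for m s
    have Bm: "B m s \<in> events" if "s \<in> steps n m" for m s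
      unfolding B_def using gaussian_measurable[OF P g[OF that]] by measurable
    have single: "prob (B m s) \<le> c * V ^ p * ((32 / 49) ^ p) ^ m" if s: "s \<in> steps n m" for m s
    proof -
      have meas[measurable]: "D m s \<in> borel_measurable P" by (rule gaussian_measurable[OF P g[OF s]])
      have "B m s \<subseteq> {\<omega> \<in> space P. (decay ^ m) ^ (2 * p) \<le> D m s \<omega> ^ (2 * p)}"
      proof
        fix \<omega> assume "\<omega> \<in> B m s"
        then have \<omega>: "\<omega> \<in> space P" "decay ^ m \<le> \<bar>D m s \<omega>\<bar>" by (auto simp: B_def)
        have "(decay ^ m) ^ (2 * p) \<le> \<bar>D m s \<omega>\<bar> ^ (2 * p)" by (rule power_mono[OF \<omega>(2)]) simp
        then show "\<omega> \<in> {\<omega> \<in> space P. (decay ^ m) ^ (2 * p) \<le> D m s \<omega> ^ (2 * p)}"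
          using \<omega>(1) by (simp add: power_even_abs)
      qed
      then have "prob (B m s) \<le> prob {\<omega> \<in> space P. (decay ^ m) ^ (2 * p) \<le> D m s \<omega> ^ (2 * p)}"
        by (rule finite_measure_mono) measurable
      also have "\<dots> \<le> (\<integral>\<omega>. D m s \<omega> ^ (2 * p) \<partial>P) / (decay ^ m) ^ (2 * p)"
        by (rule integral_Markov_inequality_measure[where A="space P"])
           (auto intro!: gaussian_integrable_power[OF P g[OF s]] simp: zero_le_even_power)
      also have "\<dots> = c * (\<integral>\<omega>. (D m s \<omega>)\<^sup>2 \<partial>P) ^ p / (decay ^ m) ^ (2 * p)"
        unfolding gaussian_even_moment[OF P g[OF s]] c_def ..
      also have "\<dots> \<le> c * (V * (1 / 2) ^ m) ^ p / (decay ^ m) ^ (2 * p)"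
        by (intro divide_right_mono mult_left_mono power_mono v[OF s] c) auto
      also have "\<dots> = c * V ^ p * ((32 / 49) ^ p) ^ m"
      proof -
        have "(x ^ m) ^ p / (y ^ m) ^ (2 * p) = (x / y ^ 2) ^ (m * p)" for x y :: real
          by (simp add: power_divide mult.left_commute flip: power_mult)
        then have "((1 / 2 :: real) ^ m) ^ p / (decay ^ m) ^ (2 * p) = ((1 / 2) / decay ^ 2) ^ (m * p)" .
        also have "(1 / 2) / decay ^ 2 = (32 / 49 :: real)" by (simp add: power2_eq_square)
        finally have e: "((1 / 2 :: real) ^ m) ^ p / (decay ^ m) ^ (2 * p) = (32 / 49) ^ (m * p)" .
        have "c * (V * (1 / 2) ^ m) ^ p / (decay ^ m) ^ (2 * p) =
            c * V ^ p * (((1 / 2 :: real) ^ m) ^ p / (decay ^ m) ^ (2 * p))"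
          by (simp only: power_mult_distrib times_divide_eq_right mult.assoc)
        then show ?thesis unfolding e by (simp only: mult.commute[of m p] power_mult)
      qed
      finally show ?thesis .
    qed
    define U where "U m = (\<Union>s\<in>steps n m. B m s)" for m
    have Um: "U m \<in> events" for m unfolding U_def using finite_steps Bm by (intro sets.finite_UN) auto
    have Ub: "prob (U m) \<le> K * (1 / 2) ^ m" for m
    proof -
      have "prob (U m) \<le> (\<Sum>s\<in>steps n m. prob (B m s))"
        unfolding U_def using Bm by (intro finite_measure_subadditive_finite finite_steps) auto
      also have "\<dots> \<le> real (card (steps n m)) * (c * V ^ p * ((32 / 49) ^ p) ^ m)"
        using single by (intro sum_bounded_above) auto
      also have "\<dots> \<le> real (n * (2 * 2 ^ m) ^ n) * (c * V ^ p * ((32 / 49) ^ p) ^ m)"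
      proof (rule mult_right_mono)
        have "card (steps n m) \<le> n * (2 ^ m + 1) ^ n" by (rule card_steps)
        also have "\<dots> \<le> n * (2 * 2 ^ m) ^ n" by (intro mult_left_mono power_mono) auto
        finally show "real (card (steps n m)) \<le> real (n * (2 * 2 ^ m) ^ n)" by (simp only: of_nat_le_iff)
      qed (use V c in auto)
      also have "\<dots> = K * (2 ^ n * (32 / 49) ^ p) ^ m"
        unfolding K_def by (simp add: power_mult_distrib mult_ac flip: power_mult)
      also have "\<dots> \<le> K * (1 / 2) ^ m"
        using p by (intro mult_left_mono power_mono K) (auto simp: field_simps)
      finally show ?thesis .
    qed
    have "{\<omega> \<in> space P. \<exists>m\<ge>m0. \<exists>(z, l)\<in>steps n m. decay ^ m < \<bar>Y m (step_to z l) \<omega> - Y m z \<omega>\<bar>} = (\<Union>k. U (m0 + k))"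
    proof (intro set_eqI iffI)
      fix \<omega> assume "\<omega> \<in> {\<omega> \<in> space P. \<exists>m\<ge>m0. \<exists>(z, l)\<in>steps n m. decay ^ m < \<bar>Y m (step_to z l) \<omega> - Y m z \<omega>\<bar>}"
      then obtain m z l where "\<omega> \<in> space P" "m0 \<le> m" "(z, l) \<in> steps n m" "decay ^ m < \<bar>Y m (step_to z l) \<omega> - Y m z \<omega>\<bar>"
        by auto
      then have "\<omega> \<in> U (m0 + (m - m0))" by (auto simp: U_def B_def D_def intro!: bexI[of _ "(z, l)"])
      then show "\<omega> \<in> (\<Union>k. U (m0 + k))" by blast
    next
      fix \<omega> assume "\<omega> \<in> (\<Union>k. U (m0 + k))"
      then obtain k s where "s \<in> steps n (m0 + k)" "\<omega> \<in> space P" "decay ^ (m0 + k) < \<bar>D (m0 + k) s \<omega>\<bar>"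
        by (auto simp: U_def B_def)
      then show "\<omega> \<in> {\<omega> \<in> space P. \<exists>m\<ge>m0. \<exists>(z, l)\<in>steps n m. decay ^ m < \<bar>Y m (step_to z l) \<omega> - Y m z \<omega>\<bar>}"
        by (auto simp: D_def intro!: exI[of _ "m0 + k"] bexI[of _ s] split: prod.split)
    qed
    also have "prob (\<Union>k. U (m0 + k)) \<le> (\<Sum>k. prob (U (m0 + k)))"
    proof (rule finite_measure_subadditive_countably)
      show "summable (\<lambda>k. prob (U (m0 + k)))"
        by (rule summable_comparison_test'[of "\<lambda>k. K * (1 / 2) ^ m0 * (1 / 2) ^ k" 0])
           (use Ub[of "m0 + _"] in \<open>auto simp: power_add mult.assoc intro!: summable_mult summable_geometric\<close>)
    qed (use Um in auto)
    also have "\<dots> \<le> (\<Sum>k. K * (1 / 2) ^ m0 * (1 / 2) ^ k)"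
    proof (rule suminf_le)
      show "prob (U (m0 + k)) \<le> K * (1 / 2) ^ m0 * (1 / 2) ^ k" for k
        using Ub[of "m0 + k"] by (simp add: power_add mult.assoc)
      show sm: "summable (\<lambda>k. K * (1 / 2) ^ m0 * (1 / 2) ^ k)"
        by (intro summable_mult summable_geometric) auto
      show "summable (\<lambda>k. prob (U (m0 + k)))"
        by (rule summable_comparison_test'[OF sm, of 0])
           (use Ub[of "m0 + _"] in \<open>auto simp: power_add mult.assoc\<close>)
    qed
    also have "\<dots> = 2 * K * (1 / 2) ^ m0"
      by (subst suminf_mult) (auto simp: suminf_geometric intro!: summable_geometric)
    also have "\<dots> \<le> e" using m0 by simp
    finally show "prob {\<omega> \<in> space P. \<exists>m\<ge>m0. \<exists>(z, l)\<in>steps n m. decay ^ m < \<bar>Y m (step_to z l) \<omega> - Y m z \<omega>\<bar>} \<le> e" .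
  qed
qed

section \<open>Rounding to dyadic grids\<close>

definition round_down :: "nat \<Rightarrow> (nat \<Rightarrow> real) \<Rightarrow> (nat \<Rightarrow> real) \<Rightarrow> nat \<Rightarrow> (nat \<Rightarrow> real) \<Rightarrow> nat list" where
  "round_down n a b m x = map (\<lambda>l. nat \<lfloor>2 ^ m * ((x l - a l) / (b l - a l))\<rfloor>) [0..<n]"

text \<open>For the bound, \<open>Z x\<close> is the limit of the values at the roundings of
  \<open>x\<close>. Two consecutive roundings are joined by at most \<open>n\<close> steps of the
  finer grid, and the resulting bounds form a geometric series.\<close>

lemma
  fixes Z :: "(nat \<Rightarrow> real) \<Rightarrow> real"
  assumes ab: "\<And>l. l < n \<Longrightarrow> a l < b l" and x: "x \<in> cube n a b"
  shows round_down_grids: "round_down n a b m x \<in> grids n m"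
    and gridpt_round_down_tendsto: "(\<lambda>m. gridpt n a b m (round_down n a b m x)) \<longlonglongrightarrow> x"
    and chaining_bound: "continuous_on (cube n a b) Z \<Longrightarrow>
      (\<And>m z l. m \<ge> m0 \<Longrightarrow> (z, l) \<in> steps n m \<Longrightarrow>
        \<bar>Z (gridpt n a b m (step_to z l)) - Z (gridpt n a b m z)\<bar> \<le> decay ^ m) \<Longrightarrow> m \<ge> m0 \<Longrightarrow>
      \<bar>Z x - Z (gridpt n a b m (round_down n a b m x))\<bar> \<le> 7 * real n * decay ^ m"
proof -
  define u where "u l = (x l - a l) / (b l - a l)" for l
  have u: "0 \<le> u l" "u l \<le> 1" if "l < n" for l
    using x ab[OF that] that by (auto simp: u_def cube_def divide_le_eq)
  define q where "q m l = nat \<lfloor>2 ^ m * u l\<rfloor>" for m l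
  have rd: "round_down n a b m x ! l = q m l" if "l < n" for m l
    using that by (simp add: round_down_def q_def u_def)
  have lrd: "length (round_down n a b m x) = n" for m by (simp add: round_down_def)
  have qr: "real (q m l) = real_of_int \<lfloor>2 ^ m * u l\<rfloor>" if "l < n" for m l
    using u[OF that] by (simp add: q_def)
  have qle: "q m l \<le> 2 ^ m" if "l < n" for m l
  proof -
    have "real (q m l) \<le> 2 ^ m * u l" unfolding qr[OF that] by simp
    also have "\<dots> \<le> 2 ^ m * 1" using u[OF that] by (intro mult_left_mono) auto
    finally have "real (q m l) \<le> real (2 ^ m)" by simp
    then show ?thesis by (simp only: of_nat_le_iff)
  qed
  have rdg: "round_down n a b m x \<in> grids n m" for m
    using qle rd lrd by (intro gridsI) auto
  then show "round_down n a b m x \<in> grids n m" .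
  let ?g = "\<lambda>m. gridpt n a b m (round_down n a b m x)"
  show lim: "?g \<longlonglongrightarrow> x"
    unfolding tendsto_fun_iff
  proof
    fix l
    show "(\<lambda>m. ?g m l) \<longlonglongrightarrow> x l"
    proof (cases "l < n")
      case False
      then show ?thesis using x by (simp add: gridpt_def cube_def)
    next
      case True
      have "(\<lambda>m. real (q m l) / 2 ^ m) \<longlonglongrightarrow> u l"
      proof (rule tendsto_sandwich[of "\<lambda>m. u l - (1 / 2) ^ m" _ _ "\<lambda>m. u l"])
        have "2 ^ m * u l - 1 \<le> real (q m l)" "real (q m l) \<le> 2 ^ m * u l" for m
          unfolding qr[OF True] by linarith+
        note b = this
        have "u l - (1 / 2) ^ m = (2 ^ m * u l - 1) / 2 ^ m" for m
          by (simp add: diff_divide_distrib power_divide)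
        then show "\<forall>\<^sub>F m in sequentially. u l - (1 / 2) ^ m \<le> real (q m l) / 2 ^ m"
          using b(1) by (auto intro!: always_eventually divide_right_mono)
        have "real (q m l) / 2 ^ m \<le> u l" for m
          using b(2)[of m] by (simp add: divide_le_eq mult.commute)
        then show "\<forall>\<^sub>F m in sequentially. real (q m l) / 2 ^ m \<le> u l"
          by (intro always_eventually allI)
        have "(\<lambda>m. u l - (1 / 2) ^ m) \<longlonglongrightarrow> u l - 0"
          by (intro tendsto_intros LIMSEQ_realpow_zero) auto
        then show "(\<lambda>m. u l - (1 / 2) ^ m) \<longlonglongrightarrow> u l" by simp
      qed auto
      then have "(\<lambda>m. a l + (b l - a l) * (real (q m l) / 2 ^ m)) \<longlonglongrightarrow> a l + (b l - a l) * u l"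
        by (intro tendsto_intros)
      moreover have "a l + (b l - a l) * u l = x l" using ab[OF True] by (simp add: u_def)
      ultimately show ?thesis using True rd by (simp add: gridpt_def)
    qed
  qed
  have gQ: "?g m \<in> cube n a b" for m
    using ab by (intro gridpt_in_cube rdg) (auto intro: less_imp_le)
  assume cont: "continuous_on (cube n a b) Z"
    and steps: "\<And>m z l. m \<ge> m0 \<Longrightarrow> (z, l) \<in> steps n m \<Longrightarrow>
      \<bar>Z (gridpt n a b m (step_to z l)) - Z (gridpt n a b m z)\<bar> \<le> decay ^ m"
    and m: "m \<ge> m0"
  have one: "\<bar>Z (?g (Suc m)) - Z (?g m)\<bar> \<le> real n * decay ^ Suc m" if "Suc m \<ge> m0" for m
  proof -
    \<comment> \<open>Passage from the rounding at level \<open>m\<close>, whose indices double on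
      the finer grid, to the one at level \<open>m + 1\<close>, one coordinate at a time. By
      \<open>q2\<close> each coordinate stays or moves up by one.\<close>
    define w where "w k = map (\<lambda>l. if l < k then q (Suc m) l else 2 * q m l) [0..<n]" for k
    have wn: "w k ! l = (if l < k then q (Suc m) l else 2 * q m l)" if "l < n" for k l
      using that by (simp add: w_def)
    have q2: "q (Suc m) l = 2 * q m l \<or> q (Suc m) l = Suc (2 * q m l)" if "l < n" for l
    proof -
      have "\<lfloor>2 ^ Suc m * u l\<rfloor> = 2 * \<lfloor>2 ^ m * u l\<rfloor> \<or> \<lfloor>2 ^ Suc m * u l\<rfloor> = 2 * \<lfloor>2 ^ m * u l\<rfloor> + 1"
        by (simp add: mult.assoc) linarith
      moreover have "\<lfloor>2 ^ m * u l\<rfloor> \<ge> 0" using u[OF that] by simp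
      ultimately show ?thesis unfolding q_def by linarith
    qed
    have wg: "w k \<in> grids n (Suc m)" for k
      using qle[of _ m] qle[of _ "Suc m"] by (intro gridsI) (auto simp: w_def)
    let ?h = "\<lambda>k. gridpt n a b (Suc m) (w k)"
    have h0: "?h 0 = ?g m" using rd by (auto simp: gridpt_def wn fun_eq_iff)
    have hn: "?h n = ?g (Suc m)" using rd by (auto simp: gridpt_def wn fun_eq_iff)
    have "\<bar>Z (?h (Suc k)) - Z (?h k)\<bar> \<le> decay ^ Suc m" if k: "k < n" for k
    proof (cases "q (Suc m) k = 2 * q m k")
      case True
      then have "w (Suc k) = w k" by (auto simp: w_def less_Suc_eq)
      then show ?thesis by simp
    next
      case False
      then have q: "q (Suc m) k = Suc (2 * q m k)" using q2[OF k] by simp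
      have "(w k, k) \<in> steps n (Suc m)"
        using wg[of k] k q qle[OF k, of "Suc m"] by (simp add: steps_def wn)
      moreover have "step_to (w k) k = w (Suc k)"
        by (rule nth_equalityI) (auto simp: w_def nth_list_update less_Suc_eq q k)
      ultimately show ?thesis using steps[OF \<open>m0 \<le> Suc m\<close>, of "w k" k] by simp
    qed
    then have "(\<Sum>k<n. \<bar>Z (?h (Suc k)) - Z (?h k)\<bar>) \<le> (\<Sum>k<n. decay ^ Suc m)"
      by (intro sum_mono) auto
    moreover have "\<bar>Z (?h n) - Z (?h 0)\<bar> \<le> (\<Sum>k<n. \<bar>Z (?h (Suc k)) - Z (?h k)\<bar>)"
      unfolding sum_lessThan_telescope[of "\<lambda>k. Z (?h k)" n, symmetric] by (rule sum_abs)
    ultimately show ?thesis unfolding h0 hn by simp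
  qed
  \<comment> \<open>The right side telescopes because
    \<open>decay ^ Suc j = 7 * (decay ^ j - decay ^ Suc j)\<close>.\<close>
  have many: "\<bar>Z (?g (m + k)) - Z (?g m)\<bar> \<le> 7 * real n * (decay ^ m - decay ^ (m + k))" for k
  proof (induction k)
    case (Suc k)
    have "\<bar>Z (?g (m + Suc k)) - Z (?g m)\<bar> \<le> \<bar>Z (?g (Suc (m + k))) - Z (?g (m + k))\<bar> + \<bar>Z (?g (m + k)) - Z (?g m)\<bar>"
      by simp
    also have "\<dots> \<le> real n * decay ^ Suc (m + k) + 7 * real n * (decay ^ m - decay ^ (m + k))"
      using one[of "m + k"] m Suc.IH by simp
    also have "\<dots> = 7 * real n * (decay ^ m - decay ^ (m + Suc k))"
      by (simp add: algebra_simps)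
    finally show ?case .
  qed simp
  have "(\<lambda>k. Z (?g k)) \<longlonglongrightarrow> Z x"
    using continuous_on_tendsto_compose[OF cont lim x] gQ by simp
  then have "(\<lambda>k. \<bar>Z (?g (m + k)) - Z (?g m)\<bar>) \<longlonglongrightarrow> \<bar>Z x - Z (?g m)\<bar>"
    using LIMSEQ_ignore_initial_segment[of "\<lambda>k. Z (?g k)" "Z x" m]
    by (intro tendsto_intros) (simp add: add.commute)
  then show "\<bar>Z x - Z (?g m)\<bar> \<le> 7 * real n * decay ^ m"
  proof (rule LIMSEQ_le_const2)
    show "\<exists>N. \<forall>k\<ge>N. \<bar>Z (?g (m + k)) - Z (?g m)\<bar> \<le> 7 * real n * decay ^ m"
    proof (intro exI allI impI)
      fix k
      show "\<bar>Z (?g (m + k)) - Z (?g m)\<bar> \<le> 7 * real n * decay ^ m"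
        using many[of k] by (rule order_trans) (simp add: mult_left_mono)
    qed
  qed
qed

section \<open>Coordinate patches\<close>

text \<open>The generating sets are balls around arbitrary \<open>f\<close>, so \<open>h\<close> may
  lie off the centre. On a compact set the distance from \<open>h\<close> to \<open>f\<close>
  attains its maximum, which is below \<open>e\<close> and leaves room for a uniform
  perturbation.\<close>

lemma limitin_uniform_on_topology:
  assumes S: "\<And>j. g j \<in> S" "h \<in> S"
    and lim: "\<And>D C. (D, C) \<in> \<D> \<Longrightarrow> uniform_limit C (\<lambda>j. D (g j)) (D h) sequentially"
    and cont: "\<And>D C f. (D, C) \<in> \<D> \<Longrightarrow> f \<in> S \<Longrightarrow> continuous_on C (D f)"
    and comp: "\<And>D C. (D, C) \<in> \<D> \<Longrightarrow> compact C"
  shows "limitin (uniform_on_topology S \<D>) g h sequentially"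
  unfolding limitin_def
proof (intro conjI allI impI)
  show "h \<in> topspace (uniform_on_topology S \<D>)" using S by simp
  fix U assume "openin (uniform_on_topology S \<D>) U \<and> h \<in> U"
  then have "generate_topology_on
      (insert S {{g\<in>S. \<forall>x\<in>C. norm (D g x - D f x) < e} | f D C e. f \<in> S \<and> (D, C) \<in> \<D> \<and> 0 < e}) U" and "h \<in> U"
    unfolding uniform_on_topology_def openin_topology_generated_by_iff by auto
  then show "\<forall>\<^sub>F j in sequentially. g j \<in> U"
  proof induction
    case (Int A B)
    then show ?case by (auto simp: eventually_conj_iff)
  next
    case (UN K)
    then obtain A where "A \<in> K" "h \<in> A" by blast
    with UN have "\<forall>\<^sub>F j in sequentially. g j \<in> A" by blast
    then show ?case by (rule eventually_mono) (use \<open>A \<in> K\<close> in blast)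
  next
    case (Basis A)
    then consider "A = S" | f D C e where "A = {g\<in>S. \<forall>x\<in>C. norm (D g x - D f x) < e}"
      "f \<in> S" "(D, C) \<in> \<D>" "0 < e" by auto
    then show ?case
    proof cases
      case 1
      then show ?thesis using S by simp
    next
      case 2
      have "\<exists>m<e. \<forall>x\<in>C. norm (D h x - D f x) \<le> m"
      proof (cases "C = {}")
        case True
        then show ?thesis using \<open>0 < e\<close> by auto
      next
        case False
        have "continuous_on C (\<lambda>x. norm (D h x - D f x))"
          using cont[OF 2(3)] S(2) 2(2) by (intro continuous_intros) auto
        then obtain x where "x \<in> C" "\<forall>y\<in>C. norm (D h y - D f y) \<le> norm (D h x - D f x)"
          using continuous_attains_sup[OF comp[OF 2(3)] False] by blast
        then show ?thesis using Basis.prems 2(1) by blast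
      qed
      then obtain m where m: "m < e" "\<And>x. x \<in> C \<Longrightarrow> norm (D h x - D f x) \<le> m" by blast
      have "\<forall>\<^sub>F j in sequentially. \<forall>x\<in>C. dist (D (g j) x) (D h x) < e - m"
        using uniform_limitD[OF lim[OF 2(3)], of "e - m"] m(1) by simp
      then show ?thesis
      proof (rule eventually_mono)
        fix j assume j: "\<forall>x\<in>C. dist (D (g j) x) (D h x) < e - m"
        have "norm (D (g j) x - D f x) < e" if "x \<in> C" for x
          using norm_triangle_ineq[of "D (g j) x - D h x" "D h x - D f x"] j that m(2)[OF that]
          by (force simp: dist_norm)
        then show "g j \<in> A" using S 2(1) by simp
      qed
    qed
  qed simp
qed

lemma compact_uniform_limit_local:
  fixes C :: "'a::topological_space set"
  assumes C: "compact C" "C \<subseteq> W"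
    and loc: "\<And>x. x \<in> W \<Longrightarrow> \<exists>B. open B \<and> x \<in> B \<and> uniform_limit (W \<inter> B) f h sequentially"
  shows "uniform_limit C f h sequentially"
proof -
  have "\<forall>x\<in>C. \<exists>B. open B \<and> x \<in> B \<and> uniform_limit (W \<inter> B) f h sequentially"
    using loc C(2) by blast
  then obtain B where B: "\<And>x. x \<in> C \<Longrightarrow> open (B x) \<and> x \<in> B x \<and> uniform_limit (W \<inter> B x) f h sequentially"
    by metis
  obtain F where F: "F \<subseteq> C" "finite F" "C \<subseteq> (\<Union>x\<in>F. B x)"
  proof (rule compactE_image[OF C(1), of C B])
    show "open (B x)" if "x \<in> C" for x using B[OF that] by simp
    show "C \<subseteq> (\<Union>x\<in>C. B x)" using B by auto
  qed (rule that, assumption+)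
  have "uniform_limit (\<Union>x\<in>F. W \<inter> B x) f h sequentially"
    using F B by (intro uniform_limit_on_UNION) auto
  then show ?thesis
    by (rule uniform_limit_on_subset) (use F C in auto)
qed

lemma Cr_with_cong_partials:
  assumes g: "Cr_with n r V f g" and eq: "\<And>is x. is \<in> directions n r \<Longrightarrow> x \<in> V \<Longrightarrow> g' is x = g is x"
  shows "Cr_with n r V f g'"
  unfolding Cr_with_def
proof (intro conjI ballI allI impI)
  show "g' [] x = f x" if "x \<in> V" for x using Cr_with_Nil[OF g that] eq[OF _ that] by simp
  show "continuous_on V (g' is)" if "is \<in> directions n r" for "is"
    using Cr_with_continuous[OF g that] eq[OF that] by (simp cong: continuous_on_cong)
  fix i "is" x assume i: "i # is \<in> directions n r" and x: "x \<in> V"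
  show "((\<lambda>t. g' is (x(i := t))) has_vector_derivative g' (i # is) x) (at (x i) within {t. x(i := t) \<in> V})"
    unfolding eq[OF i x]
    by (rule has_vector_derivative_transform[OF _ _ Cr_with_deriv[OF g i x]])
       (use x eq directions_ConsD[OF i] in auto)
qed

lemma Cr_with_unique:
  assumes "thick n V" "Cr_with n r V f g" "Cr_with n r V f g'" "is \<in> directions n r" "x \<in> V"
  shows "g is x = g' is x"
  using iter_partial_eqI[OF assms(1,2,4,5)] iter_partial_eqI[OF assms(1,3,4,5)] by simp

lemma top_of_set_Euclidean_space: "Euclidean_space n = top_of_set (model_space n False)"
  by (simp add: Euclidean_space_def model_space_def euclidean_product_topology)

lemma half_space_eq: "half_space n = top_of_set (model_space n True)"
  unfolding half_space_def Euclidean_space_def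
  by (simp add: model_space_def euclidean_product_topology subtopology_subtopology)
     (intro arg_cong[where f="subtopology euclidean"], auto)

section \<open>Charts, cubes in charts, and the change of charts\<close>

abbreviation pt :: "'m chart \<Rightarrow> (nat \<Rightarrow> real) \<Rightarrow> 'm" where
  "pt c x \<equiv> inv_into (fst c) (snd c) x"

lemma chart_image_eq: "chart_image c = snd c ` fst c"
  by (simp add: chart_image_def split: prod.split)

lemma in_chart_eq: "in_chart c f x = f (pt c x)"
  by (simp add: in_chart_def split: prod.split)

type_synonym 'm patch = "'m chart \<times> (nat \<Rightarrow> real) \<times> (nat \<Rightarrow> real) \<times> (nat \<Rightarrow> real) set"

abbreviation pchart :: "'m patch \<Rightarrow> 'm chart" where "pchart p \<equiv> fst p"
abbreviation plow :: "'m patch \<Rightarrow> nat \<Rightarrow> real" where "plow p \<equiv> fst (snd p)"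
abbreviation phigh :: "'m patch \<Rightarrow> nat \<Rightarrow> real" where "phigh p \<equiv> fst (snd (snd p))"
abbreviation popen :: "'m patch \<Rightarrow> (nat \<Rightarrow> real) set" where "popen p \<equiv> snd (snd (snd p))"
definition pcube :: "nat \<Rightarrow> 'm patch \<Rightarrow> (nat \<Rightarrow> real) set" where "pcube n p = cube n (plow p) (phigh p)"
definition pnbhd :: "'m patch \<Rightarrow> 'm set" where
  "pnbhd p = {q \<in> fst (pchart p). snd (pchart p) q \<in> popen p}"

text \<open>The cube is compact and lies in the chart image, while \<open>popen\<close> cuts out of
  the chart image a relatively open part inside the cube. \<open>pnbhd\<close> is therefore open in
  the manifold, at boundary points too.\<close>

definition good_patch :: "nat \<Rightarrow> 'm chart set \<Rightarrow> 'm patch \<Rightarrow> bool" where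
  "good_patch n \<A> p \<longleftrightarrow> pchart p \<in> \<A> \<and> (\<forall>l<n. plow p l < phigh p l) \<and>
     pcube n p \<subseteq> chart_image (pchart p) \<and> open (popen p) \<and> chart_image (pchart p) \<inter> popen p \<subseteq> pcube n p"

locale smooth_mfd =
  fixes M :: "'m topology" and n :: nat and \<A> :: "'m chart set"
  assumes mfd: "smooth_manifold M n \<A>"
begin

lemma is_chart: "c \<in> \<A> \<Longrightarrow> is_chart M n c"
  using mfd unfolding smooth_manifold_def smooth_atlas_def by (elim conjE) (rule bspec)

lemma chart_open: "c \<in> \<A> \<Longrightarrow> openin M (fst c)"
  using is_chart[of c] unfolding is_chart_def case_prod_beta by blast

lemma chart_subset: "c \<in> \<A> \<Longrightarrow> fst c \<subseteq> topspace M"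
  by (rule openin_subset[OF chart_open])

lemma chart_cover: "q \<in> topspace M \<Longrightarrow> \<exists>c\<in>\<A>. q \<in> fst c"
proof -
  have "topspace M = (\<Union>c\<in>\<A>. fst c)"
    using mfd unfolding smooth_manifold_def smooth_atlas_def case_prod_beta by (elim conjE) simp
  then show "q \<in> topspace M \<Longrightarrow> \<exists>c\<in>\<A>. q \<in> fst c" by blast
qed

lemma chart_homeo:
  "c \<in> \<A> \<Longrightarrow> homeomorphic_map (subtopology M (fst c)) (subtopology (Euclidean_space n) (chart_image c)) (snd c)"
  using is_chart[of c] unfolding is_chart_def case_prod_beta chart_image_eq by blast

lemma chart_model: "c \<in> \<A> \<Longrightarrow> \<exists>bd. openin (top_of_set (model_space n bd)) (chart_image c)"
  using is_chart[of c]
  unfolding is_chart_def case_prod_beta chart_image_eq half_space_eq top_of_set_Euclidean_space by blast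

lemma chart_thick: "c \<in> \<A> \<Longrightarrow> thick n (chart_image c)"
  using chart_model thick_model_space by blast

lemma chart_image_model: "c \<in> \<A> \<Longrightarrow> chart_image c \<subseteq> model_space n False"
proof -
  assume "c \<in> \<A>"
  then obtain bd where "openin (top_of_set (model_space n bd)) (chart_image c)"
    using chart_model by blast
  then have "chart_image c \<subseteq> model_space n bd" by (rule openin_imp_subset)
  also have "\<dots> \<subseteq> model_space n False" by (auto simp: model_space_def)
  finally show ?thesis .
qed

lemma chart_topologies:
  assumes "c \<in> \<A>"
  shows "topspace (subtopology M (fst c)) = fst c"
    and "subtopology (Euclidean_space n) (chart_image c) = top_of_set (chart_image c)"
  using chart_subset[OF assms] chart_image_model[OF assms]
  by (auto simp: top_of_set_Euclidean_space subtopology_subtopology Int_absorb1)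

lemma chart_inj: "c \<in> \<A> \<Longrightarrow> inj_on (snd c) (fst c)"
  using homeomorphic_imp_injective_map[OF chart_homeo] chart_topologies(1) by metis

lemma pt_image: "x \<in> chart_image c \<Longrightarrow> pt c x \<in> fst c \<and> snd c (pt c x) = x"
  by (simp add: chart_image_eq inv_into_into f_inv_into_f)

lemma pt_chart: "c \<in> \<A> \<Longrightarrow> q \<in> fst c \<Longrightarrow> pt c (snd c q) = q"
  by (simp add: chart_inj)

lemma chart_preimage_open:
  assumes c: "c \<in> \<A>" and A: "open A"
  shows "openin M {q \<in> fst c. snd c q \<in> A}"
proof -
  have "openin (subtopology M (fst c)) {q \<in> topspace (subtopology M (fst c)). snd c q \<in> chart_image c \<inter> A}"
  proof (rule openin_continuous_map_preimage)
    show "continuous_map (subtopology M (fst c)) (top_of_set (chart_image c)) (snd c)"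
      using homeomorphic_imp_continuous_map[OF chart_homeo[OF c]] chart_topologies(2)[OF c] by simp
    show "openin (top_of_set (chart_image c)) (chart_image c \<inter> A)" using A by (auto simp: openin_open)
  qed
  also have "{q \<in> topspace (subtopology M (fst c)). snd c q \<in> chart_image c \<inter> A} = {q \<in> fst c. snd c q \<in> A}"
    unfolding chart_topologies(1)[OF c] by (auto simp: chart_image_eq)
  finally show ?thesis using chart_open[OF c] by (meson openin_trans_full)
qed

lemma chart_image_open:
  assumes c: "c \<in> \<A>" and N: "openin M N"
  shows "\<exists>B. open B \<and> snd c ` (fst c \<inter> N) = chart_image c \<inter> B"
proof -
  have "openin (subtopology M (fst c)) (fst c \<inter> N)"
    using N by (auto simp: openin_subtopology)
  then have "openin (top_of_set (chart_image c)) (snd c ` (fst c \<inter> N))"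
    using homeomorphic_imp_open_map[OF chart_homeo[OF c]] chart_topologies(2)[OF c]
    by (simp add: open_map_def)
  then show ?thesis by (auto simp: openin_open)
qed

lemma transition:
  assumes "c \<in> \<A>" "c' \<in> \<A>" "l < n"
  shows "Cr_on n \<infinity> (snd c ` (fst c \<inter> fst c')) (\<lambda>x. snd c' (pt c x) l)"
proof -
  have "\<forall>c\<in>\<A>. \<forall>c'\<in>\<A>. \<forall>i<n. Cr_on n \<infinity> (snd c ` (fst c \<inter> fst c')) (\<lambda>x. snd c' (pt c x) i)"
    using mfd unfolding smooth_manifold_def smooth_atlas_def case_prod_beta by (elim conjE)
  then show ?thesis using assms by simp
qed

lemma exists_patch:
  assumes "q \<in> topspace M"
  shows "\<exists>p. good_patch n \<A> p \<and> q \<in> pnbhd p"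
proof -
  obtain c where c: "c \<in> \<A>" "q \<in> fst c" using chart_cover[OF assms] by blast
  obtain bd where bd: "openin (top_of_set (model_space n bd)) (chart_image c)"
    using chart_model[OF c(1)] by blast
  obtain a b A where "\<forall>i<n. a i < b i" "cube n a b \<subseteq> chart_image c" "open A" "snd c q \<in> A"
      "chart_image c \<inter> A \<subseteq> cube n a b"
    using model_space_nbhd[OF bd, of "snd c q"] c by (auto simp: chart_image_eq)
  then show ?thesis
    using c by (intro exI[of _ "(c, a, b, A)"]) (simp add: good_patch_def pcube_def pnbhd_def)
qed

lemma pnbhd_open: "good_patch n \<A> p \<Longrightarrow> openin M (pnbhd p)"
  unfolding pnbhd_def good_patch_def by (intro chart_preimage_open) auto

lemma pnbhd_cube: "good_patch n \<A> p \<Longrightarrow> q \<in> pnbhd p \<Longrightarrow> snd (pchart p) q \<in> pcube n p"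
  unfolding pnbhd_def good_patch_def by (auto simp: chart_image_eq)

text \<open>Second countability gives the Lindelof property and so a countable subcover. This is the
  reason why countably many coordinates describe a field.\<close>

lemma countable_patches:
  "\<exists>\<P>. countable \<P> \<and> (\<forall>p\<in>\<P>. good_patch n \<A> p) \<and> topspace M = (\<Union>p\<in>\<P>. pnbhd p)"
proof -
  have "Lindelof_space M"
    using mfd by (intro second_countable_imp_Lindelof_space) (simp add: smooth_manifold_def)
  moreover have "\<Union>(pnbhd ` {p. good_patch n \<A> p}) = topspace M"
  proof
    show "\<Union>(pnbhd ` {p. good_patch n \<A> p}) \<subseteq> topspace M"
      using pnbhd_open openin_subset by blast
  qed (use exists_patch in blast)
  ultimately obtain \<V> where \<V>: "countable \<V>" "\<V> \<subseteq> pnbhd ` {p. good_patch n \<A> p}" "\<Union>\<V> = topspace M"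
    using Lindelof_spaceD[of M "pnbhd ` {p. good_patch n \<A> p}"] pnbhd_open by blast
  then obtain \<P> where "countable \<P>" "\<P> \<subseteq> {p. good_patch n \<A> p}" "\<V> = pnbhd ` \<P>"
    using countable_subset_image[of \<V> pnbhd "{p. good_patch n \<A> p}"] by blast
  then show ?thesis using \<V>(3) by blast
qed

lemma patch_Cr_with:
  assumes p: "good_patch n \<A> p" and f: "f \<in> Cr_space M n \<A> r"
  shows "Cr_with n r (pcube n p) (in_chart (pchart p) f)
    (\<lambda>is. iter_partial (chart_image (pchart p)) is (in_chart (pchart p) f))"
proof (rule Cr_with_subset[OF Cr_onD])
  show "Cr_on n r (chart_image (pchart p)) (in_chart (pchart p) f)"
    using p f by (auto simp: good_patch_def Cr_space_def)
qed (use p in \<open>simp add: good_patch_def\<close>)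

text \<open>Near \<open>x0\<close> the transition map \<open>\<tau>\<close> sends the chart
  \<open>c\<close> into the cube of \<open>p\<close>, so \<open>compose_partials\<close> expresses
  derivatives in \<open>c\<close> through derivatives on the cube. The set \<open>B\<close> is
  obtained as the trace of \<open>pnbhd p\<close> in the chart.\<close>

lemma patch_transition:
  assumes c: "c \<in> \<A>" and x0: "x0 \<in> chart_image c" and p: "good_patch n \<A> p" and q: "pt c x0 \<in> pnbhd p"
  obtains B \<tau> C where "open B" "x0 \<in> B" "thick n (chart_image c \<inter> B)"
    "\<And>x. x \<in> chart_image c \<inter> B \<Longrightarrow> \<tau> x \<in> pcube n p \<and> pt c x = pt (pchart p) (\<tau> x)"
    "\<And>is js. set is \<subseteq> {..<n} \<Longrightarrow> continuous_on (chart_image c \<inter> B) (C is js)"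
    "\<And>r F G. Cr_with n r (pcube n p) F G \<Longrightarrow>
       Cr_with n r (chart_image c \<inter> B) (\<lambda>x. F (\<tau> x) :: 'b::real_normed_vector)
         (\<lambda>is x. \<Sum>js\<in>directions n (enat (length is)). C is js x *\<^sub>R G js (\<tau> x))"
proof -
  let ?c = "pchart p"
  have pc: "?c \<in> \<A>" using p by (simp add: good_patch_def)
  obtain B where B: "open B" "snd c ` (fst c \<inter> pnbhd p) = chart_image c \<inter> B"
    using chart_image_open[OF c pnbhd_open[OF p]] by blast
  let ?V = "chart_image c \<inter> B"
  have V: "pt c x \<in> fst c \<inter> pnbhd p" if "x \<in> ?V" for x
  proof -
    obtain q where "q \<in> fst c \<inter> pnbhd p" "x = snd c q" using \<open>x \<in> ?V\<close> unfolding B(2)[symmetric] by blast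
    then show ?thesis using pt_chart[OF c] by simp
  qed
  define \<tau> where "\<tau> x = snd ?c (pt c x)" for x
  have \<tau>: "\<tau> x \<in> pcube n p" "pt c x = pt ?c (\<tau> x)" if "x \<in> ?V" for x
    using V[OF that] pnbhd_cube[OF p] pt_chart[OF pc] by (auto simp: \<tau>_def pnbhd_def)
  obtain bd where "openin (top_of_set (model_space n bd)) (chart_image c)"
    using chart_model[OF c] by blast
  then have "openin (top_of_set (model_space n bd)) ?V"
    using B(1) by (rule openin_Int_open)
  then have th: "thick n ?V" by (rule thick_model_space)
  have D: "Cr_with n \<infinity> ?V (\<lambda>x. \<tau> x l)
      (\<lambda>is. iter_partial (snd c ` (fst c \<inter> fst ?c)) is (\<lambda>x. snd ?c (pt c x) l))" if "l < n" for l
    unfolding \<tau>_def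
  proof (rule Cr_with_subset[OF Cr_onD[OF transition[OF c pc that]]])
    show "?V \<subseteq> snd c ` (fst c \<inter> fst ?c)" unfolding B(2)[symmetric] by (auto simp: pnbhd_def)
  qed
  have "x0 \<in> B"
  proof -
    have "pt c x0 \<in> fst c \<inter> pnbhd p" using q pt_image[OF x0] by simp
    then have "snd c (pt c x0) \<in> ?V" unfolding B(2)[symmetric] by blast
    then show ?thesis using pt_image[OF x0] by simp
  qed
  obtain C where C: "\<And>is js. set is \<subseteq> {..<n} \<Longrightarrow> continuous_on ?V (C is js)"
    "\<And>r F G. Cr_with n r (pcube n p) F G \<Longrightarrow>
       Cr_with n r ?V (\<lambda>x. F (\<tau> x) :: 'b)
         (\<lambda>is x. \<Sum>js\<in>directions n (enat (length is)). C is js x *\<^sub>R G js (\<tau> x))"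
    using compose_partials[of n ?V \<tau> _ "plow p" "phigh p", where 'b='b, OF D] \<tau>(1)
    unfolding pcube_def by blast
  show ?thesis
    by (rule that[of B \<tau> C]) (use B(1) \<open>x0 \<in> B\<close> th \<tau> C in auto)
qed

text \<open>Reduces convergence in all charts and on all compact sets to convergence on the cubes of
  a cover. The coefficients of the chain rule do not depend on \<open>j\<close>, so uniform
  convergence passes to a neighbourhood of each point of any chart; finitely many neighbourhoods
  cover a compact set.\<close>

lemma Cr_space_limit:
  fixes g :: "nat \<Rightarrow> 'm \<Rightarrow> 'b::banach"
  assumes cover: "topspace M = (\<Union>p\<in>\<P>. pnbhd p)" and \<P>: "\<And>p. p \<in> \<P> \<Longrightarrow> good_patch n \<A> p"
    and g: "\<And>j. g j \<in> Cr_space M n \<A> r"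
    and lim: "\<And>p is. p \<in> \<P> \<Longrightarrow> is \<in> directions n r \<Longrightarrow>
      uniformly_convergent_on (pcube n p) (\<lambda>j. iter_partial (chart_image (pchart p)) is (in_chart (pchart p) (g j)))"
  shows "\<exists>h\<in>Cr_space M n \<A> r. \<forall>c\<in>\<A>. \<forall>is\<in>directions n r. \<forall>C. compact C \<longrightarrow> C \<subseteq> chart_image c \<longrightarrow>
    uniform_limit C (\<lambda>j. iter_partial (chart_image c) is (in_chart c (g j)))
      (iter_partial (chart_image c) is (in_chart c h)) sequentially"
proof -
  let ?G = "\<lambda>p j is. iter_partial (chart_image (pchart p)) is (in_chart (pchart p) (g j))"
  define H where "H p is x = lim (\<lambda>j. ?G p j is x)" for p "is" x
  have H: "uniform_limit (pcube n p) (\<lambda>j. ?G p j is) (H p is) sequentially"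
    if "p \<in> \<P>" "is \<in> directions n r" for p "is"
    using lim[OF that] unfolding uniformly_convergent_uniform_limit_iff H_def[abs_def] .
  have CrH: "Cr_with n r (pcube n p) (H p []) (H p)" if "p \<in> \<P>" for p
    using patch_Cr_with[OF \<P>[OF that] g] H[OF that] unfolding pcube_def by (rule Cr_with_uniform_limit)
  define h where "h = restrict (\<lambda>q. lim (\<lambda>j. g j q)) (topspace M)"
  have hH: "h (pt (pchart p) y) = H p [] y" if p: "p \<in> \<P>" and y: "y \<in> pcube n p" for p y
  proof -
    have "pchart p \<in> \<A>" "y \<in> chart_image (pchart p)" using \<P>[OF p] y by (auto simp: good_patch_def)
    then have "pt (pchart p) y \<in> topspace M"
      using pt_image chart_subset by blast
    then show ?thesis by (simp add: h_def H_def in_chart_eq)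
  qed
  define L where "L c is x = lim (\<lambda>j. iter_partial (chart_image c) is (in_chart c (g j)) x)" for c "is" x
  have local: "(\<exists>B. open B \<and> x0 \<in> B \<and> Cr_with n r (chart_image c \<inter> B) (in_chart c h) (L c)) \<and>
      (\<forall>is\<in>directions n r. \<exists>B. open B \<and> x0 \<in> B \<and> uniform_limit (chart_image c \<inter> B)
        (\<lambda>j. iter_partial (chart_image c) is (in_chart c (g j))) (L c is) sequentially)"
    if c: "c \<in> \<A>" and x0: "x0 \<in> chart_image c" for c x0
  proof -
    have "pt c x0 \<in> topspace M" using pt_image[OF x0] chart_subset[OF c] by blast
    then obtain p where p: "p \<in> \<P>" "pt c x0 \<in> pnbhd p" using cover by blast
    obtain B \<tau> C where B: "open B" "x0 \<in> B" and th: "thick n (chart_image c \<inter> B)"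
      and \<tau>: "\<And>x. x \<in> chart_image c \<inter> B \<Longrightarrow> \<tau> x \<in> pcube n p \<and> pt c x = pt (pchart p) (\<tau> x)"
      and C: "\<And>is js. set is \<subseteq> {..<n} \<Longrightarrow> continuous_on (chart_image c \<inter> B) (C is js)"
      and chain: "\<And>r F G. Cr_with n r (pcube n p) F G \<Longrightarrow>
        Cr_with n r (chart_image c \<inter> B) (\<lambda>x. F (\<tau> x) :: 'b)
          (\<lambda>is x. \<Sum>js\<in>directions n (enat (length is)). C is js x *\<^sub>R G js (\<tau> x))"
      by (rule patch_transition[where 'b='b, OF c x0 \<P>[OF p(1)] p(2)]) (rule that, assumption+)
    let ?V = "chart_image c \<inter> B"
    let ?J = "\<lambda>is. directions n (enat (length (is :: nat list)))"
    let ?I = "\<lambda>j is. iter_partial (chart_image c) is (in_chart c (g j))"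
    have sub: "js \<in> directions n r" if "is \<in> directions n r" "js \<in> ?J is" for "is" js
      using subsetD[OF directions_mono[OF directions_length[OF that(1)]] that(2)] .
    \<comment> \<open>Both sides are derivative families of one function on a thick set, hence
      equal.\<close>
    have I: "?I j is x = (\<Sum>js\<in>?J is. C is js x *\<^sub>R ?G p j js (\<tau> x))"
      if "is \<in> directions n r" "x \<in> ?V" for j "is" x
    proof (rule Cr_with_unique[OF th _ _ that])
      show "Cr_with n r ?V (in_chart c (g j)) (?I j)"
        using g[of j] c by (intro Cr_with_subset[OF Cr_onD, of n r "chart_image c"]) (auto simp: Cr_space_def)
      show "Cr_with n r ?V (in_chart c (g j)) (\<lambda>is x. \<Sum>js\<in>?J is. C is js x *\<^sub>R ?G p j js (\<tau> x))"
        using chain[OF patch_Cr_with[OF \<P>[OF p(1)] g]]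
        by (rule Cr_with_cong) (use \<tau> in \<open>simp add: in_chart_eq\<close>)
    qed
    have LH: "L c is x = (\<Sum>js\<in>?J is. C is js x *\<^sub>R H p js (\<tau> x))"
      if i: "is \<in> directions n r" and x: "x \<in> ?V" for "is" x
      unfolding L_def I[OF i x]
    proof (rule limI, intro tendsto_intros)
      show "(\<lambda>j. ?G p j js (\<tau> x)) \<longlonglongrightarrow> H p js (\<tau> x)" if "js \<in> ?J is" for js
        using tendsto_uniform_limitI[OF H[OF p(1) sub[OF i that]]] \<tau>[OF x] by blast
    qed
    have "Cr_with n r ?V (in_chart c h) (\<lambda>is x. \<Sum>js\<in>?J is. C is js x *\<^sub>R H p js (\<tau> x))"
      using chain[OF CrH[OF p(1)]]
      by (rule Cr_with_cong) (use \<tau> hH[OF p(1)] in \<open>simp add: in_chart_eq\<close>)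
    then have 1: "Cr_with n r ?V (in_chart c h) (L c)"
      by (rule Cr_with_cong_partials) (rule LH)
    have 2: "\<exists>B. open B \<and> x0 \<in> B \<and> uniform_limit (chart_image c \<inter> B) (\<lambda>j. ?I j is) (L c is) sequentially"
      if i: "is \<in> directions n r" for "is"
    proof -
      \<comment> \<open>The coefficients are merely continuous, so they are bounded by their size at
        \<open>x0\<close> plus 1 on a smaller neighbourhood; only finitely many words
        \<open>js\<close> matter.\<close>
      define k where "k js = \<bar>C is js x0\<bar> + 1" for js
      have "\<exists>A. open A \<and> x0 \<in> A \<and> (\<forall>x\<in>?V \<inter> A. \<bar>C is js x\<bar> \<le> k js)" for js
      proof -
        have "continuous_on ?V (\<lambda>x. \<bar>C is js x\<bar>)"
          using C[OF directions_set[OF i]] by (intro continuous_intros)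
        then obtain A where A: "open A" "A \<inter> ?V = (\<lambda>x. \<bar>C is js x\<bar>) -` {..<k js} \<inter> ?V"
          unfolding continuous_on_open_invariant by (meson open_lessThan)
        have "x0 \<in> A \<inter> ?V" unfolding A(2) using x0 B by (simp add: k_def)
        moreover have "\<bar>C is js x\<bar> \<le> k js" if "x \<in> ?V \<inter> A" for x
        proof -
          have "x \<in> A \<inter> ?V" using that by blast
          then show ?thesis unfolding A(2) by simp
        qed
        ultimately show ?thesis using A(1) by blast
      qed
      then obtain A where A: "\<And>js. open (A js)" "\<And>js. x0 \<in> A js"
        "\<And>js x. x \<in> ?V \<inter> A js \<Longrightarrow> \<bar>C is js x\<bar> \<le> k js" by metis
      define B0 where "B0 = B \<inter> (\<Inter>js\<in>?J is. A js)"
      have "open B0" "x0 \<in> B0"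
        unfolding B0_def using A B finite_directions[of n "length is"] by auto
      moreover have "uniform_limit (chart_image c \<inter> B0) (\<lambda>j. ?I j is) (L c is) sequentially"
      proof (rule uniform_limitI)
        fix e :: real assume e: "e > 0"
        define S where "S = (\<Sum>js\<in>?J is. k js)"
        have S: "S \<ge> 0" unfolding S_def by (intro sum_nonneg) (simp add: k_def)
        have "\<forall>\<^sub>F j in sequentially. \<forall>js\<in>?J is. \<forall>y\<in>pcube n p. dist (?G p j js y) (H p js y) < e / (S + 1)"
          using e S by (intro eventually_ball_finite finite_directions ballI uniform_limitD[OF H[OF p(1)]] sub[OF i]) auto
        then show "\<forall>\<^sub>F j in sequentially. \<forall>x\<in>chart_image c \<inter> B0. dist (?I j is x) (L c is x) < e"
        proof eventually_elim
          case (elim j)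
          show ?case
          proof
            fix x assume x: "x \<in> chart_image c \<inter> B0"
            then have xV: "x \<in> ?V" by (auto simp: B0_def)
            have "dist (?I j is x) (L c is x) =
                norm (\<Sum>js\<in>?J is. C is js x *\<^sub>R (?G p j js (\<tau> x) - H p js (\<tau> x)))"
              unfolding dist_norm I[OF i xV] LH[OF i xV] by (simp add: sum_subtractf scaleR_diff_right)
            also have "\<dots> \<le> (\<Sum>js\<in>?J is. k js * (e / (S + 1)))"
            proof (rule order_trans[OF norm_sum], rule sum_mono)
              fix js assume js: "js \<in> ?J is"
              have "\<bar>C is js x\<bar> \<le> k js" using x js by (intro A(3)) (auto simp: B0_def)
              moreover have "norm (?G p j js (\<tau> x) - H p js (\<tau> x)) \<le> e / (S + 1)"
                using elim js \<tau>[OF xV] by (auto simp: dist_norm less_imp_le)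
              ultimately show "norm (C is js x *\<^sub>R (?G p j js (\<tau> x) - H p js (\<tau> x))) \<le> k js * (e / (S + 1))"
                unfolding norm_scaleR by (intro mult_mono) (auto simp: k_def)
            qed
            also have "\<dots> = S * e / (S + 1)"
              unfolding sum_distrib_right[symmetric] S_def[symmetric] by simp
            also have "\<dots> < e" using S e by (simp add: divide_less_eq algebra_simps)
            finally show "dist (?I j is x) (L c is x) < e" .
          qed
        qed
      qed
      ultimately show ?thesis by blast
    qed
    show ?thesis using 1 2 B by blast
  qed
  have Cr: "Cr_with n r (chart_image c) (in_chart c h) (L c)" if "c \<in> \<A>" for c
    using local[OF that] by (intro Cr_with_local) blast
  have "h \<in> Cr_space M n \<A> r"
    using Cr_onI(1)[OF chart_thick Cr] by (auto simp: Cr_space_def h_def)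
  moreover have "uniform_limit C (\<lambda>j. iter_partial (chart_image c) is (in_chart c (g j)))
      (iter_partial (chart_image c) is (in_chart c h)) sequentially"
    if c: "c \<in> \<A>" and i: "is \<in> directions n r" and C: "compact C" "C \<subseteq> chart_image c" for c "is" C
  proof -
    have "uniform_limit C (\<lambda>j. iter_partial (chart_image c) is (in_chart c (g j))) (L c is) sequentially"
      using local[OF c] i by (intro compact_uniform_limit_local[OF C]) blast
    moreover have "L c is x = iter_partial (chart_image c) is (in_chart c h) x" if "x \<in> C" for x
      using iter_partial_eqI[OF chart_thick[OF c] Cr[OF c] i] that C by auto
    ultimately show ?thesis
      by (subst uniform_limit_cong'[of C _ "\<lambda>j. iter_partial (chart_image c) is (in_chart c (g j))" _ "L c is"]) auto
  qed
  ultimately show ?thesis by blast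
qed

end

text \<open>An argument with three thirds of \<open>e\<close>: \<open>chaining_bound\<close>
  controls the distance to the rounded point uniformly in \<open>j\<close>, and at a fixed level
  only finitely many grid values have to be Cauchy. It runs per component because the thresholds
  \<open>m0 i\<close> do.\<close>

lemma grid_convergence:
  fixes G :: "nat \<Rightarrow> (nat \<Rightarrow> real) \<Rightarrow> real ^ 'k"
  assumes ab: "\<And>l. l < n \<Longrightarrow> a l < b l" and cont: "\<And>j. continuous_on (cube n a b) (G j)"
    and steps: "\<And>j i m z l. m \<ge> m0 i \<Longrightarrow> (z, l) \<in> steps n m \<Longrightarrow>
      \<bar>G j (gridpt n a b m (step_to z l)) $ i - G j (gridpt n a b m z) $ i\<bar> \<le> decay ^ m"
    and conv: "\<And>m z i. z \<in> grids n m \<Longrightarrow> convergent (\<lambda>j. G j (gridpt n a b m z) $ i)"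
  shows "uniformly_convergent_on (cube n a b) G"
proof -
  let ?Q = "cube n a b"
  have comp: "\<exists>h. uniform_limit ?Q (\<lambda>j x. G j x $ i) h sequentially" for i
  proof -
    have "uniformly_Cauchy_on ?Q (\<lambda>j x. G j x $ i)"
    proof (rule uniformly_Cauchy_onI)
      fix e :: real assume e: "e > 0"
      have "(\<lambda>m. 7 * real n * decay ^ m) \<longlonglongrightarrow> 7 * real n * 0"
        by (intro tendsto_intros LIMSEQ_realpow_zero) auto
      then have "\<forall>\<^sub>F m in sequentially. 7 * real n * decay ^ m < e / 3"
        using e by (intro order_tendstoD) auto
      moreover have "\<forall>\<^sub>F m in sequentially. m \<ge> m0 i" by (rule eventually_ge_at_top)
      ultimately have "\<forall>\<^sub>F m in sequentially. 7 * real n * decay ^ m < e / 3 \<and> m \<ge> m0 i"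
        by (rule eventually_conj)
      then obtain m where m: "7 * real n * decay ^ m < e / 3" "m \<ge> m0 i"
        by (auto dest: eventually_happens)
      have "\<forall>z\<in>grids n m. \<exists>N. \<forall>j\<ge>N. \<forall>k\<ge>N.
          dist (G j (gridpt n a b m z) $ i) (G k (gridpt n a b m z) $ i) < e / 3"
        using convergent_Cauchy[OF conv] e unfolding Cauchy_def by (metis divide_pos_pos zero_less_numeral)
      then obtain N where N: "\<And>z j k. z \<in> grids n m \<Longrightarrow> j \<ge> N z \<Longrightarrow> k \<ge> N z \<Longrightarrow>
          dist (G j (gridpt n a b m z) $ i) (G k (gridpt n a b m z) $ i) < e / 3" by metis
      define N' where "N' = Max (insert 0 (N ` grids n m))"
      have N': "N z \<le> N'" if "z \<in> grids n m" for z
        unfolding N'_def using that finite_grids by (intro Max_ge) auto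
      show "\<exists>N. \<forall>x\<in>?Q. \<forall>j\<ge>N. \<forall>k\<ge>N. dist (G j x $ i) (G k x $ i) < e"
      proof (intro exI ballI allI impI)
        fix x j k assume x: "x \<in> ?Q" and jk: "j \<ge> N'" "k \<ge> N'"
        have tri: "\<bar>A - D\<bar> \<le> \<bar>A - B\<bar> + \<bar>B - C\<bar> + \<bar>D - C\<bar>" for A B C D :: real by linarith
        let ?z = "round_down n a b m x"
        let ?y = "gridpt n a b m ?z"
        have z: "?z \<in> grids n m"
          by (rule round_down_grids[OF ab x])
        have near: "\<bar>G j x $ i - G j ?y $ i\<bar> \<le> 7 * real n * decay ^ m" for j
          using cont by (intro chaining_bound[OF ab x _ steps m(2)] continuous_intros)
        have "dist (G j ?y $ i) (G k ?y $ i) < e / 3"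
          using N' jk z by (intro N) (auto intro: order_trans)
        then show "dist (G j x $ i) (G k x $ i) < e"
          using near[of j] near[of k] m(1) tri[where A="G j x $ i" and D="G k x $ i" and B="G j ?y $ i" and C="G k ?y $ i"]
          unfolding dist_real_def by linarith
      qed
    qed
    then show ?thesis
      using Cauchy_uniformly_convergent uniformly_convergent_on_def by blast
  qed
  then obtain h where h: "\<And>i. uniform_limit ?Q (\<lambda>j x. G j x $ i) (h i) sequentially" by metis
  have "uniform_limit ?Q G (\<lambda>x. \<chi> i. h i x) sequentially"
  proof (rule uniform_limitI)
    fix e :: real assume e: "e > 0"
    have "\<forall>\<^sub>F j in sequentially. \<forall>i\<in>(UNIV :: 'k set). \<forall>x\<in>?Q. dist (G j x $ i) (h i x) < e / CARD('k)"
      using e by (intro eventually_ball_finite ballI uniform_limitD[OF h]) auto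
    then show "\<forall>\<^sub>F j in sequentially. \<forall>x\<in>?Q. dist (G j x) (\<chi> i. h i x) < e"
    proof eventually_elim
      case (elim j)
      show ?case
      proof
        fix x assume x: "x \<in> ?Q"
        have "dist (G j x) (\<chi> i. h i x) \<le> (\<Sum>i\<in>UNIV. \<bar>(G j x - (\<chi> i. h i x)) $ i\<bar>)"
          unfolding dist_norm by (rule norm_le_l1_cart)
        also have "\<dots> < (\<Sum>i\<in>(UNIV :: 'k set). e / CARD('k))"
          using elim x by (intro sum_strict_mono) (auto simp: dist_real_def)
        finally show "dist (G j x) (\<chi> i. h i x) < e" by simp
      qed
    qed
  qed
  then show ?thesis by (rule uniformly_convergentI)
qed

section \<open>The countable family of coordinates of a field\<close>

type_synonym 'k site = "nat \<times> nat list \<times> 'k \<times> nat \<times> nat list"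

locale patched_mfd = smooth_mfd M n \<A> for M :: "'m topology" and n :: nat and \<A> :: "'m chart set" +
  fixes \<P> :: "'m patch set" and r :: enat
  assumes countable_P: "countable \<P>" and good: "\<And>p. p \<in> \<P> \<Longrightarrow> good_patch n \<A> p"
    and covering: "topspace M = (\<Union>p\<in>\<P>. pnbhd p)"
begin

definition patch :: "nat \<Rightarrow> 'm patch" where "patch k = from_nat_into \<P> k"

text \<open>The set \<open>\<P>\<close> may be finite while \<open>from_nat_into\<close> is total;
  this marks the numbers that code a patch.\<close>

definition valid :: "nat \<Rightarrow> bool" where "valid k \<longleftrightarrow> k \<in> to_nat_on \<P> ` \<P>"

lemma valid_patch: "valid k \<Longrightarrow> patch k \<in> \<P>"
  unfolding valid_def patch_def using countable_P by (auto simp: from_nat_into_to_nat_on)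

lemma patch_surj: "p \<in> \<P> \<Longrightarrow> \<exists>k. valid k \<and> patch k = p"
  unfolding valid_def patch_def using countable_P by (auto simp: from_nat_into_to_nat_on)

abbreviation ch :: "nat \<Rightarrow> 'm chart" where "ch k \<equiv> pchart (patch k)"

abbreviation gp :: "nat \<Rightarrow> nat \<Rightarrow> nat list \<Rightarrow> nat \<Rightarrow> real" where
  "gp k m z \<equiv> gridpt n (plow (patch k)) (phigh (patch k)) m z"

lemma valid_chart: "valid k \<Longrightarrow> ch k \<in> \<A>"
  using good[OF valid_patch] by (simp add: good_patch_def)

lemma valid_side: "valid k \<Longrightarrow> l < n \<Longrightarrow> plow (patch k) l < phigh (patch k) l"
  using good[OF valid_patch] by (simp add: good_patch_def)

lemma valid_cube: "valid k \<Longrightarrow> pcube n (patch k) \<subseteq> chart_image (ch k)"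
  using good[OF valid_patch] by (simp add: good_patch_def)

lemma gp_cube: "valid k \<Longrightarrow> z \<in> grids n m \<Longrightarrow> gp k m z \<in> pcube n (patch k)"
  unfolding pcube_def using valid_side[of k] by (intro gridpt_in_cube) (simp_all add: less_imp_le)

lemma gp_chart: "valid k \<Longrightarrow> z \<in> grids n m \<Longrightarrow> gp k m z \<in> chart_image (ch k)"
  by (rule subsetD[OF valid_cube gp_cube])

definition deriv_at :: "'m chart \<Rightarrow> nat list \<Rightarrow> 'k \<Rightarrow> (nat \<Rightarrow> real) \<Rightarrow> ('m \<Rightarrow> real ^ 'k) \<Rightarrow> real" where
  "deriv_at c is i x f = iter_partial (chart_image c) is (in_chart c f) x $ i"

definition ok :: "'k site \<Rightarrow> bool" where
  "ok = (\<lambda>(k, is, i, m, z). valid k \<and> is \<in> directions n r \<and> z \<in> grids n m)"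

text \<open>Every natural number has to name a coordinate, so meaningless sites occur. Their default
  0 is measurable, Gaussian and the same for all fields.\<close>

definition functional :: "'k::finite site \<Rightarrow> ('m \<Rightarrow> real ^ 'k) \<Rightarrow> real" where
  "functional e f = (if ok e then (case e of (k, is, i, m, z) \<Rightarrow> deriv_at (ch k) is i (gp k m z) f) else 0)"

definition coordinate :: "nat \<Rightarrow> ('m \<Rightarrow> real ^ 'k::finite) \<Rightarrow> real" where
  "coordinate l f = functional (from_nat l) f"

abbreviation index :: "nat \<Rightarrow> nat list \<Rightarrow> 'k::finite \<Rightarrow> nat \<Rightarrow> nat list \<Rightarrow> nat" where
  "index k is i m z \<equiv> to_nat (k, is, i, m, z)"

lemma coordinate_to_nat: "coordinate (to_nat e) f = functional e f"
  by (simp add: coordinate_def)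

text \<open>Each condition compares two coordinates, so the set is closed in the product topology.
  It restricts increments from a level on, that level depending on patch, derivative and component;
  values are left free.\<close>

definition regular :: "(nat \<Rightarrow> nat list \<Rightarrow> 'k::finite \<Rightarrow> nat) \<Rightarrow> (nat \<Rightarrow> real) set" where
  "regular m0 = {v. \<forall>k is i m z l. valid k \<longrightarrow> is \<in> directions n r \<longrightarrow> m0 k is i \<le> m \<longrightarrow> (z, l) \<in> steps n m \<longrightarrow>
     \<bar>v (to_nat (k, is, i, m, step_to z l)) - v (to_nat (k, is, i, m, z))\<bar> \<le> decay ^ m}"

lemma closed_regular: "closed (regular m0)"
  unfolding regular_def
  by (intro closed_Collect_all closed_Collect_imp closed_Collect_le continuous_intros) auto

text \<open>On regular sequences, convergence of all coordinates already is convergence in the weak Whitney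
  topology. This replaces compactness.\<close>

lemma closed_image:
  fixes F :: "('m \<Rightarrow> real ^ 'k) set"
  assumes F: "closedin (weak_Whitney M n \<A> r) F"
  shows "closed ((\<lambda>f l. coordinate l f) ` F \<inter> regular (m0 :: nat \<Rightarrow> nat list \<Rightarrow> 'k \<Rightarrow> nat))"
  unfolding closed_sequential_limits
proof (intro allI impI, elim conjE)
  fix v and v' :: "nat \<Rightarrow> real"
  assume v: "\<forall>j. v j \<in> (\<lambda>f l. coordinate l f) ` F \<inter> regular m0" and lim: "v \<longlonglongrightarrow> v'"
  have "\<forall>j. \<exists>f. f \<in> F \<and> v j = (\<lambda>l. coordinate l f)" using v by blast
  then obtain g where g: "\<And>j. g j \<in> F" "\<And>j. v j = (\<lambda>l. coordinate l (g j))" by metis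
  have gC: "g j \<in> Cr_space M n \<A> r" for j
    using closedin_subset[OF F] g(1) by auto
  have vlim: "(\<lambda>j. coordinate l (g j)) \<longlonglongrightarrow> v' l" for l
    using lim unfolding tendsto_fun_iff g(2) by blast
  have "\<exists>h\<in>Cr_space M n \<A> r. \<forall>c\<in>\<A>. \<forall>is\<in>directions n r. \<forall>C. compact C \<longrightarrow> C \<subseteq> chart_image c \<longrightarrow>
    uniform_limit C (\<lambda>j. iter_partial (chart_image c) is (in_chart c (g j)))
      (iter_partial (chart_image c) is (in_chart c h)) sequentially"
  proof (rule Cr_space_limit[OF covering good gC])
    fix p "is" assume p: "p \<in> \<P>" and i: "is \<in> directions n r"
    obtain k where k: "valid k" "patch k = p" using patch_surj[OF p] by blast
    show "uniformly_convergent_on (pcube n p) (\<lambda>j. iter_partial (chart_image (pchart p)) is (in_chart (pchart p) (g j)))"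
      unfolding pcube_def
    proof (rule grid_convergence[where ?m0.0="m0 k is"])
      show "plow p l < phigh p l" if "l < n" for l using valid_side[OF k(1) that] k(2) by simp
      show "continuous_on (cube n (plow p) (phigh p)) (iter_partial (chart_image (pchart p)) is (in_chart (pchart p) (g j)))" for j
        using Cr_with_continuous[OF patch_Cr_with[OF good[OF p] gC] i] by (simp add: pcube_def)
      fix i' :: 'k and m z l and j
      assume m: "m0 k is i' \<le> m" and z: "(z, l) \<in> steps n m"
      have "v j \<in> regular m0" using v by blast
      then have "\<bar>v j (to_nat (k, is, i', m, step_to z l)) - v j (to_nat (k, is, i', m, z))\<bar> \<le> decay ^ m"
        using m z i k(1) unfolding regular_def by blast
      moreover have "ok (k, is, i', m, step_to z l)" "ok (k, is, i', m, z)"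
        using step_to_grids[OF z] z k(1) i by (auto simp: ok_def steps_def)
      ultimately show "\<bar>iter_partial (chart_image (pchart p)) is (in_chart (pchart p) (g j)) (gridpt n (plow p) (phigh p) m (step_to z l)) $ i' -
          iter_partial (chart_image (pchart p)) is (in_chart (pchart p) (g j)) (gridpt n (plow p) (phigh p) m z) $ i'\<bar> \<le> decay ^ m"
        by (simp add: g(2) coordinate_to_nat functional_def deriv_at_def k(2))
    next
      fix m z and i' :: 'k assume "z \<in> grids n m"
      then have "ok (k, is, i', m, z)" using k(1) i by (simp add: ok_def)
      then show "convergent (\<lambda>j. iter_partial (chart_image (pchart p)) is (in_chart (pchart p) (g j)) (gridpt n (plow p) (phigh p) m z) $ i')"
        using vlim[of "to_nat (k, is, i', m, z)"]
        by (intro convergentI) (simp add: coordinate_to_nat functional_def deriv_at_def k(2))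
    qed
  qed
  then obtain h where h: "h \<in> Cr_space M n \<A> r"
    and hl: "\<forall>c\<in>\<A>. \<forall>is\<in>directions n r. \<forall>C. compact C \<longrightarrow> C \<subseteq> chart_image c \<longrightarrow>
    uniform_limit C (\<lambda>j. iter_partial (chart_image c) is (in_chart c (g j)))
      (iter_partial (chart_image c) is (in_chart c h)) sequentially"
    by (elim bexE)
  note hlim = hl[rule_format]
  have "limitin (weak_Whitney M n \<A> r) g h sequentially"
    unfolding weak_Whitney_def
  proof (rule limitin_uniform_on_topology[OF gC h])
    fix D C
    assume "(D, C) \<in> {(\<lambda>f :: 'm \<Rightarrow> real ^ 'k. iter_partial (chart_image c) is (in_chart c f), C) | c is C.
        c \<in> \<A> \<and> is \<in> directions n r \<and> compact C \<and> C \<subseteq> chart_image c}"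
    then obtain c "is" where D: "D = (\<lambda>f. iter_partial (chart_image c) is (in_chart c f))"
      and c: "c \<in> \<A>" "is \<in> directions n r" "compact C" "C \<subseteq> chart_image c"
      by (elim CollectE exE conjE Pair_inject) simp
    show "uniform_limit C (\<lambda>j. D (g j)) (D h) sequentially"
      unfolding D by (rule hlim[OF c])
    show "compact C" by (rule c)
    fix f :: "'m \<Rightarrow> real ^ 'k" assume "f \<in> Cr_space M n \<A> r"
    then have "continuous_on (chart_image c) (D f)"
      using c unfolding D Cr_space_def Cr_on_def by blast
    then show "continuous_on C (D f)" using c(4) by (rule continuous_on_subset)
  qed
  then have "h \<in> F" by (rule limitin_closedin[OF _ F]) (use g(1) in auto)
  moreover have "v' = (\<lambda>l. coordinate l h)"
  proof
    fix l
    have "(\<lambda>j. coordinate l (g j)) \<longlonglongrightarrow> coordinate l h"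
    proof (cases "ok (from_nat l :: 'k site)")
      case True
      obtain k "is" i m z where e: "(from_nat l :: 'k site) = (k, is, i, m, z)"
        by (rule prod_cases5)
      have okk: "valid k" "is \<in> directions n r" "z \<in> grids n m" using True by (auto simp: e ok_def)
      have "(\<lambda>j. iter_partial (chart_image (ch k)) is (in_chart (ch k) (g j)) (gp k m z)) \<longlonglongrightarrow>
          iter_partial (chart_image (ch k)) is (in_chart (ch k) h) (gp k m z)"
        by (rule tendsto_uniform_limitI[OF hlim[OF valid_chart[OF okk(1)] okk(2), of "{gp k m z}"]])
           (use gp_chart okk in auto)
      then show ?thesis
        using True by (simp add: coordinate_def functional_def e deriv_at_def tendsto_vec_nth)
    qed (simp add: coordinate_def functional_def)
    then show "v' l = coordinate l h" using vlim LIMSEQ_unique by blast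
  qed
  moreover have "v' \<in> regular m0"
    using closed_sequentially[OF closed_regular _ lim] v by blast
  ultimately show "v' \<in> (\<lambda>f l. coordinate l f) ` F \<inter> regular m0" by blast
qed

text \<open>Coordinates with the empty word are values at grid points, and the grid points are the
  roundings of \<open>q\<close> in one patch. Since \<open>k\<close> and \<open>z\<close> do not
  depend on \<open>f\<close>, the value of a random field at \<open>q\<close> is the limit of one
  fixed sequence of coordinates.\<close>

lemma value_limit:
  assumes q: "q \<in> topspace M"
  shows "\<exists>k z. valid k \<and> q \<in> fst (ch k) \<and> (\<forall>m. z m \<in> grids n m) \<and>
    (\<lambda>m. gp k m (z m)) \<longlonglongrightarrow> snd (ch k) q \<and>
    (\<forall>(f :: 'm \<Rightarrow> real ^ 'k) i. f \<in> Cr_space M n \<A> r \<longrightarrow>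
       (\<lambda>m. coordinate (index k [] i m (z m)) f) \<longlonglongrightarrow> f q $ i)"
proof -
  obtain p where p: "p \<in> \<P>" "q \<in> pnbhd p" using q covering by blast
  obtain k where k: "valid k" "patch k = p" using patch_surj[OF p(1)] by blast
  have qc: "q \<in> fst (ch k)" using p(2) k(2) by (simp add: pnbhd_def)
  let ?x = "snd (ch k) q"
  have x: "?x \<in> pcube n (patch k)" using pnbhd_cube[OF good[OF p(1)] p(2)] k(2) by simp
  define z where "z m = round_down n (plow (patch k)) (phigh (patch k)) m ?x" for m
  have z: "z m \<in> grids n m" for m
    unfolding z_def
    by (rule round_down_grids[OF valid_side[OF k(1)]]) (use x in \<open>simp_all add: pcube_def\<close>)
  have lim: "(\<lambda>m. gp k m (z m)) \<longlonglongrightarrow> ?x"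
    unfolding z_def
    by (rule gridpt_round_down_tendsto[OF valid_side[OF k(1)]]) (use x in \<open>simp_all add: pcube_def\<close>)
  have "(\<lambda>m. coordinate (index k [] i m (z m)) f) \<longlonglongrightarrow> f q $ i"
    if f: "f \<in> Cr_space M n \<A> r" for f :: "'m \<Rightarrow> real ^ 'k" and i
  proof -
    have "continuous_on (pcube n (patch k)) (in_chart (ch k) f)"
      using Cr_with_continuous[OF patch_Cr_with[OF good[OF p(1)] f], of "[]"] k(2) by simp
    then have "(\<lambda>m. in_chart (ch k) f (gp k m (z m))) \<longlonglongrightarrow> in_chart (ch k) f ?x"
      by (rule continuous_on_tendsto_compose[OF _ lim x]) (simp add: gp_cube[OF k(1) z])
    then have "(\<lambda>m. in_chart (ch k) f (gp k m (z m)) $ i) \<longlonglongrightarrow> in_chart (ch k) f ?x $ i"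
      by (rule tendsto_vec_nth)
    moreover have "in_chart (ch k) f ?x = f q"
      using pt_chart[OF valid_chart[OF k(1)] qc] by (simp add: in_chart_eq)
    ultimately show ?thesis
      using k(1) z by (simp add: coordinate_to_nat functional_def ok_def deriv_at_def)
  qed
  then show ?thesis using k(1) qc z lim by (intro exI[of _ k] exI[of _ z]) simp
qed

lemma coordinate_inj:
  fixes f g :: "'m \<Rightarrow> real ^ 'k"
  assumes f: "f \<in> Cr_space M n \<A> r" and g: "g \<in> Cr_space M n \<A> r"
    and eq: "\<And>l. coordinate l f = coordinate l g"
  shows "f = g"
proof (rule extensionalityI)
  show "f \<in> extensional (topspace M)" "g \<in> extensional (topspace M)"
    using f g by (auto simp: Cr_space_def)
  fix q assume q: "q \<in> topspace M"
  obtain k z where "\<forall>(f :: 'm \<Rightarrow> real ^ 'k) i. f \<in> Cr_space M n \<A> r \<longrightarrow>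
      (\<lambda>m. coordinate (index k [] i m (z m)) f) \<longlonglongrightarrow> f q $ i"
    using value_limit[where 'k='k, OF q] by (elim exE conjE) (rule that, assumption)
  note this[rule_format]
  from this[OF f] this[OF g] have "f q $ i = g q $ i" for i
    unfolding eq using LIMSEQ_unique by blast
  then show "f q = g q" by (simp add: vec_eq_iff)
qed

text \<open>Evaluating a derivative at a point is continuous, because the singleton
  \<open>{x}\<close> is one of the compact sets in the definition of the topology.\<close>

lemma deriv_at_measurable:
  assumes c: "c \<in> \<A>" and i: "is \<in> directions n r" and x: "x \<in> chart_image c"
  shows "deriv_at c is i x \<in> borel_measurable (borel_of (weak_Whitney M n \<A> r :: ('m \<Rightarrow> real ^ 'k) topology))"
proof (rule borel_measurableI)
  let ?T = "weak_Whitney M n \<A> r :: ('m \<Rightarrow> real ^ 'k) topology"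
  let ?D = "\<lambda>f. iter_partial (chart_image c) is (in_chart c f)"
  fix S :: "real set" assume S: "open S"
  have "openin ?T (deriv_at c is i x -` S \<inter> space (borel_of ?T))"
  proof (subst openin_subopen, rule ballI)
    fix f assume f: "f \<in> deriv_at c is i x -` S \<inter> space (borel_of ?T)"
    then have "f \<in> Cr_space M n \<A> r" "?D f x $ i \<in> S" by (auto simp: deriv_at_def)
    then obtain e where e: "e > 0" "\<And>t. \<bar>t - ?D f x $ i\<bar> < e \<Longrightarrow> t \<in> S"
      using S unfolding open_dist dist_real_def by blast
    let ?U = "{g \<in> Cr_space M n \<A> r. \<forall>y\<in>{x}. norm (?D g y - ?D f y) < e}"
    have "openin ?T ?U"
      unfolding weak_Whitney_def uniform_on_topology_def
    proof (rule topology_generated_by_Basis, rule insertI2, rule CollectI)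
      show "\<exists>f' D C e'. ?U = {g \<in> Cr_space M n \<A> r. \<forall>x\<in>C. norm (D g x - D f' x) < e'} \<and> f' \<in> Cr_space M n \<A> r \<and>
          (D, C) \<in> {(\<lambda>f :: 'm \<Rightarrow> real ^ 'k. iter_partial (chart_image c) is (in_chart c f), C) | c is C.
            c \<in> \<A> \<and> is \<in> directions n r \<and> compact C \<and> C \<subseteq> chart_image c} \<and> 0 < e'"
        using \<open>f \<in> Cr_space M n \<A> r\<close> e(1) c i x
        by (intro exI[of _ f] exI[of _ ?D] exI[of _ "{x}"] exI[of _ e] conjI refl CollectI
              exI[of _ c] exI[of _ "is"]) auto
    qed
    moreover have "f \<in> ?U" using \<open>f \<in> Cr_space M n \<A> r\<close> e(1) by simp
    moreover have "?U \<subseteq> deriv_at c is i x -` S \<inter> space (borel_of ?T)"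
    proof
      fix g assume g: "g \<in> ?U"
      have "\<bar>(?D g x - ?D f x) $ i\<bar> \<le> norm (?D g x - ?D f x)" by (rule component_le_norm_cart)
      then have "\<bar>?D g x $ i - ?D f x $ i\<bar> < e" using g by simp
      then show "g \<in> deriv_at c is i x -` S \<inter> space (borel_of ?T)"
        using e(2) g by (simp add: deriv_at_def)
    qed
    ultimately show "\<exists>U. openin ?T U \<and> f \<in> U \<and> U \<subseteq> deriv_at c is i x -` S \<inter> space (borel_of ?T)"
      by blast
  qed
  then show "deriv_at c is i x -` S \<inter> space (borel_of ?T) \<in> sets (borel_of ?T)"
    by (rule openin_borel_of)
qed

lemma coordinate_measurable:
  "coordinate l \<in> borel_measurable (borel_of (weak_Whitney M n \<A> r :: ('m \<Rightarrow> real ^ 'k) topology))"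
proof (cases "ok (from_nat l :: 'k site)")
  case True
  obtain k "is" i m z where e: "(from_nat l :: 'k site) = (k, is, i, m, z)"
    by (rule prod_cases5)
  have okk: "valid k" "is \<in> directions n r" "z \<in> grids n m" using True by (auto simp: e ok_def)
  have "coordinate l = deriv_at (ch k) is i (gp k m z)"
    using True by (simp add: fun_eq_iff coordinate_def functional_def e)
  then show ?thesis using deriv_at_measurable valid_chart gp_chart okk by metis
next
  case False
  then have "coordinate l = (\<lambda>_ :: 'm \<Rightarrow> real ^ 'k. 0)" by (simp add: fun_eq_iff coordinate_def functional_def)
  then show ?thesis by simp
qed

end

section \<open>Derivatives of a Gaussian field\<close>

lemma has_vector_derivative_vec:
  fixes f :: "real \<Rightarrow> 'b::real_normed_vector ^ 'k"
  assumes "\<And>i. ((\<lambda>t. f t $ i) has_vector_derivative D $ i) (at x within S)"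
  shows "(f has_vector_derivative D) (at x within S)"
  unfolding has_vector_derivative_iff_quotient
  by (rule vec_tendstoI) (use assms in \<open>simp add: has_vector_derivative_iff_quotient\<close>)

lemma limitin_uniform_on_topologyD:
  assumes lim: "limitin (uniform_on_topology S \<D>) g h sequentially" and D: "(D, C) \<in> \<D>"
  shows "uniform_limit C (\<lambda>j. D (g j)) (D h) sequentially"
proof (rule uniform_limitI)
  fix e :: real assume e: "e > 0"
  have h: "h \<in> S" using limitin_topspace[OF lim] by simp
  let ?U = "{f \<in> S. \<forall>x\<in>C. norm (D f x - D h x) < e}"
  have "openin (uniform_on_topology S \<D>) ?U"
    unfolding uniform_on_topology_def
  proof (rule topology_generated_by_Basis, rule insertI2, rule CollectI)
    show "\<exists>f D' C' e'. ?U = {g \<in> S. \<forall>x\<in>C'. norm (D' g x - D' f x) < e'} \<and> f \<in> S \<and> (D', C') \<in> \<D> \<and> 0 < e'"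
      using h D e by (intro exI[of _ h] exI[of _ D] exI[of _ C] exI[of _ e]) simp
  qed
  moreover have "h \<in> ?U" using h e by simp
  ultimately have "\<forall>\<^sub>F j in sequentially. g j \<in> ?U" using lim unfolding limitin_def by blast
  then show "\<forall>\<^sub>F j in sequentially. \<forall>x\<in>C. dist (D (g j) x) (D h x) < e"
    by (rule eventually_mono) (simp add: dist_norm)
qed

text \<open>The limit bounds all large \<open>d\<close> at once, compactness bounds the remaining
  finitely many one by one. The start at \<open>N\<close> reflects that continuity is available only
  from there on.\<close>

lemma uniform_limit_bounded_tail:
  fixes f :: "nat \<Rightarrow> 'a::topological_space \<Rightarrow> 'b::real_normed_vector"
  assumes lim: "uniform_limit C f h sequentially" and C: "compact C"
    and cont: "continuous_on C h" "\<And>d. d \<ge> N \<Longrightarrow> continuous_on C (f d)"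
  shows "\<exists>B\<ge>0. \<forall>d\<ge>N. \<forall>x\<in>C. norm (f d x) \<le> B"
proof -
  have bd: "\<exists>B. \<forall>x\<in>C. norm (g x) \<le> B" if "continuous_on C g" for g :: "'a \<Rightarrow> 'b"
    using compact_imp_bounded[OF compact_continuous_image[OF that C]] by (auto simp: bounded_iff)
  obtain B0 where B0: "\<forall>x\<in>C. norm (h x) \<le> B0" using bd[OF cont(1)] by blast
  have "\<forall>\<^sub>F d in sequentially. \<forall>x\<in>C. dist (f d x) (h x) < 1"
    by (rule uniform_limitD[OF lim]) simp
  then obtain N1 where N1: "\<And>d. d \<ge> N1 \<Longrightarrow> \<forall>x\<in>C. dist (f d x) (h x) < 1"
    by (auto simp: eventually_sequentially)
  have "\<forall>d. \<exists>B. d \<ge> N \<longrightarrow> (\<forall>x\<in>C. norm (f d x) \<le> B)" using bd cont(2) by blast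
  then obtain B where B: "\<And>d. d \<ge> N \<Longrightarrow> \<forall>x\<in>C. norm (f d x) \<le> B d" by metis
  define B' where "B' = Max (insert 0 (insert (B0 + 1) (B ` {..<N1})))"
  have "norm (f d x) \<le> B'" if "d \<ge> N" "x \<in> C" for d x
  proof (cases "d < N1")
    case True
    then have "B d \<le> B'" unfolding B'_def by (intro Max_ge) auto
    then show ?thesis using B[OF that(1)] that(2) by force
  next
    case False
    then have "dist (f d x) (h x) < 1" using N1[of d] that by simp
    then have "norm (f d x) \<le> norm (h x) + 1"
      using norm_triangle_ineq2[of "f d x" "h x"] by (simp add: dist_norm)
    also have "\<dots> \<le> B0 + 1" using B0 that by simp
    also have "\<dots> \<le> B'" unfolding B'_def by (intro Max_ge) auto
    finally show ?thesis .
  qed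
  moreover have "B' \<ge> 0" unfolding B'_def by (intro Max_ge) auto
  ultimately show ?thesis by blast
qed

definition point_span :: "'m topology \<Rightarrow> ('w \<Rightarrow> 'm \<Rightarrow> real ^ 'k) \<Rightarrow> ('w \<Rightarrow> real) set" where
  "point_span M X = {Y. \<exists>F a. finite F \<and> F \<subseteq> topspace M \<and> Y = (\<lambda>\<omega>. \<Sum>p\<in>F. a p \<bullet> X \<omega> p)}"

definition limit_span :: "'m topology \<Rightarrow> 'w measure \<Rightarrow> ('w \<Rightarrow> 'm \<Rightarrow> real ^ 'k) \<Rightarrow> nat \<Rightarrow> ('w \<Rightarrow> real) set" where
  "limit_span M P X m = (pointwise_limits P ^^ m) (point_span M X)"

text \<open>One Gaussian space for derivatives of all orders up to \<open>r\<close>, so that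
  covariances between different orders make sense; derivatives of order \<open>m\<close> appear at
  stage \<open>m\<close>.\<close>

definition field_space :: "'m topology \<Rightarrow> 'w measure \<Rightarrow> ('w \<Rightarrow> 'm \<Rightarrow> real ^ 'k) \<Rightarrow> ('w \<Rightarrow> real) set" where
  "field_space M P X = (\<Union>m. limit_span M P X m)"

text \<open>For sums, the coefficients over two finite sets of points are padded with zeros to their
  union.\<close>

lemma gaussian_space_point_span:
  assumes X: "gaussian_random_field M n \<A> r P X"
  shows "gaussian_space P (point_span M X)"
  unfolding gaussian_space_def
proof (intro conjI ballI allI)
  fix Y assume "Y \<in> point_span M X"
  then show "centered_gaussian_rv P Y"
    using X unfolding point_span_def gaussian_random_field_def centered_gaussian_vector_def by blast
next
  fix Y Z assume "Y \<in> point_span M X" "Z \<in> point_span M X"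
  then obtain F a G b where F: "finite F" "F \<subseteq> topspace M" "Y = (\<lambda>\<omega>. \<Sum>p\<in>F. a p \<bullet> X \<omega> p)"
    and G: "finite G" "G \<subseteq> topspace M" "Z = (\<lambda>\<omega>. \<Sum>p\<in>G. b p \<bullet> X \<omega> p)"
    unfolding point_span_def by blast
  let ?a = "\<lambda>p. if p \<in> F then a p else 0" and ?b = "\<lambda>p. if p \<in> G then b p else 0"
  have "Y \<omega> = (\<Sum>p\<in>F \<union> G. ?a p \<bullet> X \<omega> p)" for \<omega>
    unfolding F(3) by (rule sum.mono_neutral_cong_left) (use F(1) G(1) in auto)
  moreover have "Z \<omega> = (\<Sum>p\<in>F \<union> G. ?b p \<bullet> X \<omega> p)" for \<omega>
    unfolding G(3) by (rule sum.mono_neutral_cong_left) (use F(1) G(1) in auto)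
  ultimately have "(\<lambda>\<omega>. Y \<omega> + Z \<omega>) = (\<lambda>\<omega>. \<Sum>p\<in>F \<union> G. (?a p + ?b p) \<bullet> X \<omega> p)"
    by (simp only: inner_add_left sum.distrib)
  then show "(\<lambda>\<omega>. Y \<omega> + Z \<omega>) \<in> point_span M X"
    unfolding point_span_def using F(1,2) G(1,2)
    by (intro CollectI exI[of _ "F \<union> G"] exI[of _ "\<lambda>p. ?a p + ?b p"]) simp
next
  fix Y and c :: real assume "Y \<in> point_span M X"
  then obtain F a where F: "finite F" "F \<subseteq> topspace M" "Y = (\<lambda>\<omega>. \<Sum>p\<in>F. a p \<bullet> X \<omega> p)"
    unfolding point_span_def by blast
  then have "(\<lambda>\<omega>. c * Y \<omega>) = (\<lambda>\<omega>. \<Sum>p\<in>F. (c *\<^sub>R a p) \<bullet> X \<omega> p)"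
    by (simp add: sum_distrib_left)
  then show "(\<lambda>\<omega>. c * Y \<omega>) \<in> point_span M X"
    unfolding point_span_def using F(1,2) by (intro CollectI exI[of _ F] exI[of _ "\<lambda>p. c *\<^sub>R a p"]) simp
qed

lemma gaussian_space_limit_span:
  assumes X: "gaussian_random_field M n \<A> r P X"
  shows "gaussian_space P (limit_span M P X m)"
proof (induction m)
  case 0
  then show ?case using gaussian_space_point_span[OF X] by (simp add: limit_span_def)
next
  case (Suc m)
  have "prob_space P" using X by (simp add: gaussian_random_field_def)
  from gaussian_space_limits[OF this Suc] show ?case by (simp add: limit_span_def)
qed

lemma gaussian_space_field_space:
  assumes X: "gaussian_random_field M n \<A> r P X"
  shows "gaussian_space P (field_space M P X)"
  unfolding field_space_def
  by (rule gaussian_space_UN[OF gaussian_space_limit_span[OF X]])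
     (simp add: limit_span_def pointwise_limits_subset)

lemma value_in_point_span: "q \<in> topspace M \<Longrightarrow> (\<lambda>\<omega>. X \<omega> q $ i) \<in> point_span M X"
  unfolding point_span_def
  by (intro CollectI exI[of _ "{q}"] exI[of _ "\<lambda>_. axis i 1"]) (simp add: inner_axis')

section \<open>Derivatives of a field and their covariances\<close>

context patched_mfd
begin

lemma deriv_at_quotient_tendsto:
  fixes f :: "'m \<Rightarrow> real ^ 'k"
  assumes f: "f \<in> Cr_space M n \<A> r" and c: "c \<in> \<A>" and li: "l # is \<in> directions n r" and x: "x \<in> chart_image c"
    and t: "\<And>j::nat. t j \<in> {t. x(l := t) \<in> chart_image c} - {x l}" "t \<longlonglongrightarrow> x l"
  shows "(\<lambda>j. inverse (t j - x l) * (deriv_at c is i (x(l := t j)) f - deriv_at c is i x f)) \<longlonglongrightarrow> deriv_at c (l # is) i x f"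
proof -
  have "Cr_on n r (chart_image c) (in_chart c f)" using f c by (simp add: Cr_space_def)
  from Cr_with_deriv[OF Cr_onD[OF this] li x]
  have "((\<lambda>s. (iter_partial (chart_image c) is (in_chart c f) (x(l := s)) - iter_partial (chart_image c) is (in_chart c f) (x(l := x l))) /\<^sub>R (s - x l)) \<longlongrightarrow>
      iter_partial (chart_image c) (l # is) (in_chart c f) x) (at (x l) within {t. x(l := t) \<in> chart_image c})"
    unfolding has_vector_derivative_iff_quotient .
  moreover have "filterlim t (at (x l) within {t. x(l := t) \<in> chart_image c}) sequentially"
    unfolding filterlim_at using t by (auto intro!: always_eventually)
  ultimately have "(\<lambda>j. (iter_partial (chart_image c) is (in_chart c f) (x(l := t j)) - iter_partial (chart_image c) is (in_chart c f) (x(l := x l))) /\<^sub>R (t j - x l)) \<longlonglongrightarrow>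
      iter_partial (chart_image c) (l # is) (in_chart c f) x"
    by (rule filterlim_compose)
  from tendsto_vec_nth[OF this, of i] show ?thesis
    by (simp add: deriv_at_def)
qed

lemma field_in_Cr_space:
  "gaussian_random_field M n \<A> r P X \<Longrightarrow> \<omega> \<in> space P \<Longrightarrow> X \<omega> \<in> Cr_space M n \<A> r"
  unfolding gaussian_random_field_def using measurable_space[of X P "borel_of (weak_Whitney M n \<A> r)" \<omega>] by simp

text \<open>Each letter of the word costs one passage to the limit of difference quotients. The
  parameters \<open>t j\<close> come from thickness of the chart image and do not depend on
  \<omega>.\<close>

lemma deriv_in_limit_span:
  assumes X: "gaussian_random_field M n \<A> r P X" and c: "c \<in> \<A>"
  shows "is \<in> directions n r \<Longrightarrow> x \<in> chart_image c \<Longrightarrow>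
    (\<lambda>\<omega>. deriv_at c is i x (X \<omega>)) \<in> limit_span M P X (length is)"
proof (induction "is" arbitrary: x)
  case Nil
  have "pt c x \<in> topspace M" using pt_image[OF Nil(2)] chart_subset[OF c] by blast
  then show ?case
    using value_in_point_span by (simp add: limit_span_def deriv_at_def in_chart_eq)
next
  case (Cons l "is")
  have l: "l < n" "is \<in> directions n r" using directions_ConsD[OF Cons.prems(1)] by auto
  have "x l islimpt {t. x(l := t) \<in> chart_image c}"
    using chart_thick[OF c] Cons.prems(2) l(1) by (simp add: thick_def)
  then obtain t where t: "\<And>j::nat. t j \<in> {t. x(l := t) \<in> chart_image c} - {x l}" "t \<longlonglongrightarrow> x l"
    unfolding islimpt_sequential by blast
  let ?Y = "\<lambda>j \<omega>. inverse (t j - x l) * (deriv_at c is i (x(l := t j)) (X \<omega>) - deriv_at c is i x (X \<omega>))"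
  have xt: "x(l := t j) \<in> chart_image c" for j using t(1)[of j] by simp
  have "?Y j \<in> limit_span M P X (length is)" for j
    by (rule gaussian_space_scale[OF gaussian_space_limit_span[OF X]
        gaussian_space_diff[OF gaussian_space_limit_span[OF X] Cons.IH[OF l(2) xt] Cons.IH[OF l(2) Cons.prems(2)]]])
  moreover have "(\<lambda>j. ?Y j \<omega>) \<longlonglongrightarrow> deriv_at c (l # is) i x (X \<omega>)" if "\<omega> \<in> space P" for \<omega>
    by (rule deriv_at_quotient_tendsto[OF field_in_Cr_space[OF X that] c Cons.prems t])
  ultimately have "(\<lambda>\<omega>. deriv_at c (l # is) i x (X \<omega>)) \<in> pointwise_limits P (limit_span M P X (length is))"
    unfolding pointwise_limits_def by (intro CollectI exI[of _ ?Y]) blast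
  then show ?case by (simp add: limit_span_def)
qed

lemma deriv_in_field_space:
  assumes "gaussian_random_field M n \<A> r P X" "c \<in> \<A>" "is \<in> directions n r" "x \<in> chart_image c"
  shows "(\<lambda>\<omega>. deriv_at c is i x (X \<omega>)) \<in> field_space M P X"
  unfolding field_space_def using deriv_in_limit_span[OF assms] by blast

text \<open>Differentiation under the expectation: the difference quotients converge at every sample
  point and stay in a Gaussian space, so \<open>gaussian_cov_lim\<close> replaces
  domination.\<close>

lemma cov_line_deriv:
  assumes X: "gaussian_random_field M n \<A> r P X" and c: "c \<in> \<A>" and li: "l # is \<in> directions n r"
    and x: "x \<in> chart_image c" and W: "W \<in> field_space M P X"
  shows "((\<lambda>t. \<integral>\<omega>. deriv_at c is i (x(l := t)) (X \<omega>) * W \<omega> \<partial>P) has_vector_derivative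
    (\<integral>\<omega>. deriv_at c (l # is) i x (X \<omega>) * W \<omega> \<partial>P)) (at (x l) within {t. x(l := t) \<in> chart_image c})"
  unfolding has_vector_derivative_iff_quotient tendsto_at_iff_sequentially
proof (intro allI impI)
  fix t :: "nat \<Rightarrow> real"
  assume t: "\<forall>j. t j \<in> {t. x(l := t) \<in> chart_image c} - {x l}" "t \<longlonglongrightarrow> x l"
  have P: "prob_space P" using X by (simp add: gaussian_random_field_def)
  note V = gaussian_space_field_space[OF X]
  have l: "l < n" "is \<in> directions n r" using directions_ConsD[OF li] by auto
  let ?Z = "\<lambda>x \<omega>. deriv_at c is i x (X \<omega>)"
  let ?Y = "\<lambda>j \<omega>. inverse (t j - x l) * (?Z (x(l := t j)) \<omega> - ?Z x \<omega>)"
  have ZV: "?Z y \<in> field_space M P X" if "y \<in> chart_image c" for y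
    by (rule deriv_in_field_space[OF X c l(2) that])
  have YV: "?Y j \<in> field_space M P X" for j
    using t(1) x by (intro gaussian_space_scale[OF V] gaussian_space_diff[OF V] ZV) auto
  have int: "integrable P (\<lambda>\<omega>. ?Z y \<omega> * W \<omega>)" if "y \<in> chart_image c" for y
    by (rule gaussian_integrable_mult[OF P gaussian_space_rv[OF V ZV[OF that]] gaussian_space_rv[OF V W]])
  have "(\<integral>\<omega>. ?Y j \<omega> * W \<omega> \<partial>P) =
      ((\<integral>\<omega>. ?Z (x(l := t j)) \<omega> * W \<omega> \<partial>P) - (\<integral>\<omega>. ?Z (x(l := x l)) \<omega> * W \<omega> \<partial>P)) /\<^sub>R (t j - x l)" for j
  proof -
    have xt: "x(l := t j) \<in> chart_image c" using t(1) by auto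
    have "(\<integral>\<omega>. ?Y j \<omega> * W \<omega> \<partial>P) = (\<integral>\<omega>. inverse (t j - x l) * (?Z (x(l := t j)) \<omega> * W \<omega> - ?Z x \<omega> * W \<omega>) \<partial>P)"
      by (intro Bochner_Integration.integral_cong refl) (simp add: algebra_simps)
    also have "\<dots> = inverse (t j - x l) * ((\<integral>\<omega>. ?Z (x(l := t j)) \<omega> * W \<omega> \<partial>P) - (\<integral>\<omega>. ?Z x \<omega> * W \<omega> \<partial>P))"
      by (simp only: integral_mult_right_zero Bochner_Integration.integral_diff[OF int[OF xt] int[OF x]])
    finally show ?thesis by simp
  qed
  moreover have "(\<lambda>j. \<integral>\<omega>. ?Y j \<omega> * W \<omega> \<partial>P) \<longlonglongrightarrow> (\<integral>\<omega>. deriv_at c (l # is) i x (X \<omega>) * W \<omega> \<partial>P)"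
  proof (rule gaussian_cov_lim[OF P V YV deriv_in_field_space[OF X c li x] W])
    show "(\<lambda>j. ?Y j \<omega>) \<longlonglongrightarrow> deriv_at c (l # is) i x (X \<omega>)" if "\<omega> \<in> space P" for \<omega>
      by (rule deriv_at_quotient_tendsto[OF field_in_Cr_space[OF X that] c li x _ t(2)]) (use t(1) in blast)
  qed
  ultimately show "((\<lambda>s. ((\<integral>\<omega>. ?Z (x(l := s)) \<omega> * W \<omega> \<partial>P) - (\<integral>\<omega>. ?Z (x(l := x l)) \<omega> * W \<omega> \<partial>P)) /\<^sub>R (s - x l)) \<circ> t)
      \<longlonglongrightarrow> (\<integral>\<omega>. deriv_at c (l # is) i x (X \<omega>) * W \<omega> \<partial>P)"
    by (simp add: comp_def)
qed

lemma in_charts_eq: "in_charts c c' K (x, y) = K (pt c x, pt c' y)"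
  by (simp add: in_charts_def split: prod.split)

text \<open>Line derivatives of the covariances are given by \<open>cov_line_deriv\<close> and
  identified by \<open>iter_partial_lines\<close>, first in \<open>y\<close> and then in
  \<open>x\<close>, as in \<open>mixed_partial\<close>. The orders stay at most \<open>r\<close>,
  where the field itself is differentiable.\<close>

lemma mixed_partial_covariance:
  fixes X :: "'w \<Rightarrow> 'm \<Rightarrow> real ^ 'k"
  assumes X: "gaussian_random_field M n \<A> r P X" and c: "c \<in> \<A>" "c' \<in> \<A>"
    and i: "is \<in> directions n r" "js \<in> directions n r" and x: "x \<in> chart_image c" and y: "y \<in> chart_image c'"
  shows "mixed_partial (chart_image c) (chart_image c') is js (in_charts c c' (covariance_function M P X)) (x, y) =
    (\<chi> i j. \<integral>\<omega>. deriv_at c is i x (X \<omega>) * deriv_at c' js j y (X \<omega>) \<partial>P)"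
proof -
  let ?K = "in_charts c c' (covariance_function M P X)"
  have K: "?K (x, y) = (\<chi> i j. \<integral>\<omega>. deriv_at c [] i x (X \<omega>) * deriv_at c' [] j y (X \<omega>) \<partial>P)"
    if "x \<in> chart_image c" "y \<in> chart_image c'" for x y
  proof -
    have "pt c x \<in> topspace M" "pt c' y \<in> topspace M"
      using that pt_image chart_subset c by blast+
    then show ?thesis by (simp add: in_charts_eq covariance_function_def deriv_at_def in_chart_eq)
  qed
  have Y: "iter_partial (chart_image c') js (\<lambda>y'. ?K (x, y')) y =
      (\<chi> i j. \<integral>\<omega>. deriv_at c [] i x (X \<omega>) * deriv_at c' js j y (X \<omega>) \<partial>P)"
    if x: "x \<in> chart_image c" for x
  proof (rule iter_partial_lines[OF chart_thick[OF c(2)] _ _ i(2) y])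
    show "(\<chi> i j. \<integral>\<omega>. deriv_at c [] i x (X \<omega>) * deriv_at c' [] j y (X \<omega>) \<partial>P) = ?K (x, y)"
      if "y \<in> chart_image c'" for y using K[OF x that] by simp
    show "((\<lambda>t. \<chi> i j. \<integral>\<omega>. deriv_at c [] i x (X \<omega>) * deriv_at c' js j (y(l := t)) (X \<omega>) \<partial>P) has_vector_derivative
        (\<chi> i j. \<integral>\<omega>. deriv_at c [] i x (X \<omega>) * deriv_at c' (l # js) j y (X \<omega>) \<partial>P))
        (at (y l) within {t. y(l := t) \<in> chart_image c'})"
      if "l # js \<in> directions n r" "y \<in> chart_image c'" for l js y
      using cov_line_deriv[OF X c(2) that deriv_in_field_space[OF X c(1) _ x, of "[]"]]
      by (intro has_vector_derivative_vec) (simp add: mult.commute)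
  qed
  have "iter_partial (chart_image c) is (\<lambda>x'. iter_partial (chart_image c') js (\<lambda>y'. ?K (x', y')) y) x =
      (\<chi> i j. \<integral>\<omega>. deriv_at c is i x (X \<omega>) * deriv_at c' js j y (X \<omega>) \<partial>P)"
  proof (rule iter_partial_lines[OF chart_thick[OF c(1)] _ _ i(1) x])
    show "(\<chi> i j. \<integral>\<omega>. deriv_at c [] i x (X \<omega>) * deriv_at c' js j y (X \<omega>) \<partial>P) =
        iter_partial (chart_image c') js (\<lambda>y'. ?K (x, y')) y"
      if "x \<in> chart_image c" for x using Y[OF that] by simp
    show "((\<lambda>t. \<chi> i j. \<integral>\<omega>. deriv_at c is i (x(l := t)) (X \<omega>) * deriv_at c' js j y (X \<omega>) \<partial>P) has_vector_derivative
        (\<chi> i j. \<integral>\<omega>. deriv_at c (l # is) i x (X \<omega>) * deriv_at c' js j y (X \<omega>) \<partial>P))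
        (at (x l) within {t. x(l := t) \<in> chart_image c})"
      if "l # is \<in> directions n r" "x \<in> chart_image c" for l "is" x
      using cov_line_deriv[OF X c(1) that deriv_in_field_space[OF X c(2) i(2) y]]
      by (intro has_vector_derivative_vec) simp
  qed
  then show ?thesis by (simp add: mixed_partial_def)
qed

lemma directions_extra: "is \<in> directions n r \<Longrightarrow> l < n \<Longrightarrow> l # is \<in> directions n (r + 2)"
  unfolding directions_def by (cases r) (auto simp: numeral_eq_enat)

lemma directions_add: "is \<in> directions n r \<Longrightarrow> is \<in> directions n (r + 2)"
  unfolding directions_def by (cases r) (auto simp: numeral_eq_enat)

text \<open>Only one derivative in \<open>x\<close> beyond order \<open>r\<close> is used: both differences below are taken in \<open>x\<close>.\<close>

lemma step_variance:
  fixes X :: "'w \<Rightarrow> 'm \<Rightarrow> real ^ 'k"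
  assumes X: "gaussian_random_field M n \<A> r P X" and k: "valid k" and i: "is \<in> directions n r"
    and K: "covariance_function M P X \<in> Css_space M n \<A> (r + 2)"
    and bound: "\<And>l u. l < n \<Longrightarrow> u \<in> pcube n (patch k) \<times> pcube n (patch k) \<Longrightarrow>
      norm (mixed_partial (chart_image (ch k)) (chart_image (ch k)) (l # is) is
        (in_charts (ch k) (ch k) (covariance_function M P X)) u) \<le> C"
    and s: "(z, l) \<in> steps n m"
  shows "(\<integral>\<omega>. (deriv_at (ch k) is i (gp k m (step_to z l)) (X \<omega>) - deriv_at (ch k) is i (gp k m z) (X \<omega>))\<^sup>2 \<partial>P)
    \<le> 2 * C * (phigh (patch k) l - plow (patch k) l) / 2 ^ m"
proof -
  let ?c = "ch k" and ?W = "chart_image (ch k)" and ?Q = "pcube n (patch k)"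
  let ?R = "mixed_partial ?W ?W is is (in_charts ?c ?c (covariance_function M P X))"
  let ?R' = "mixed_partial ?W ?W (l # is) is (in_charts ?c ?c (covariance_function M P X))"
  let ?Z = "\<lambda>x \<omega>. deriv_at ?c is i x (X \<omega>)"
  have P: "prob_space P" using X by (simp add: gaussian_random_field_def)
  note V = gaussian_space_field_space[OF X]
  note c = valid_chart[OF k]
  have l: "l < n" and z: "z \<in> grids n m" using s by (auto simp: steps_def)
  define x where "x = gp k m z"
  define h where "h = (phigh (patch k) l - plow (patch k) l) / 2 ^ m"
  define x' where "x' = gp k m (step_to z l)"
  have x'eq: "x' = x(l := x l + h)"
    unfolding x'_def x_def h_def by (rule gridpt_step[OF s])
  have h: "h \<ge> 0" using valid_side[OF k l] by (simp add: h_def)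
  have xQ: "x \<in> ?Q" "x' \<in> ?Q"
    unfolding x_def x'_def by (intro gp_cube k z step_to_grids[OF s])+
  have QW: "y \<in> ?W" if "y \<in> ?Q" for y using that valid_cube[OF k] by blast
  have R: "(\<integral>\<omega>. ?Z u \<omega> * ?Z v \<omega> \<partial>P) = ?R (u, v) $ i $ i" if "u \<in> ?Q" "v \<in> ?Q" for u v
    using mixed_partial_covariance[OF X c c i i QW[OF that(1)] QW[OF that(2)]] by simp
  have Lip: "\<bar>?R (x', y) $ i $ i - ?R (x, y) $ i $ i\<bar> \<le> C * h" if y: "y \<in> ?Q" for y
  proof -
    let ?S = "{plow (patch k) l..phigh (patch k) l}"
    have line: "{t. x(l := t) \<in> ?Q} = ?S"
      unfolding pcube_def by (rule cube_line[OF _ l]) (use xQ in \<open>simp add: pcube_def\<close>)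
    have xt: "x(l := t) \<in> ?Q" if "t \<in> ?S" for t using that line by blast
    have der: "((\<lambda>t. ?R (x(l := t), y)) has_derivative (\<lambda>u. u *\<^sub>R ?R' (x(l := t), y))) (at t within ?S)"
      if t: "t \<in> ?S" for t
    proof -
      \<comment> \<open>This derivative in \<open>x\<close> may have order r + 1, beyond the
        smoothness of the field; it exists by the regularity of the covariance function.\<close>
      have "partial_differentiable ?W l (\<lambda>x. ?R (x, y))"
        using K c i directions_extra[OF i l] directions_add[OF i] QW[OF y]
        unfolding Css_space_def Css_on_def by blast
      then have "(\<lambda>s. ?R (x(l := t, l := s), y)) differentiable at ((x(l := t)) l) within {s. x(l := t, l := s) \<in> ?W}"
        using QW[OF xt[OF t]] unfolding partial_differentiable_def by blast
      then have "((\<lambda>s. ?R (x(l := s), y)) has_vector_derivative partial_deriv ?W l (\<lambda>x. ?R (x, y)) (x(l := t)))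
          (at t within {s. x(l := s) \<in> ?W})"
        unfolding partial_deriv_def vector_derivative_works by simp
      moreover have "partial_deriv ?W l (\<lambda>x. ?R (x, y)) (x(l := t)) = ?R' (x(l := t), y)"
        by (simp add: mixed_partial_def)
      ultimately have "((\<lambda>s. ?R (x(l := s), y)) has_vector_derivative ?R' (x(l := t), y)) (at t within {s. x(l := s) \<in> ?W})"
        by simp
      then have "((\<lambda>s. ?R (x(l := s), y)) has_vector_derivative ?R' (x(l := t), y)) (at t within ?S)"
        by (rule has_vector_derivative_within_subset) (use QW xt in blast)
      then show ?thesis by (simp add: has_vector_derivative_def)
    qed
    have xS: "x l \<in> ?S" "x l + h \<in> ?S"
      using xQ l unfolding x'eq by (auto simp: pcube_def cube_def)
    have "norm (?R (x(l := x l + h), y) - ?R (x(l := x l), y)) \<le> C * norm (x l + h - x l)"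
    proof (rule differentiable_bound[OF _ der])
      show "onorm (\<lambda>u. u *\<^sub>R ?R' (x(l := t), y)) \<le> C" if "t \<in> ?S" for t
      proof (rule onorm_le)
        fix u :: real
        have "norm (?R' (x(l := t), y)) \<le> C" using xt[OF that] y by (intro bound l) simp
        then have "\<bar>u\<bar> * norm (?R' (x(l := t), y)) \<le> \<bar>u\<bar> * C" by (rule mult_left_mono) simp
        then show "norm (u *\<^sub>R ?R' (x(l := t), y)) \<le> C * norm u" by (simp add: mult.commute)
      qed
    qed (use xS in auto)
    then have n: "norm (?R (x', y) - ?R (x, y)) \<le> C * h" using h by (simp add: x'eq)
    have "\<bar>(?R (x', y) - ?R (x, y)) $ i $ i\<bar> \<le> norm ((?R (x', y) - ?R (x, y)) $ i)"
      by (rule component_le_norm_cart)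
    also have "\<dots> \<le> norm (?R (x', y) - ?R (x, y))" by (rule Finite_Cartesian_Product.norm_nth_le)
    finally show ?thesis using n by simp
  qed
  have g: "centered_gaussian_rv P (?Z y)" if "y \<in> ?Q" for y
    by (rule gaussian_space_rv[OF V deriv_in_field_space[OF X c i QW[OF that]]])
  have int: "integrable P (\<lambda>\<omega>. ?Z u \<omega> * ?Z v \<omega>)" if "u \<in> ?Q" "v \<in> ?Q" for u v
    by (rule gaussian_integrable_mult[OF P g[OF that(1)] g[OF that(2)]])
  have "(\<integral>\<omega>. (?Z x' \<omega> - ?Z x \<omega>)\<^sup>2 \<partial>P) =
      (\<integral>\<omega>. (?Z x' \<omega> * ?Z x' \<omega> - ?Z x \<omega> * ?Z x' \<omega>) - (?Z x' \<omega> * ?Z x \<omega> - ?Z x \<omega> * ?Z x \<omega>) \<partial>P)"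
    by (intro Bochner_Integration.integral_cong refl) (simp add: power2_eq_square algebra_simps)
  \<comment> \<open>The variance of an increment is a mixed second difference, grouped here into two
    differences in the first argument, one for each value of the second.\<close>
  also have "\<dots> = (?R (x', x') $ i $ i - ?R (x, x') $ i $ i) - (?R (x', x) $ i $ i - ?R (x, x) $ i $ i)"
    using xQ by (simp only: Bochner_Integration.integral_diff Bochner_Integration.integrable_diff int R)
  also have "\<dots> \<le> 2 * C * h"
    using Lip[OF xQ(1)] Lip[OF xQ(2)] by linarith
  finally show ?thesis by (simp add: x_def x'_def h_def)
qed

end

section \<open>The limit field\<close>

lemma compact_cube: "compact (cube n a b)"
proof -
  have "y \<in> cube n a b \<longleftrightarrow> y \<in> (\<Pi>\<^sub>E l\<in>UNIV. if l < n then {a l..b l} else {0})" for y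
  proof
    assume "y \<in> cube n a b"
    then have "y l \<in> (if l < n then {a l..b l} else {0})" for l
      by (cases "l < n") (simp_all add: cube_def)
    then show "y \<in> (\<Pi>\<^sub>E l\<in>UNIV. if l < n then {a l..b l} else {0})" unfolding PiE_UNIV_domain Pi_iff by blast
  next
    assume "y \<in> (\<Pi>\<^sub>E l\<in>UNIV. if l < n then {a l..b l} else {0})"
    then have y: "y l \<in> (if l < n then {a l..b l} else {0})" for l unfolding PiE_UNIV_domain Pi_iff by blast
    have "a l \<le> y l \<and> y l \<le> b l" if "l < n" for l using y[of l] that by simp
    moreover have "y l = 0" if "l \<ge> n" for l using y[of l] that by simp
    ultimately show "y \<in> cube n a b" by (simp add: cube_def)
  qed
  then have "cube n a b = (\<Pi>\<^sub>E l\<in>UNIV. if l < n then {a l..b l} else {0})" by blast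
  moreover have "compactin (product_topology (\<lambda>_. euclidean) UNIV) (\<Pi>\<^sub>E l\<in>UNIV. if l < n then {a l..b l} else {0})"
    unfolding compactin_PiE by simp
  ultimately show ?thesis by (simp add: euclidean_product_topology)
qed

context patched_mfd
begin

text \<open>Uniform convergence on cubes bounds the mixed partials of the covariances, hence the
  step variances, uniformly in \<open>d\<close>. \<open>chaining_probability\<close> then gives a
  threshold for each triple of patch, word and component, and the failure probabilities are summed
  over all triples.\<close>

lemma tightness:
  fixes X :: "nat \<Rightarrow> 'w \<Rightarrow> 'm \<Rightarrow> real ^ 'k"
  assumes X: "\<And>d. gaussian_random_field M n \<A> r (P d) (X d)"
    and lim: "limitin (Css_topology M n \<A> (r + 2)) (\<lambda>d. covariance_function M (P d) (X d)) K sequentially"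
    and e: "e > 0"
  shows "\<exists>m0 :: nat \<Rightarrow> nat list \<Rightarrow> 'k \<Rightarrow> nat. \<forall>\<^sub>F d in sequentially.
    measure (P d) {\<omega> \<in> space (P d). (\<lambda>l. coordinate l (X d \<omega>)) \<notin> regular m0} \<le> e"
proof -
  let ?cov = "\<lambda>d. covariance_function M (P d) (X d)"
  have KS: "K \<in> Css_space M n \<A> (r + 2)" using limitin_topspace[OF lim] by simp
  have "\<forall>\<^sub>F d in sequentially. ?cov d \<in> Css_space M n \<A> (r + 2)"
  proof -
    have "openin (Css_topology M n \<A> (r + 2)) (Css_space M n \<A> (r + 2) :: ('m \<times> 'm \<Rightarrow> real ^ 'k ^ 'k) set)"
      using openin_topspace[of "Css_topology M n \<A> (r + 2) :: ('m \<times> 'm \<Rightarrow> real ^ 'k ^ 'k) topology"]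
      unfolding topspace_Css_topology .
    then show ?thesis using lim KS unfolding limitin_def by blast
  qed
  \<comment> \<open>This \<open>N\<close> is common to all triples, as a union over infinitely many
    of them is taken for a single \<open>d\<close>.\<close>
  then obtain N where N: "\<forall>d\<ge>N. ?cov d \<in> Css_space M n \<A> (r + 2)"
    unfolding eventually_sequentially by (elim exE)
  note N = N[rule_format]
  let ?S = "\<lambda>d k is (i :: 'k) m0. {\<omega> \<in> space (P d). \<exists>m\<ge>m0. \<exists>(z, l)\<in>steps n m.
      decay ^ m < \<bar>deriv_at (ch k) is i (gp k m (step_to z l)) (X d \<omega>) - deriv_at (ch k) is i (gp k m z) (X d \<omega>)\<bar>}"
  have single: "\<exists>m0. \<forall>d\<ge>N. measure (P d) (?S d k is i m0) \<le> e'"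
    if k: "valid k" and i: "is \<in> directions n r" and e': "e' > 0" for k "is" and i :: 'k and e'
  proof -
    let ?W = "chart_image (ch k)" and ?Q = "pcube n (patch k)"
    let ?M = "\<lambda>l K. mixed_partial ?W ?W (l # is) is (in_charts (ch k) (ch k) K)"
    have "\<forall>l. \<exists>B\<ge>0. l < n \<longrightarrow> (\<forall>d\<ge>N. \<forall>u\<in>?Q \<times> ?Q. norm (?M l (?cov d) u) \<le> B)"
    proof
      fix l
      show "\<exists>B\<ge>0. l < n \<longrightarrow> (\<forall>d\<ge>N. \<forall>u\<in>?Q \<times> ?Q. norm (?M l (?cov d) u) \<le> B)"
      proof (cases "l < n")
        case True
        have QW: "?Q \<times> ?Q \<subseteq> ?W \<times> ?W" using valid_cube[OF k] by blast
        have comp: "compact (?Q \<times> ?Q)" unfolding pcube_def by (intro compact_Times compact_cube)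
        have cont: "continuous_on (?Q \<times> ?Q) (?M l H)" if "H \<in> Css_space M n \<A> (r + 2)" for H
        proof -
          have "continuous_on (?W \<times> ?W) (?M l H)"
            using that valid_chart[OF k] directions_extra[OF i True] directions_add[OF i]
            unfolding Css_space_def Css_on_def by blast
          then show ?thesis using QW by (rule continuous_on_subset)
        qed
        have "uniform_limit (?Q \<times> ?Q) (\<lambda>d. ?M l (?cov d)) (?M l K) sequentially"
        proof (rule limitin_uniform_on_topologyD[OF lim[unfolded Css_topology_def], of "\<lambda>K. ?M l K"])
          show "(\<lambda>K. ?M l K, ?Q \<times> ?Q) \<in> {(\<lambda>K. mixed_partial (chart_image c) (chart_image c') is js (in_charts c c' K), C) | c c' is js C.
            c \<in> \<A> \<and> c' \<in> \<A> \<and> is \<in> directions n (r + 2) \<and> js \<in> directions n (r + 2) \<and>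
            compact C \<and> C \<subseteq> chart_image c \<times> chart_image c'}"
            by (intro CollectI exI[of _ "ch k"] exI[of _ "l # is"] exI[of _ "is"] exI[of _ "?Q \<times> ?Q"] conjI refl
                valid_chart[OF k] directions_extra[OF i True] directions_add[OF i] comp QW)
        qed
        from uniform_limit_bounded_tail[OF this comp cont[OF KS] cont[OF N]] show ?thesis by blast
      qed auto
    qed
    then obtain B where B: "\<And>l. B l \<ge> 0" "\<And>l d u. l < n \<Longrightarrow> d \<ge> N \<Longrightarrow> u \<in> ?Q \<times> ?Q \<Longrightarrow> norm (?M l (?cov d) u) \<le> B l"
      by metis
    \<comment> \<open>One constant for all directions, as \<open>chaining_probability\<close> takes
      a single variance bound; \<open>S\<close> does the same for the side lengths.\<close>
    define C where "C = (\<Sum>l<n. B l)"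
    have BC: "B l \<le> C" if "l < n" for l
      unfolding C_def using B(1) that by (intro member_le_sum) auto
    have C0: "C \<ge> 0" unfolding C_def using B(1) by (intro sum_nonneg) auto
    let ?s = "\<lambda>l. phigh (patch k) l - plow (patch k) l"
    define S where "S = (\<Sum>l<n. ?s l)"
    have sS: "?s l \<le> S" if "l < n" for l
      unfolding S_def using valid_side[OF k] that by (intro member_le_sum) (auto intro: less_imp_le)
    have S0: "S \<ge> 0" unfolding S_def using valid_side[OF k] by (intro sum_nonneg) (auto intro: less_imp_le)
    obtain m0 where m0: "\<forall>(P :: 'w measure) Y. prob_space P \<longrightarrow>
      (\<forall>m z l. (z, l) \<in> steps n m \<longrightarrow>
         centered_gaussian_rv P (\<lambda>\<omega>. Y m (step_to z l) \<omega> - Y m z \<omega>) \<and>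
         (\<integral>\<omega>. (Y m (step_to z l) \<omega> - Y m z \<omega>)\<^sup>2 \<partial>P) \<le> 2 * C * S * (1 / 2) ^ m) \<longrightarrow>
      measure P {\<omega> \<in> space P. \<exists>m\<ge>m0. \<exists>(z, l)\<in>steps n m. decay ^ m < \<bar>Y m (step_to z l) \<omega> - Y m z \<omega>\<bar>} \<le> e'"
      using chaining_probability[of "2 * C * S" e' n, where 'w='w] C0 S0 e' by auto
    have "measure (P d) (?S d k is i m0) \<le> e'" if d: "d \<ge> N" for d
    proof (rule m0[rule_format, of "P d" "\<lambda>m z \<omega>. deriv_at (ch k) is i (gp k m z) (X d \<omega>)"])
      show "prob_space (P d)" using X[of d] by (simp add: gaussian_random_field_def)
      fix m z l assume s: "(z, l) \<in> steps n m"
      then have l: "l < n" and z: "z \<in> grids n m" by (auto simp: steps_def)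
      note V = gaussian_space_field_space[OF X[of d]]
      have "centered_gaussian_rv (P d) (\<lambda>\<omega>. deriv_at (ch k) is i (gp k m (step_to z l)) (X d \<omega>) -
          deriv_at (ch k) is i (gp k m z) (X d \<omega>))"
        by (intro gaussian_space_rv[OF V gaussian_space_diff[OF V]] deriv_in_field_space[OF X valid_chart[OF k] i]
            gp_chart[OF k] z step_to_grids[OF s])
      moreover have "(\<integral>\<omega>. (deriv_at (ch k) is i (gp k m (step_to z l)) (X d \<omega>) -
          deriv_at (ch k) is i (gp k m z) (X d \<omega>))\<^sup>2 \<partial>P d) \<le> 2 * C * ?s l / 2 ^ m"
        by (rule step_variance[OF X k i N[OF d] _ s]) (use B(2)[OF _ d] BC in \<open>blast intro: order_trans\<close>)
      moreover have "2 * C * ?s l / 2 ^ m \<le> 2 * C * S * (1 / 2) ^ m"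
        using sS[OF l] C0 by (simp add: power_divide divide_right_mono mult_left_mono)
      ultimately show "centered_gaussian_rv (P d) (\<lambda>\<omega>. deriv_at (ch k) is i (gp k m (step_to z l)) (X d \<omega>) -
          deriv_at (ch k) is i (gp k m z) (X d \<omega>)) \<and>
          (\<integral>\<omega>. (deriv_at (ch k) is i (gp k m (step_to z l)) (X d \<omega>) -
          deriv_at (ch k) is i (gp k m z) (X d \<omega>))\<^sup>2 \<partial>P d) \<le> 2 * C * S * (1 / 2) ^ m"
        by (auto intro: order_trans)
    qed
    then show ?thesis by blast
  qed
  let ?n = "\<lambda>k is i. to_nat (k :: nat, is :: nat list, i :: 'k)"
  \<comment> \<open>The triple with code \<open>j\<close> receives the share
    \<open>e * (1 / 2) ^ Suc j\<close>, and these shares add up to \<open>e\<close>.\<close>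
  define m0 where "m0 k is (i :: 'k) = (SOME m. \<forall>d\<ge>N. measure (P d) (?S d k is i m) \<le> e * (1 / 2) ^ Suc (?n k is i))" for k "is" i
  have m0: "measure (P d) (?S d k is i (m0 k is i)) \<le> e * (1 / 2) ^ Suc (?n k is i)"
    if "valid k" "is \<in> directions n r" "d \<ge> N" for k "is" and i :: 'k and d
  proof -
    have "0 < e * (1 / 2) ^ Suc (?n k is i)" using e by simp
    from someI_ex[OF single[OF that(1,2) this]] that(3) show ?thesis unfolding m0_def by blast
  qed
  have "measure (P d) {\<omega> \<in> space (P d). (\<lambda>l. coordinate l (X d \<omega>)) \<notin> regular m0} \<le> e" if d: "d \<ge> N" for d
  proof -
    interpret prob_space "P d" using X[of d] by (simp add: gaussian_random_field_def)
    note V = gaussian_space_field_space[OF X[of d]]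
    \<comment> \<open>Failure events numbered by the codes of the triples; a number that codes no
      admissible triple gets the empty set.\<close>
    define B where "B j = (case from_nat j of (k, is, i :: 'k) \<Rightarrow>
        if ?n k is i = j \<and> valid k \<and> is \<in> directions n r then ?S d k is i (m0 k is i) else {})" for j
    have Sm: "?S d k is i m1 \<in> events" if k: "valid k" and i: "is \<in> directions n r" for k "is" and i :: 'k and m1
    proof -
      define D where "D m z l \<omega> = \<bar>deriv_at (ch k) is i (gp k m (step_to z l)) (X d \<omega>) - deriv_at (ch k) is i (gp k m z) (X d \<omega>)\<bar>" for m z l \<omega>
      have D: "D m z l \<in> borel_measurable (P d)" if "(z, l) \<in> steps n m" for m z l
      proof -
        have "z \<in> grids n m" using that by (auto simp: steps_def)
        then have "(\<lambda>\<omega>. deriv_at (ch k) is i (gp k m (step_to z l)) (X d \<omega>) - deriv_at (ch k) is i (gp k m z) (X d \<omega>)) \<in> borel_measurable (P d)"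
          by (intro gaussian_measurable[OF prob_space_axioms gaussian_space_rv[OF V gaussian_space_diff[OF V]]]
             deriv_in_field_space[OF X valid_chart[OF k] i] gp_chart[OF k] step_to_grids[OF that])
        then show ?thesis unfolding D_def[abs_def] by measurable
      qed
      have "?S d k is i m1 = (\<Union>m\<in>{m1..}. \<Union>s\<in>steps n m. {\<omega> \<in> space (P d). decay ^ m < D m (fst s) (snd s) \<omega>})"
        unfolding D_def by (auto simp: case_prod_beta)
      also have "\<dots> \<in> events"
      proof (rule sets.countable_UN'')
        fix m
        show "(\<Union>s\<in>steps n m. {\<omega> \<in> space (P d). decay ^ m < D m (fst s) (snd s) \<omega>}) \<in> events"
        proof (rule sets.finite_UN[OF finite_steps])
          fix s assume "s \<in> steps n m"
          then have "D m (fst s) (snd s) \<in> borel_measurable (P d)" by (intro D) simp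
          then show "{\<omega> \<in> space (P d). decay ^ m < D m (fst s) (snd s) \<omega>} \<in> events" by measurable
        qed
      qed simp
      finally show ?thesis .
    qed
    have B: "B j \<in> events \<and> prob (B j) \<le> e * (1 / 2) ^ Suc j" for j
    proof -
      obtain k :: nat and "is" :: "nat list" and i :: 'k where j: "from_nat j = (k, is, i)" by (rule prod_cases3)
      show ?thesis
      proof (cases "?n k is i = j \<and> valid k \<and> is \<in> directions n r")
        case True
        have Bj: "B j = ?S d k is i (m0 k is i)"
          unfolding B_def j prod.case using True by (rule if_P)
        have "?S d k is i (m0 k is i) \<in> events" using True by (intro Sm) blast+
        moreover have "prob (?S d k is i (m0 k is i)) \<le> e * (1 / 2) ^ Suc (?n k is i)"
          using True d by (intro m0) blast+
        ultimately show ?thesis unfolding Bj using True by (simp only:)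
      next
        case False
        have Bj: "B j = {}"
          unfolding B_def j prod.case using False by (rule if_not_P)
        show ?thesis unfolding Bj using e by simp
      qed
    qed
    have Bm: "B j \<in> events" and Bb: "prob (B j) \<le> e * (1 / 2) ^ Suc j" for j
      using B by blast+
    have sub: "{\<omega> \<in> space (P d). (\<lambda>l. coordinate l (X d \<omega>)) \<notin> regular m0} \<subseteq> (\<Union>j. B j)"
    proof
      fix \<omega> assume "\<omega> \<in> {\<omega> \<in> space (P d). (\<lambda>l. coordinate l (X d \<omega>)) \<notin> regular m0}"
      then obtain k "is" and i :: 'k and m z l where w: "\<omega> \<in> space (P d)" "valid k" "is \<in> directions n r" "m0 k is i \<le> m"
        "(z, l) \<in> steps n m"
        "decay ^ m < \<bar>coordinate (index k is i m (step_to z l)) (X d \<omega>) - coordinate (index k is i m z) (X d \<omega>)\<bar>"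
        unfolding regular_def mem_Collect_eq not_all not_imp not_le by (elim conjE exE) (rule that, assumption+)
      have "ok (k, is, i, m, step_to z l)" "ok (k, is, i, m, z)"
        using step_to_grids[OF w(5)] w by (auto simp: ok_def steps_def)
      then have "decay ^ m < \<bar>deriv_at (ch k) is i (gp k m (step_to z l)) (X d \<omega>) - deriv_at (ch k) is i (gp k m z) (X d \<omega>)\<bar>"
        using w(6) by (simp add: coordinate_to_nat functional_def)
      then have "\<exists>(z, l)\<in>steps n m. decay ^ m < \<bar>deriv_at (ch k) is i (gp k m (step_to z l)) (X d \<omega>) - deriv_at (ch k) is i (gp k m z) (X d \<omega>)\<bar>"
        using w(5) by (intro bexI[of _ "(z, l)"]) simp_all
      then have "\<omega> \<in> ?S d k is i (m0 k is i)"
        using w(1,4) by blast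
      moreover have "B (?n k is i) = ?S d k is i (m0 k is i)"
        unfolding B_def from_nat_to_nat prod.case by (rule if_P) (use w(2,3) in simp)
      ultimately have "\<omega> \<in> B (?n k is i)" by (simp only:)
      then show "\<omega> \<in> (\<Union>j. B j)" by blast
    qed
    have geo: "summable (\<lambda>j. e * (1 / 2 :: real) ^ Suc j)" "(\<Sum>j. e * (1 / 2 :: real) ^ Suc j) = e"
    proof -
      have gs: "(\<lambda>j. e * (1 / 2 :: real) ^ Suc j) sums (e * 1)" by (rule sums_mult[OF power_half_series])
      show "summable (\<lambda>j. e * (1 / 2 :: real) ^ Suc j)" by (rule sums_summable[OF gs])
      show "(\<Sum>j. e * (1 / 2 :: real) ^ Suc j) = e"
        by (simp only: sums_unique[OF gs, symmetric] mult_1_right)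
    qed
    have sm: "summable (\<lambda>j. prob (B j))"
      by (rule summable_comparison_test'[OF geo(1), of 0]) (use Bb in auto)
    have "prob {\<omega> \<in> space (P d). (\<lambda>l. coordinate l (X d \<omega>)) \<notin> regular m0} \<le> prob (\<Union>j. B j)"
      using Bm by (intro finite_measure_mono sub) auto
    also have "\<dots> \<le> (\<Sum>j. prob (B j))"
      using Bm sm by (intro finite_measure_subadditive_countably) auto
    also have "\<dots> \<le> (\<Sum>j. e * (1 / 2) ^ Suc j)"
      by (rule suminf_le[OF Bb sm geo(1)])
    finally show ?thesis using geo(2) by simp
  qed
  then show ?thesis by (intro exI[of _ m0]) (auto simp: eventually_sequentially)
qed

end

section \<open>Portmanteau inequalities and covariances from characteristic functionals\<close>

lemma limsup_le_epsilon:
  fixes x :: "nat \<Rightarrow> real"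
  assumes "\<And>e. e > 0 \<Longrightarrow> \<forall>\<^sub>F d in sequentially. x d < y + e"
  shows "limsup (\<lambda>d. ereal (x d)) \<le> ereal y"
proof (rule ereal_le_epsilon2)
  fix e :: real assume "e > 0"
  show "limsup (\<lambda>d. ereal (x d)) \<le> ereal y + ereal e"
    by (rule Limsup_bounded) (use assms[OF \<open>e > 0\<close>] in \<open>auto elim!: eventually_mono\<close>)
qed

lemma liminf_ge_epsilon:
  fixes x :: "nat \<Rightarrow> real"
  assumes "\<And>e. e > 0 \<Longrightarrow> \<forall>\<^sub>F d in sequentially. y - e < x d"
  shows "ereal y \<le> liminf (\<lambda>d. ereal (x d))"
proof (rule ereal_le_epsilon2)
  fix e :: real assume "e > 0"
  have "ereal (y - e) \<le> liminf (\<lambda>d. ereal (x d))"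
    by (rule Liminf_bounded) (use assms[OF \<open>e > 0\<close>] in \<open>auto elim!: eventually_mono\<close>)
  then have "ereal (y - e) + ereal e \<le> liminf (\<lambda>d. ereal (x d)) + ereal e"
    by (rule add_right_mono)
  then show "ereal y \<le> liminf (\<lambda>d. ereal (x d)) + ereal e" by simp
qed

text \<open>Everything comes from the bound for closed sets: it is applied to the closure of
  \<open>A\<close> and to the complement of the interior. When the boundary is a null set, closure
  and interior have the mass of \<open>A\<close> under \<open>Q\<close> and the two bounds
  meet.\<close>

lemma portmanteau:
  fixes T :: "'f topology" and X :: "nat \<Rightarrow> 'w \<Rightarrow> 'f"
  assumes P: "\<And>d. prob_space (P d)" and X: "\<And>d. X d \<in> measurable (P d) (borel_of T)"
    and Q: "prob_space Q" and sQ: "sets Q = sets (borel_of T)"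
    and closed: "\<And>F e. closedin T F \<Longrightarrow> e > 0 \<Longrightarrow>
      \<forall>\<^sub>F d in sequentially. measure (P d) {\<omega> \<in> space (P d). X d \<omega> \<in> F} < measure Q F + e"
    and A: "A \<in> sets (borel_of T)"
  shows "ereal (law_prob Q (\<lambda>f. f) (T interior_of A)) \<le> liminf (\<lambda>d. ereal (law_prob (P d) (X d) A))"
    and "limsup (\<lambda>d. ereal (law_prob (P d) (X d) A)) \<le> ereal (law_prob Q (\<lambda>f. f) (T closure_of A))"
    and "law_prob Q (\<lambda>f. f) (T frontier_of A) = 0 \<Longrightarrow>
      (\<lambda>d. law_prob (P d) (X d) A) \<longlonglongrightarrow> law_prob Q (\<lambda>f. f) A"
proof -
  interpret P: prob_space "P d" for d by (rule P)
  interpret Q: prob_space Q by (rule Q)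
  have spQ: "space Q = topspace T" using sets_eq_imp_space_eq[OF sQ] by simp
  have AT: "A \<subseteq> topspace T" using sets.sets_into_space[OF A] by simp
  have lQ: "law_prob Q (\<lambda>f. f) B = measure Q B" if "B \<subseteq> topspace T" for B
  proof -
    have "{f \<in> space Q. f \<in> B} = B" using that by (auto simp: spQ)
    then show ?thesis by (simp add: law_prob_def)
  qed
  have ev: "{\<omega> \<in> space (P d). X d \<omega> \<in> B} \<in> sets (P d)" if "B \<in> sets (borel_of T)" for B d
    using measurable_sets[OF X that, of d] by (simp add: vimage_def Int_def conj_commute)
  have mono: "law_prob (P d) (X d) B \<le> law_prob (P d) (X d) C"
    if "B \<subseteq> C" "C \<in> sets (borel_of T)" for B C d
    unfolding law_prob_def using that by (intro P.finite_measure_mono ev) auto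
  let ?C = "T closure_of A" and ?I = "T interior_of A"
  have C: "closedin T ?C" and I: "openin T ?I" by auto
  have CT: "?C \<subseteq> topspace T" and IT: "?I \<subseteq> topspace T"
    using closedin_subset[OF C] openin_subset[OF I] by auto
  have upper: "\<forall>\<^sub>F d in sequentially. law_prob (P d) (X d) A < measure Q ?C + e" if "e > 0" for e
    using closed[OF C that]
  proof eventually_elim
    case (elim d)
    have "law_prob (P d) (X d) A \<le> law_prob (P d) (X d) ?C"
      by (intro mono closure_of_subset AT closedin_borel_of C)
    with elim show ?case by (simp add: law_prob_def)
  qed
  have lower: "\<forall>\<^sub>F d in sequentially. measure Q ?I - e < law_prob (P d) (X d) A" if "e > 0" for e
  proof -
    have F: "closedin T (topspace T - ?I)" using I by (simp add: closedin_def Diff_Diff_Int Int_absorb1 IT)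
    have QI: "measure Q (topspace T - ?I) = 1 - measure Q ?I"
      using Q.prob_compl[of ?I] openin_borel_of[OF I] by (simp add: sQ spQ)
    show ?thesis
      using closed[OF F that]
    proof eventually_elim
      case (elim d)
      have "{\<omega> \<in> space (P d). X d \<omega> \<in> topspace T - ?I} = space (P d) - {\<omega> \<in> space (P d). X d \<omega> \<in> ?I}"
        using measurable_space[OF X] by auto
      then have "measure (P d) {\<omega> \<in> space (P d). X d \<omega> \<in> topspace T - ?I} = 1 - law_prob (P d) (X d) ?I"
        using P.prob_compl[OF ev[OF openin_borel_of[OF I]]] by (simp add: law_prob_def)
      moreover have "law_prob (P d) (X d) ?I \<le> law_prob (P d) (X d) A"
        by (intro mono interior_of_subset A)
      ultimately show ?case using elim QI by simp
    qed
  qed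
  show "ereal (law_prob Q (\<lambda>f. f) ?I) \<le> liminf (\<lambda>d. ereal (law_prob (P d) (X d) A))"
    unfolding lQ[OF IT] by (rule liminf_ge_epsilon) (rule lower)
  show "limsup (\<lambda>d. ereal (law_prob (P d) (X d) A)) \<le> ereal (law_prob Q (\<lambda>f. f) ?C)"
    unfolding lQ[OF CT] by (rule limsup_le_epsilon) (rule upper)
  assume fr: "law_prob Q (\<lambda>f. f) (T frontier_of A) = 0"
  have [simp]: "?C \<in> sets Q" "?I \<in> sets Q" "A \<in> sets Q"
    using closedin_borel_of[OF C] openin_borel_of[OF I] A by (simp_all add: sQ)
  have "measure Q ?C - measure Q ?I = measure Q (?C - ?I)"
    using interior_of_subset_closure_of[of T A] by (intro Q.finite_measure_Diff[symmetric]) auto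
  also have "\<dots> = 0"
    using fr lQ[of "T frontier_of A"] frontier_of_subset_topspace[of T A] by (simp add: frontier_of_def)
  finally have "measure Q ?C = measure Q ?I" by simp
  moreover have "measure Q ?I \<le> measure Q A" "measure Q A \<le> measure Q ?C"
    using closure_of_subset[OF AT] interior_of_subset[of T A] by (auto intro!: Q.finite_measure_mono)
  ultimately have eq: "measure Q ?C = measure Q A" "measure Q ?I = measure Q A" by auto
  show "(\<lambda>d. law_prob (P d) (X d) A) \<longlonglongrightarrow> law_prob Q (\<lambda>f. f) A"
    unfolding lQ[OF AT]
  proof (rule tendstoI)
    fix e :: real assume e: "e > 0"
    show "\<forall>\<^sub>F d in sequentially. dist (law_prob (P d) (X d) A) (measure Q A) < e"
      using upper[OF e] lower[OF e] unfolding eq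
      by eventually_elim (simp add: dist_real_def abs_diff_less_iff)
  qed
qed

lemma sum_sum_delta:
  fixes \<Delta> :: "nat \<Rightarrow> nat \<Rightarrow> real"
  assumes "p < N" "q < N"
  shows "(\<Sum>i<N. \<Sum>j<N. of_bool (i = p) * of_bool (j = q) * \<Delta> i j) = \<Delta> p q"
proof -
  have "(\<Sum>j<N. of_bool (i = p) * of_bool (j = q) * \<Delta> i j) = (if i = p then \<Delta> i q else 0)" for i
  proof -
    have "(\<Sum>j<N. of_bool (i = p) * of_bool (j = q) * \<Delta> i j) = (\<Sum>j<N. if j = q then of_bool (i = p) * \<Delta> i j else 0)"
      by (rule sum.cong) simp_all
    also have "\<dots> = of_bool (i = p) * \<Delta> i q" using assms(2) by (simp add: sum.delta)
    finally show ?thesis by simp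
  qed
  then show ?thesis using assms(1) by (simp add: sum.delta)
qed

text \<open>The characteristic functional determines the quadratic form of \<Gamma>; symmetry of
  \<Gamma> is what allows polarization to recover the entries.\<close>

lemma gaussian_functionals:
  fixes D :: "nat \<Rightarrow> 'f \<Rightarrow> real"
  assumes Q: "prob_space Q" and D: "\<And>l. D l \<in> borel_measurable Q"
    and sym: "\<And>l l'. \<Gamma> l l' = \<Gamma> l' l"
    and ch: "\<And>N a. (CLINT f|Q. iexp (\<Sum>l<N. a l * D l f)) =
       of_real (exp (- (\<Sum>l<N. \<Sum>l'<N. a l * a l' * \<Gamma> l l') / 2))"
  shows "gaussian_space Q {Y. \<exists>N a. Y = (\<lambda>f. \<Sum>l<N. a l * D l f)}" (is "gaussian_space Q ?V")
    and "D l \<in> {Y. \<exists>N a. Y = (\<lambda>f. \<Sum>l<N. a l * D l f)}"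
    and "(\<integral>f. D l f * D l' f \<partial>Q) = \<Gamma> l l'"
proof -
  interpret Q: prob_space Q by (rule Q)
  note [measurable] = D
  have comb: "centered_gaussian_rv Q (\<lambda>f. \<Sum>l<N. a l * D l f) \<and>
      (\<integral>f. (\<Sum>l<N. a l * D l f)\<^sup>2 \<partial>Q) = (\<Sum>l<N. \<Sum>l'<N. a l * a l' * \<Gamma> l l')" for N a
  proof -
    let ?Y = "\<lambda>f. \<Sum>l<N. a l * D l f" and ?v = "\<Sum>l<N. \<Sum>l'<N. a l * a l' * \<Gamma> l l'"
    have cht: "(CLINT f|Q. iexp (t * ?Y f)) = of_real (exp (- (t\<^sup>2 * ?v) / 2))" for t
    proof -
      have "(CLINT f|Q. iexp (t * ?Y f)) = (CLINT f|Q. iexp (\<Sum>l<N. (t * a l) * D l f))"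
        by (simp only: sum_distrib_left mult.assoc)
      also have "\<dots> = of_real (exp (- (\<Sum>l<N. \<Sum>l'<N. (t * a l) * (t * a l') * \<Gamma> l l') / 2))" by (rule ch)
      also have "(\<Sum>l<N. \<Sum>l'<N. (t * a l) * (t * a l') * \<Gamma> l l') = t\<^sup>2 * ?v"
        unfolding sum_distrib_left by (intro sum.cong refl) (simp add: power2_eq_square)
      finally show ?thesis .
    qed
    interpret R: real_distribution "distr Q borel ?Y" by (rule Q.real_distribution_distr) simp
    \<comment> \<open>Positivity of the quadratic form follows from the fact that a characteristic
      function has modulus at most 1.\<close>
    have "char (distr Q borel ?Y) 1 = (CLINT f|Q. iexp (1 * ?Y f))"
      unfolding char_def by (subst integral_distr) auto
    also have "\<dots> = of_real (exp (- (1\<^sup>2 * ?v) / 2))" by (rule cht)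
    finally have "\<bar>exp (- (1\<^sup>2 * ?v) / 2)\<bar> \<le> 1"
      using R.cmod_char_le_1[of 1] by (simp only: norm_of_real)
    then have v: "?v \<ge> 0" by simp
    have g: "centered_gaussian_rv Q ?Y"
      by (rule gaussianI_char[OF Q _ v]) (use cht in simp_all)
    have "complex_of_real (exp (- (1\<^sup>2 * ?v) / 2)) = of_real (exp (- (1\<^sup>2 * (\<integral>f. (?Y f)\<^sup>2 \<partial>Q)) / 2))"
      using cht[of 1] gaussian_char[OF Q g, of 1] by simp
    then have "(\<integral>f. (?Y f)\<^sup>2 \<partial>Q) = ?v"
      by (simp only: of_real_eq_iff exp_inj_iff) simp
    with g show ?thesis by simp
  qed
  show V: "gaussian_space Q ?V"
    unfolding gaussian_space_def
  proof (intro conjI ballI allI)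
    show "centered_gaussian_rv Q Y" if "Y \<in> ?V" for Y using that comb by blast
    fix Y assume "Y \<in> ?V"
    then obtain N a where Y: "Y = (\<lambda>f. \<Sum>l<N. a l * D l f)" by blast
    show "(\<lambda>f. c * Y f) \<in> ?V" for c
      unfolding Y by (intro CollectI exI[of _ N] exI[of _ "\<lambda>l. c * a l"]) (simp add: sum_distrib_left mult.assoc)
    fix Z assume "Z \<in> ?V"
    then obtain N' b where Z: "Z = (\<lambda>f. \<Sum>l<N'. b l * D l f)" by blast
    have "Y f = (\<Sum>l<max N N'. (if l < N then a l else 0) * D l f)" for f
      unfolding Y by (rule sum.mono_neutral_cong_left) auto
    moreover have "Z f = (\<Sum>l<max N N'. (if l < N' then b l else 0) * D l f)" for f
      unfolding Z by (rule sum.mono_neutral_cong_left) auto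
    ultimately have "(\<lambda>f. Y f + Z f) = (\<lambda>f. \<Sum>l<max N N'. ((if l < N then a l else 0) + (if l < N' then b l else 0)) * D l f)"
      by (simp only: distrib_right sum.distrib)
    then show "(\<lambda>f. Y f + Z f) \<in> ?V"
      by (intro CollectI exI[of _ "max N N'"] exI[of _ "\<lambda>l. (if l < N then a l else 0) + (if l < N' then b l else 0)"])
  qed
  show DV: "D l \<in> ?V" for l
  proof -
    have "D l = (\<lambda>f. \<Sum>i<Suc l. (if i = l then 1 else 0) * D i f)" by (simp add: fun_eq_iff)
    then show ?thesis by (intro CollectI exI[of _ "Suc l"] exI[of _ "\<lambda>i. if i = l then 1 else 0"])
  qed
  \<comment> \<open>The quadratic form of this difference vanishes: unit vectors give the diagonal
    entries, the sum of two unit vectors gives the others.\<close>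
  define \<Delta> where "\<Delta> i j = (\<integral>f. D i f * D j f \<partial>Q) - \<Gamma> i j" for i j
  have \<Delta>0: "(\<Sum>i<N. \<Sum>j<N. a i * a j * \<Delta> i j) = 0" for N a
  proof -
    have "(\<Sum>i<N. \<Sum>j<N. a i * a j * (\<integral>f. D i f * D j f \<partial>Q)) = (\<Sum>l<N. \<Sum>l'<N. a l * a l' * \<Gamma> l l')"
      using comb[of a N] variance_comb[OF Q finite_lessThan, of N D a] gaussian_space_rv[OF V DV] by simp
    then show ?thesis by (simp add: \<Delta>_def right_diff_distrib sum_subtractf)
  qed
  have diag: "\<Delta> l l = 0" for l
    using \<Delta>0[of "\<lambda>i. of_bool (i = l)" "Suc l"] sum_sum_delta[of l "Suc l" l \<Delta>] by simp
  have "\<Delta> l l' = 0"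
  proof -
    let ?N = "Suc (max l l')"
    let ?u = "\<lambda>i. of_bool (i = l) :: real" and ?w = "\<lambda>i. of_bool (i = l') :: real"
    have "(\<Sum>i<?N. \<Sum>j<?N. (?u i + ?w i) * (?u j + ?w j) * \<Delta> i j) =
      (\<Sum>i<?N. \<Sum>j<?N. ?u i * ?u j * \<Delta> i j) + (\<Sum>i<?N. \<Sum>j<?N. ?u i * ?w j * \<Delta> i j) +
      (\<Sum>i<?N. \<Sum>j<?N. ?w i * ?u j * \<Delta> i j) + (\<Sum>i<?N. \<Sum>j<?N. ?w i * ?w j * \<Delta> i j)"
      by (simp only: distrib_left distrib_right sum.distrib add_ac)
    also have "\<dots> = \<Delta> l l + \<Delta> l l' + \<Delta> l' l + \<Delta> l' l'"
      by (subst (1 2 3 4) sum_sum_delta) auto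
    finally have "\<Delta> l l' + \<Delta> l' l = 0"
      using \<Delta>0[of "\<lambda>i. ?u i + ?w i" ?N] diag by simp
    moreover have "\<Delta> l' l = \<Delta> l l'" by (simp add: \<Delta>_def sym[of l' l] mult.commute)
    ultimately show ?thesis by simp
  qed
  then show "(\<integral>f. D l f * D l' f \<partial>Q) = \<Gamma> l l'" by (simp add: \<Delta>_def)
qed

section \<open>Construction of the limit field\<close>

context patched_mfd
begin

text \<open>The guard matches the default 0 of \<open>functional\<close>, so that this is the limit
  of the coordinate covariances for all pairs of indices.\<close>

definition limit_cov :: "('m \<times> 'm \<Rightarrow> real ^ 'k ^ 'k::finite) \<Rightarrow> nat \<Rightarrow> nat \<Rightarrow> real" where
  "limit_cov K l l' = (if ok (from_nat l :: 'k site) \<and>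
       ok (from_nat l' :: 'k site)
     then (case from_nat l of (k, is, i :: 'k, m, z) \<Rightarrow> case from_nat l' of (k', js, j :: 'k, m', z') \<Rightarrow>
       mixed_partial (chart_image (ch k)) (chart_image (ch k')) is js (in_charts (ch k) (ch k') K)
         (gp k m z, gp k' m' z') $ i $ j) else 0)"

lemma coordinate_in_field_space:
  fixes X :: "'w \<Rightarrow> 'm \<Rightarrow> real ^ 'k"
  assumes X: "gaussian_random_field M n \<A> r P X"
  shows "(\<lambda>\<omega>. coordinate l (X \<omega>)) \<in> field_space M P X"
proof (cases "ok (from_nat l :: 'k site)")
  case True
  obtain k "is" i m z where e: "(from_nat l :: 'k site) = (k, is, i, m, z)"
    by (rule prod_cases5)
  have okk: "valid k" "is \<in> directions n r" "z \<in> grids n m" using True by (auto simp: e ok_def)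
  show ?thesis
    using deriv_in_field_space[OF X valid_chart[OF okk(1)] okk(2) gp_chart[OF okk(1,3)], of i] True
    by (simp add: coordinate_def functional_def e)
next
  case False
  have "(\<lambda>\<omega>. 0) \<in> point_span M X"
    unfolding point_span_def by (intro CollectI exI[of _ "{}"]) simp
  then have "(\<lambda>\<omega>. 0) \<in> limit_span M P X 0" by (simp add: limit_span_def)
  then have "(\<lambda>\<omega>. 0) \<in> field_space M P X" unfolding field_space_def by blast
  then show ?thesis using False by (simp add: coordinate_def functional_def)
qed

text \<open>A singleton is compact, so convergence of the covariance functions includes convergence
  of their mixed partials at each pair of grid points.\<close>

lemma coordinate_cov_tendsto:
  fixes X :: "nat \<Rightarrow> 'w \<Rightarrow> 'm \<Rightarrow> real ^ 'k"
  assumes X: "\<And>d. gaussian_random_field M n \<A> r (P d) (X d)"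
    and lim: "limitin (Css_topology M n \<A> (r + 2)) (\<lambda>d. covariance_function M (P d) (X d)) K sequentially"
  shows "(\<lambda>d. \<integral>\<omega>. coordinate l (X d \<omega>) * coordinate l' (X d \<omega>) \<partial>P d) \<longlonglongrightarrow> limit_cov K l l'"
proof (cases "ok (from_nat l :: 'k site) \<and>
       ok (from_nat l' :: 'k site)")
  case True
  obtain k "is" i m z where e: "(from_nat l :: 'k site) = (k, is, i, m, z)"
    by (rule prod_cases5)
  obtain k' js j m' z' where e': "(from_nat l' :: 'k site) = (k', js, j, m', z')"
    by (rule prod_cases5)
  have o: "valid k" "is \<in> directions n r" "z \<in> grids n m" "valid k'" "js \<in> directions n r" "z' \<in> grids n m'"
    using True by (auto simp: e e' ok_def)
  let ?D = "\<lambda>K. mixed_partial (chart_image (ch k)) (chart_image (ch k')) is js (in_charts (ch k) (ch k') K)"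
  let ?u = "(gp k m z, gp k' m' z')"
  have eq: "(\<integral>\<omega>. coordinate l (X d \<omega>) * coordinate l' (X d \<omega>) \<partial>P d) = ?D (covariance_function M (P d) (X d)) ?u $ i $ j" for d
    using mixed_partial_covariance[OF X valid_chart[OF o(1)] valid_chart[OF o(4)] o(2,5) gp_chart[OF o(1,3)] gp_chart[OF o(4,6)], of d] True
    by (simp add: coordinate_def functional_def e e')
  have "uniform_limit {?u} (\<lambda>d. ?D (covariance_function M (P d) (X d))) (?D K) sequentially"
  proof (rule limitin_uniform_on_topologyD[OF lim[unfolded Css_topology_def], of ?D])
    have "compact {?u}" "{?u} \<subseteq> chart_image (ch k) \<times> chart_image (ch k')"
      using gp_chart o by auto
    then show "(?D, {?u}) \<in> {(\<lambda>K. mixed_partial (chart_image c) (chart_image c') is js (in_charts c c' K), C) | c c' is js C.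
        c \<in> \<A> \<and> c' \<in> \<A> \<and> is \<in> directions n (r + 2) \<and> js \<in> directions n (r + 2) \<and>
        compact C \<and> C \<subseteq> chart_image c \<times> chart_image c'}"
      by (intro CollectI exI[of _ "ch k"] exI[of _ "ch k'"] exI[of _ "is"] exI[of _ js] exI[of _ "{?u}"] conjI refl
          valid_chart o directions_add)
  qed
  then have "(\<lambda>d. ?D (covariance_function M (P d) (X d)) ?u $ i $ j) \<longlonglongrightarrow> ?D K ?u $ i $ j"
    by (intro tendsto_vec_nth) simp
  then show ?thesis using True unfolding eq by (simp add: limit_cov_def e e')
next
  case False
  then have "coordinate l f * coordinate l' f = 0" for f :: "'m \<Rightarrow> real ^ 'k"
    by (auto simp: coordinate_def functional_def)
  then have "(\<integral>\<omega>. coordinate l (X d \<omega>) * coordinate l' (X d \<omega>) \<partial>P d) = 0" for d by (simp only: Bochner_Integration.integral_zero)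
  moreover have "limit_cov K l l' = 0" unfolding limit_cov_def by (rule if_not_P[OF False])
  ultimately show ?thesis by (simp only: tendsto_const)
qed

text \<open>\<open>gaussian_weak_limit\<close> describes the law through the coordinates only. The
  Gaussian property and the covariance at arbitrary points of \<open>M\<close> follow because values
  are pointwise limits of coordinates.\<close>

theorem limit_field_exists:
  fixes X :: "nat \<Rightarrow> 'w \<Rightarrow> 'm \<Rightarrow> real ^ 'k"
  assumes X: "\<And>d. gaussian_random_field M n \<A> r (P d) (X d)"
    and lim: "limitin (Css_topology M n \<A> (r + 2)) (\<lambda>d. covariance_function M (P d) (X d)) K sequentially"
  shows "\<exists>Q. gaussian_random_field M n \<A> r Q (\<lambda>f. f) \<and> covariance_function M Q (\<lambda>f. f) = K \<and>
    sets Q = sets (borel_of (weak_Whitney M n \<A> r :: ('m \<Rightarrow> real ^ 'k) topology)) \<and>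
    (\<forall>F e. closedin (weak_Whitney M n \<A> r) F \<longrightarrow> e > 0 \<longrightarrow>
       (\<forall>\<^sub>F d in sequentially. measure (P d) {\<omega> \<in> space (P d). X d \<omega> \<in> F} < measure Q F + e))"
proof -
  let ?T = "weak_Whitney M n \<A> r :: ('m \<Rightarrow> real ^ 'k) topology"
  have P: "prob_space (P d)" and Xm: "X d \<in> measurable (P d) (borel_of ?T)" for d
    using X[of d] by (auto simp: gaussian_random_field_def)
  have KS: "K \<in> Css_space M n \<A> (r + 2)" using limitin_topspace[OF lim] by simp
  have tight: "\<exists>\<kappa>. closed \<kappa> \<and>
      (\<forall>\<^sub>F d in sequentially. measure (P d) {\<omega> \<in> space (P d). (\<lambda>l. coordinate l (X d \<omega>)) \<notin> \<kappa>} \<le> e) \<and>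
      (\<forall>F. closedin ?T F \<longrightarrow> closed ((\<lambda>f l. coordinate l f) ` F \<inter> \<kappa>))" if "e > 0" for e
  proof -
    obtain m0 :: "nat \<Rightarrow> nat list \<Rightarrow> 'k \<Rightarrow> nat" where "\<forall>\<^sub>F d in sequentially.
        measure (P d) {\<omega> \<in> space (P d). (\<lambda>l. coordinate l (X d \<omega>)) \<notin> regular m0} \<le> e"
      using tightness[OF X lim \<open>e > 0\<close>] by blast
    then show ?thesis
      using closed_image[where ?m0.0=m0] closed_regular[of m0] by (intro exI[of _ "regular m0"]) simp
  qed
  obtain Q where Q: "prob_space Q" and sQ: "sets Q = sets (borel_of ?T)"
    and ch: "\<forall>N a. (CLINT f|Q. iexp (\<Sum>l<N. a l * coordinate l f)) =
       of_real (exp (- (\<Sum>l<N. \<Sum>l'<N. a l * a l' * limit_cov K l l') / 2))"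
    and cl: "\<forall>F e. closedin ?T F \<longrightarrow> e > 0 \<longrightarrow>
       (\<forall>\<^sub>F d in sequentially. measure (P d) {\<omega> \<in> space (P d). X d \<omega> \<in> F} < measure Q F + e)"
    using gaussian_weak_limit[of P X ?T coordinate "\<lambda>d. field_space M (P d) (X d)" "limit_cov K",
      OF P Xm coordinate_measurable gaussian_space_field_space[OF X] coordinate_in_field_space[OF X]
      coordinate_cov_tendsto[OF X lim] coordinate_inj tight]
    unfolding topspace_weak_Whitney by blast
  interpret Q: prob_space Q by (rule Q)
  have spQ: "space Q = Cr_space M n \<A> r" using sets_eq_imp_space_eq[OF sQ] by simp
  have cm: "coordinate l \<in> borel_measurable Q" for l
    using coordinate_measurable[of l, where 'k='k] measurable_cong_sets[OF sQ refl] by blast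
  \<comment> \<open>Symmetry is inherited from the covariances of the coordinates of
    \<open>X d\<close>.\<close>
  have sym: "limit_cov K l l' = limit_cov K l' l" for l l'
    using LIMSEQ_unique[OF coordinate_cov_tendsto[OF X lim, of l l']
        coordinate_cov_tendsto[OF X lim, of l' l, unfolded mult.commute[of "coordinate l' _"]]] .
  let ?V = "{Y. \<exists>N a. Y = (\<lambda>f :: 'm \<Rightarrow> real ^ 'k. \<Sum>l<N. a l * coordinate l f)}"
  note gf = gaussian_functionals[OF Q cm sym ch[rule_format]]
  \<comment> \<open>Closing up under pointwise limits brings in the values at all points of
    \<open>M\<close>.\<close>
  let ?L = "pointwise_limits Q ?V"
  have L: "gaussian_space Q ?L" by (rule gaussian_space_limits[OF Q gf(1)])
  have inL: "coordinate l \<in> ?L" for l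
    using pointwise_limits_subset gf(2) by blast
  have valL: "(\<lambda>f. f q $ i) \<in> ?L" if q: "q \<in> topspace M" for q i
  proof -
    obtain k z where "\<forall>(f :: 'm \<Rightarrow> real ^ 'k) i. f \<in> Cr_space M n \<A> r \<longrightarrow>
       (\<lambda>m. coordinate (index k [] i m (z m)) f) \<longlonglongrightarrow> f q $ i"
      using value_limit[where 'k='k, OF q] by (elim exE conjE) (rule that, assumption)
    then show ?thesis
      unfolding pointwise_limits_def using gf(2)
      by (intro CollectI exI[of _ "\<lambda>m. coordinate (index k [] i m (z m))"]) (simp add: spQ)
  qed
  have vec: "centered_gaussian_vector Q F (\<lambda>p f. f p)" if F: "finite F" "F \<subseteq> topspace M" for F
    unfolding centered_gaussian_vector_def
  proof
    fix a :: "'m \<Rightarrow> real ^ 'k"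
    show "centered_gaussian_rv Q (\<lambda>f. \<Sum>p\<in>F. a p \<bullet> f p)"
    proof (cases "F = {}")
      case True
      then show ?thesis by (simp add: centered_gaussian_rv_def)
    next
      case False
      have "(\<lambda>f. \<Sum>p\<in>F. \<Sum>i\<in>UNIV. a p $ i * f p $ i) \<in> ?L"
        using F by (intro gaussian_space_sum[OF L _ False] gaussian_space_comb[OF L] valL) auto
      then show ?thesis
        using gaussian_space_rv[OF L] by (simp add: inner_vec_def)
    qed
  qed
  have id: "(\<lambda>f. f) \<in> measurable Q (borel_of ?T)"
    by (rule measurable_ident_sets[OF sQ])
  have field: "gaussian_random_field M n \<A> r Q (\<lambda>f. f)"
    unfolding gaussian_random_field_def using Q id vec by blast
  \<comment> \<open>The grid points approach \<open>p\<close> first and \<open>q\<close> afterwards,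
    so that \<open>gaussian_cov_lim\<close> always has one factor fixed; continuity of
    \<open>K\<close> identifies the limits.\<close>
  have cov: "(\<integral>f. f p $ i * f q $ j \<partial>Q) = K (p, q) $ i $ j"
    if p: "p \<in> topspace M" and q: "q \<in> topspace M" for p q i j
  proof -
    obtain k z where kz: "valid k" "p \<in> fst (ch k)" "\<forall>m. z m \<in> grids n m" "(\<lambda>m. gp k m (z m)) \<longlonglongrightarrow> snd (ch k) p"
      "\<forall>(f :: 'm \<Rightarrow> real ^ 'k) i. f \<in> Cr_space M n \<A> r \<longrightarrow>
         (\<lambda>m. coordinate (index k [] i m (z m)) f) \<longlonglongrightarrow> f p $ i"
      using value_limit[where 'k='k, OF p] by (elim exE conjE) (rule that, assumption+)
    obtain k' z' where kz': "valid k'" "q \<in> fst (ch k')" "\<forall>m. z' m \<in> grids n m" "(\<lambda>m. gp k' m (z' m)) \<longlonglongrightarrow> snd (ch k') q"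
      "\<forall>(f :: 'm \<Rightarrow> real ^ 'k) i. f \<in> Cr_space M n \<A> r \<longrightarrow>
         (\<lambda>m. coordinate (index k' [] i m (z' m)) f) \<longlonglongrightarrow> f q $ i"
      using value_limit[where 'k='k, OF q] by (elim exE conjE) (rule that, assumption+)
    let ?A = "\<lambda>m. coordinate (index k [] i m (z m)) :: ('m \<Rightarrow> real ^ 'k) \<Rightarrow> real"
    let ?B = "\<lambda>m. coordinate (index k' [] j m (z' m)) :: ('m \<Rightarrow> real ^ 'k) \<Rightarrow> real"
    let ?\<kappa> = "in_charts (ch k) (ch k') K"
    let ?W = "chart_image (ch k) \<times> chart_image (ch k')"
    have "continuous_on ?W (mixed_partial (chart_image (ch k)) (chart_image (ch k')) [] [] ?\<kappa>)"
      using KS valid_chart[OF kz(1)] valid_chart[OF kz'(1)] directions_Nil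
      unfolding Css_space_def Css_on_def by blast
    moreover have "mixed_partial (chart_image (ch k)) (chart_image (ch k')) [] [] ?\<kappa> = ?\<kappa>"
      by (simp add: mixed_partial_def)
    ultimately have cont: "continuous_on ?W ?\<kappa>" by simp
    have AB: "(\<integral>f. ?A m f * ?B m' f \<partial>Q) = ?\<kappa> (gp k m (z m), gp k' m' (z' m')) $ i $ j" for m m'
      using kz(1,3) kz'(1,3) by (simp add: gf(3) limit_cov_def ok_def mixed_partial_def)
    let ?x = "snd (ch k) p" and ?y = "snd (ch k') q"
    have xW: "?x \<in> chart_image (ch k)" and yW: "?y \<in> chart_image (ch k')"
      using kz(2) kz'(2) by (auto simp: chart_image_eq)
    have gW: "gp k m (z m) \<in> chart_image (ch k)" "gp k' m (z' m) \<in> chart_image (ch k')" for m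
      using gp_chart kz(1,3) kz'(1,3) by blast+
    have 1: "(\<integral>f. f p $ i * ?B m' f \<partial>Q) = ?\<kappa> (?x, gp k' m' (z' m')) $ i $ j" for m'
    proof (rule LIMSEQ_unique)
      show "(\<lambda>m. \<integral>f. ?A m f * ?B m' f \<partial>Q) \<longlonglongrightarrow> (\<integral>f. f p $ i * ?B m' f \<partial>Q)"
        by (rule gaussian_cov_lim[OF Q L inL valL[OF p] inL]) (use kz(5) spQ in blast)
      have "(\<lambda>m. ?\<kappa> (gp k m (z m), gp k' m' (z' m'))) \<longlonglongrightarrow> ?\<kappa> (?x, gp k' m' (z' m'))"
        by (rule continuous_on_tendsto_compose[OF cont tendsto_Pair[OF kz(4) tendsto_const]])
           (use xW gW in \<open>auto intro!: always_eventually\<close>)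
      then show "(\<lambda>m. \<integral>f. ?A m f * ?B m' f \<partial>Q) \<longlonglongrightarrow> ?\<kappa> (?x, gp k' m' (z' m')) $ i $ j"
        unfolding AB by (intro tendsto_vec_nth)
    qed
    have "(\<integral>f. ?B m' f * f p $ i \<partial>Q) = ?\<kappa> (?x, gp k' m' (z' m')) $ i $ j" for m'
      using 1[of m'] by (simp add: mult.commute)
    note 2 = this
    have "(\<integral>f. f q $ j * f p $ i \<partial>Q) = ?\<kappa> (?x, ?y) $ i $ j"
    proof (rule LIMSEQ_unique)
      show "(\<lambda>m. \<integral>f. ?B m f * f p $ i \<partial>Q) \<longlonglongrightarrow> (\<integral>f. f q $ j * f p $ i \<partial>Q)"
        by (rule gaussian_cov_lim[OF Q L inL valL[OF q] valL[OF p]]) (use kz'(5) spQ in blast)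
      have "(\<lambda>m. ?\<kappa> (?x, gp k' m (z' m))) \<longlonglongrightarrow> ?\<kappa> (?x, ?y)"
        by (rule continuous_on_tendsto_compose[OF cont tendsto_Pair[OF tendsto_const kz'(4)]])
           (use xW yW gW in \<open>auto intro!: always_eventually\<close>)
      then show "(\<lambda>m. \<integral>f. ?B m f * f p $ i \<partial>Q) \<longlonglongrightarrow> ?\<kappa> (?x, ?y) $ i $ j"
        unfolding 2 by (intro tendsto_vec_nth)
    qed
    moreover have "?\<kappa> (?x, ?y) = K (p, q)"
      using pt_chart[OF valid_chart[OF kz(1)] kz(2)] pt_chart[OF valid_chart[OF kz'(1)] kz'(2)]
      by (simp add: in_charts_eq)
    ultimately show ?thesis by (simp add: mult.commute)
  qed
  have "covariance_function M Q (\<lambda>f. f) = K"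
  proof (rule extensionalityI)
    show "covariance_function M Q (\<lambda>f. f) \<in> extensional (topspace M \<times> topspace M)"
      unfolding covariance_function_def by (rule restrict_extensional)
    show "K \<in> extensional (topspace M \<times> topspace M)"
      using KS by (simp add: Css_space_def)
    fix u assume "u \<in> topspace M \<times> topspace M"
    then obtain p q where u: "u = (p, q)" "p \<in> topspace M" "q \<in> topspace M" by blast
    then show "covariance_function M Q (\<lambda>f. f) u = K u"
      using cov by (simp add: covariance_function_def vec_eq_iff)
  qed
  then show ?thesis using field sQ cl by blast
qed

end

theorem theorem21:
  fixes M :: "'m topology" and n :: nat and \<A> :: "'m chart set" and r :: enat
    and P :: "nat \<Rightarrow> 'w measure"
    and X :: "nat \<Rightarrow> 'w \<Rightarrow> 'm \<Rightarrow> real ^ 'k"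
    and K :: "'m \<times> 'm \<Rightarrow> real ^ 'k ^ 'k"
  defines "T \<equiv> (weak_Whitney M n \<A> r :: ('m \<Rightarrow> real ^ 'k) topology)"
  assumes "smooth_manifold M n \<A>"
    and "\<And>d. gaussian_random_field M n \<A> r (P d) (X d)"
    and "limitin (Css_topology M n \<A> (r + 2))
           (\<lambda>d. covariance_function M (P d) (X d)) K sequentially"
  shows "\<exists>(Q :: ('m \<Rightarrow> real ^ 'k) measure) (Y :: ('m \<Rightarrow> real ^ 'k) \<Rightarrow> 'm \<Rightarrow> real ^ 'k).
           gaussian_random_field M n \<A> r Q Y \<and>
           covariance_function M Q Y = K \<and>
           (\<forall>A \<in> sets (borel_of T).
              ereal (law_prob Q Y (T interior_of A))
                \<le> liminf (\<lambda>d. ereal (law_prob (P d) (X d) A)) \<and>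
              liminf (\<lambda>d. ereal (law_prob (P d) (X d) A))
                \<le> limsup (\<lambda>d. ereal (law_prob (P d) (X d) A)) \<and>
              limsup (\<lambda>d. ereal (law_prob (P d) (X d) A))
                \<le> ereal (law_prob Q Y (T closure_of A)) \<and>
              (law_prob Q Y (T frontier_of A) = 0 \<longrightarrow>
                 (\<lambda>d. law_prob (P d) (X d) A) \<longlonglongrightarrow> law_prob Q Y A))"
proof -
  interpret mfd: smooth_mfd M n \<A> by (rule smooth_mfd.intro) (rule assms(2))
  obtain \<P> where "countable \<P>" "\<forall>p\<in>\<P>. good_patch n \<A> p" "topspace M = (\<Union>p\<in>\<P>. pnbhd p)"
    using mfd.countable_patches by blast
  then interpret patched_mfd M n \<A> \<P> r
    by (intro patched_mfd.intro patched_mfd_axioms.intro mfd.smooth_mfd_axioms) auto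
  obtain Q where Q: "gaussian_random_field M n \<A> r Q (\<lambda>f. f)" "covariance_function M Q (\<lambda>f. f) = K"
    "sets Q = sets (borel_of T)"
    and cl: "\<forall>F e. closedin T F \<longrightarrow> e > 0 \<longrightarrow>
       (\<forall>\<^sub>F d in sequentially. measure (P d) {\<omega> \<in> space (P d). X d \<omega> \<in> F} < measure Q F + e)"
    using limit_field_exists[OF assms(3,4)] unfolding T_def by blast
  have PQ: "prob_space (P d)" "X d \<in> measurable (P d) (borel_of T)" "prob_space Q" for d
    using assms(3)[of d] Q(1) by (auto simp: gaussian_random_field_def T_def)
  note pm = portmanteau[OF PQ(1,2,3) Q(3) cl[rule_format]]
  show ?thesis
  \<comment> \<open>Canonical realization: the sample points are the fields themselves.\<close>
  proof (intro exI[of _ Q] exI[of _ "\<lambda>f. f"] conjI ballI impI Q(1,2))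
    fix A assume A: "A \<in> sets (borel_of T)"
    show "liminf (\<lambda>d. ereal (law_prob (P d) (X d) A)) \<le> limsup (\<lambda>d. ereal (law_prob (P d) (X d) A))"
      by (rule Liminf_le_Limsup) simp
  qed (use pm in simp_all)
qed

end
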